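(* Let $q=0$, let $\alpha,\beta>0$ be fixed, and for each $N$ let $I=\{a,\dots,b\}\subseteq\{1,\dots,N\}$ with $a=a(N)$ and $b=b(N)$ be an interval. (i) If $\min(\alpha,\beta)\ge\frac12$ and there exists some $\delta>0$ such that $\min(a,N-b)\ge\delta N\gg|I|$, then $$\lim_{N\to\infty}\left\|\mu_I-\mathrm{Ber}_I\left(\tfrac12\right)\right\|_{\mathrm{TV}}=0 .$$ (ii) If $\alpha<\min(\frac12,\beta)$ and $N-b\gg N^{1/3}\log(N)$, then $$\lim_{N\to\infty}\left\|\mu_I-\mathrm{Ber}_I(\alpha)\right\|_{\mathrm{TV}}=0 .$$ (iii) If $\beta<\min(\frac12,\alpha)$ and $a\gg N^{1/3}\log(N)$, then $$\lim_{N\to\infty}\left\|\mu_I-\mathrm{Ber}_I(1-\beta)\right\|_{\mathrm{TV}}=0 .$$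
   Context: The open TASEP with parameters $\alpha,\beta$ on $\{1,\dots,N\}$ is the continuous-time Markov chain on $\Omega_N=\{0,1\}^N$ with generator $$\mathcal{L}f(\eta)=\sum_{x=1}^{N-1}\eta(x)(1-\eta(x+1))[f(\eta^{x,x+1})-f(\eta)]+\alpha(1-\eta(1))[f(\eta^1)-f(\eta)]+\beta\eta(N)[f(\eta^N)-f(\eta)],$$ where $\eta^{x,y}$ is $\eta$ with the values at $x$ and $y$ swapped and $\eta^{w}$ is $\eta$ with the value at $w$ flipped (this is the open ASEP with $q=0$). It has a unique stationary distribution $\mu=\mu^{N,0,\alpha,\beta}$. For an interval $I$, $\mu_I$ denotes the projection (marginal) of $\mu$ onto the coordinates in $I$, viewed as a probability measure on $\{0,1\}^{|I|}$, and $\mathrm{Ber}_I(\rho)$ denotes the Bernoulli-$\rho$ product measure on $\{0,1\}^{|I|}$. $\|\nu-\nu'\|_{\mathrm{TV}}=\frac12\sum_x|\nu(x)-\nu'(x)|$. For functions $f,g$ of $N$, $f\gg g$ means $\liminf_{N\to\infty}f(N)/g(N)=\infty$. *)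

theory Defs
  imports "HOL-Probability.Probability"
begin

text \<open>A configuration on a finite set \<open>S\<close> of sites is an element of \<open>{0,1}\<^sup>S\<close>, encoded as an
  extensional function into \<open>bool\<close>, with \<open>True\<close> for an occupied site. The state space
  \<open>{0,1}\<^sup>N\<close> is \<open>configs {1..N}\<close>.\<close>

type_synonym config = "nat \<Rightarrow> bool"

definition configs :: "nat set \<Rightarrow> config set" where
  "configs S = S \<rightarrow>\<^sub>E UNIV"

definition swap_at :: "nat \<Rightarrow> nat \<Rightarrow> config \<Rightarrow> config" where
  "swap_at x y \<eta> = \<eta>(x := \<eta> y, y := \<eta> x)"

definition flip_at :: "nat \<Rightarrow> config \<Rightarrow> config" where
  "flip_at w \<eta> = \<eta>(w := \<not> \<eta> w)"

definition tasep_gen :: "nat \<Rightarrow> real \<Rightarrow> real \<Rightarrow> (config \<Rightarrow> real) \<Rightarrow> (config \<Rightarrow> real)" where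
  "tasep_gen N \<alpha> \<beta> f \<eta> =
     (\<Sum>x\<in>{1..<N}. of_bool (\<eta> x) * (1 - of_bool (\<eta> (x + 1))) * (f (swap_at x (x + 1) \<eta>) - f \<eta>))
     + \<alpha> * (1 - of_bool (\<eta> 1)) * (f (flip_at 1 \<eta>) - f \<eta>)
     + \<beta> * of_bool (\<eta> N) * (f (flip_at N \<eta>) - f \<eta>)"

text \<open>The Markov semigroup \<open>exp (t L)\<close> of the chain with generator \<open>L\<close>, acting on functions. For
  \<open>N \<ge> 1\<close> and \<open>\<eta> \<in> configs {1..N}\<close> the exponential series converges, since the state space is
  finite, and it depends on \<open>f\<close> only through its values on \<open>configs {1..N}\<close>.\<close>

definition tasep_semigroup ::
    "nat \<Rightarrow> real \<Rightarrow> real \<Rightarrow> real \<Rightarrow> (config \<Rightarrow> real) \<Rightarrow> (config \<Rightarrow> real)" where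
  "tasep_semigroup N \<alpha> \<beta> t f \<eta> = (\<Sum>n. t ^ n / fact n * ((tasep_gen N \<alpha> \<beta>) ^^ n) f \<eta>)"

definition tasep_stationary :: "nat \<Rightarrow> real \<Rightarrow> real \<Rightarrow> config pmf \<Rightarrow> bool" where
  "tasep_stationary N \<alpha> \<beta> \<mu> \<longleftrightarrow>
     set_pmf \<mu> \<subseteq> configs {1..N} \<and>
     (\<forall>t\<ge>0. \<forall>f. (\<Sum>\<eta>\<in>configs {1..N}. pmf \<mu> \<eta> * tasep_semigroup N \<alpha> \<beta> t f \<eta>)
                = (\<Sum>\<eta>\<in>configs {1..N}. pmf \<mu> \<eta> * f \<eta>))"

text \<open>Marginals and Bernoulli products on a set \<open>I\<close> of sites are measures on \<open>{0,1}\<^sup>I\<close>, which is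
  identified with \<open>{0,1}\<^bsup>|I|\<^esup>\<close> without renumbering the sites. The default value \<open>undefined\<close>
  makes the product measure live on extensional functions.\<close>

definition marginal :: "nat set \<Rightarrow> config pmf \<Rightarrow> config pmf" where
  "marginal I \<mu> = map_pmf (\<lambda>\<eta>. restrict \<eta> I) \<mu>"

definition Ber :: "nat set \<Rightarrow> real \<Rightarrow> config pmf" where
  "Ber I \<rho> = Pi_pmf I undefined (\<lambda>_. bernoulli_pmf \<rho>)"

definition tv_dist :: "nat set \<Rightarrow> config pmf \<Rightarrow> config pmf \<Rightarrow> real" where
  "tv_dist I \<nu> \<nu>' = 1 / 2 * (\<Sum>\<xi>\<in>configs I. \<bar>pmf \<nu> \<xi> - pmf \<nu>' \<xi>\<bar>)"

definition much_greater :: "(nat \<Rightarrow> real) \<Rightarrow> (nat \<Rightarrow> real) \<Rightarrow> bool" where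
  "much_greater f g \<longleftrightarrow> Liminf sequentially (\<lambda>N. ereal (f N / g N)) = \<infinity>"

end

theory Submission
  imports Defs
begin

text \<open>The stationary probability of a configuration is proportional to the matrix product
  \<open>\<langle>W| X\<^sub>1 \<cdots> X\<^sub>N |V\<rangle>\<close>, in which the factor of a site is \<open>D\<close> if the site is occupied and \<open>E\<close> if it is
  empty, and \<open>DE = D + E\<close>, \<open>\<langle>W|E = \<langle>W|/\<alpha>\<close>, \<open>D|V\<rangle> = |V\<rangle>/\<beta>\<close> (\<open>stationary_weight\<close>). These rules shorten every
  nonempty word, hence determine its weight (\<open>matrix_product_weight_unique\<close>). Different operators that
  obey them give the same weights, and each phase is treated with the operators that suit it. Put
  \<open>C = D + E\<close>.

  \<^bold>\<open>Low density.\<close> Enlarging the interval does not decrease the distance, so let it be \<open>{1..b}\<close>, and let \<open>r = N - b\<close>.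
  The rules turn \<open>\<langle>W|X\<close>, for a word \<open>X\<close> on \<open>{1..b}\<close>, into a combination of the covectors
  \<open>\<langle>W|D\<^sup>j\<close> with nonnegative coefficients. The weight of \<open>X\<close> is therefore a combination of the numbers
  \<open>\<langle>W|D\<^sup>jC\<^sup>r|V\<rangle>\<close>, and the Bernoulli product is the same combination of \<open>h j = (1 - \<alpha>)\<^sup>-\<^sup>j\<close>, up to
  normalization. As \<open>r\<close> grows, \<open>\<langle>W|D\<^sup>jC\<^sup>r|V\<rangle>\<close> divided by \<open>\<lambda>\<^sup>r\<close>, \<open>\<lambda> = 1/(\<alpha>(1 - \<alpha>))\<close>, converges to a
  positive multiple of \<open>h j\<close>: a recursion in \<open>j\<close> reduces this to \<open>j = 0\<close>, where the sequence is
  monotone in \<open>r\<close> and bounded away from \<open>0\<close> and \<open>\<infinity>\<close> (\<open>normalized_weight_converges\<close>,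
  \<open>right_vector_converges\<close>). The total coefficient of \<open>\<langle>W|D\<^sup>j\<close> is at most \<open>\<lambda>\<^sup>b\<alpha>\<^sup>j\<close>, uniformly in \<open>b\<close>,
  so dominated convergence together with Scheffe's trick yields the claim (\<open>marginal_error_tendsto\<close>).

  \<^bold>\<open>High density\<close> follows by particle-hole symmetry (\<open>marginal_error_reflect\<close>).

  \<^bold>\<open>Maximal current.\<close> Here the letters can be realised on functions on \<open>\<nat>\<close> by \<open>D f k = f k + f (k + 1)\<close> and
  \<open>E f k = f k + f (k - 1)\<close>, with absorption at \<open>0\<close>, so that \<open>C/4\<close> is the transition operator of a lazy
  absorbed random walk (\<open>weight_absorbed\<close>). Let \<open>R\<close> be the function that \<open>C\<^sup>r\<close> produces from the right
  boundary, \<open>r = N - b\<close>. A word \<open>X\<close> of length \<open>m\<close> moves the argument of \<open>R\<close> by a displacement whose second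
  moment, averaged over all words, is at most \<open>m/2\<close>; hence replacing \<open>X\<close> by the scalar \<open>2\<^sup>m\<close> costs at most a
  multiple of \<open>\<surd>m\<close> times the Lipschitz constant of \<open>R\<close> (\<open>word_fluctuation\<close>). The \<open>a - 1\<close> sites to the
  left contribute the probability of not being absorbed. For \<open>\<alpha>, \<beta> > 1/2\<close> and sites at distance of
  order \<open>N\<close> from both ends, the Lipschitz constant is of order \<open>N\<^sup>-\<^sup>3\<^sup>/\<^sup>2\<close>, the survival probability of order
  \<open>N\<^sup>-\<^sup>1\<^sup>/\<^sup>2\<close> and the normalization of order \<open>N\<^sup>-\<^sup>3\<^sup>/\<^sup>2\<close>, relative to \<open>4\<^sup>N\<close>, so that the error is of order
  \<open>(m/N)\<^sup>1\<^sup>/\<^sup>2\<close> (\<open>maximal_current_error\<close>). If \<open>\<alpha> > 1/2 = \<beta>\<close>, Lipschitz constant and normalization are both of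
  order \<open>N\<^sup>-\<^sup>1\<^sup>/\<^sup>2\<close>; \<open>\<alpha> = 1/2 < \<beta>\<close> is the reflection of this case, and for \<open>\<alpha> = \<beta> = 1/2\<close> the stationary
  measure is exactly the product measure.\<close>

section \<open>Matrix product weights on words\<close>

definition words :: "nat \<Rightarrow> bool list set" where
  "words n = {u. length u = n}"

definition matrix_product_weight :: "real \<Rightarrow> real \<Rightarrow> (bool list \<Rightarrow> real) \<Rightarrow> bool" where
  "matrix_product_weight \<alpha> \<beta> \<omega> \<longleftrightarrow>
     \<omega> [] = 1 \<and>
     (\<forall>v. \<omega> (False # v) = \<omega> v / \<alpha>) \<and>
     (\<forall>u. \<omega> (u @ [True]) = \<omega> u / \<beta>) \<and>
     (\<forall>u v. \<omega> (u @ True # False # v) = \<omega> (u @ True # v) + \<omega> (u @ False # v))"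

lemma words_0 [simp]: "words 0 = {[]}"
  by (auto simp: words_def)

lemma finite_words [simp]: "finite (words n)"
  using finite_lists_length_eq[of "UNIV :: bool set" n] by (simp add: words_def)

lemma card_words: "card (words n) = 2 ^ n"
  using card_lists_length_eq[of "UNIV :: bool set" n] by (simp add: words_def)

lemma sum_words_Suc:
  "(\<Sum>u\<in>words (Suc n). f u) = (\<Sum>u\<in>words n. f (True # u)) + (\<Sum>u\<in>words n. f (False # u))"
proof -
  have eq: "words (Suc n) = (Cons True) ` words n \<union> (Cons False) ` words n"
  proof (intro set_eqI iffI)
    fix x assume "x \<in> words (Suc n)"
    then obtain b u where "x = b # u" "u \<in> words n"
      by (cases x) (auto simp: words_def)
    then show "x \<in> (Cons True) ` words n \<union> (Cons False) ` words n" by (cases b) auto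
  qed (auto simp: words_def)
  show ?thesis unfolding eq
    by (subst sum.union_disjoint) (auto simp: sum.reindex)
qed

lemma sum_words_add:
  "(\<Sum>y\<in>words (m + n). f y) = (\<Sum>u\<in>words m. \<Sum>v\<in>words n. f (u @ v))"
  by (induction m arbitrary: f) (simp_all add: sum_words_Suc)

text \<open>A word that neither begins with an empty site nor ends with a particle contains a
  particle followed by an empty site; hence the rules shorten every nonempty word.\<close>

lemma word_reducible:
  assumes "u \<noteq> []"
  shows "(\<exists>v. u = False # v) \<or> (\<exists>v. u = v @ [True]) \<or> (\<exists>x y. u = x @ True # False # y)"
  using assms
proof (induction u)
  case (Cons b u)
  show ?case
  proof (cases "b \<and> u \<noteq> []")
    case True
    with Cons.IH[OF conjunct2[OF True]] consider v where "u = False # v" | v where "u = v @ [True]"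
      | x y where "u = x @ True # False # y" by blast
    then show ?thesis
    proof cases
      case 1
      with True have "b # u = [] @ True # False # v" by simp
      then show ?thesis by blast
    next
      case 2
      then have "b # u = (b # v) @ [True]" by simp
      then show ?thesis by blast
    next
      case 3
      then have "b # u = (b # x) @ True # False # y" by simp
      then show ?thesis by blast
    qed
  next
    case False
    then have "b # u = False # u \<or> b # u = [] @ [True]" by auto
    then show ?thesis by blast
  qed
qed simp

lemma matrix_product_weightD:
  assumes "matrix_product_weight \<alpha> \<beta> \<omega>"
  shows "\<omega> [] = 1" "\<omega> (False # v) = \<omega> v / \<alpha>" "\<omega> (u @ [True]) = \<omega> u / \<beta>"
    "\<omega> (u @ True # False # v) = \<omega> (u @ True # v) + \<omega> (u @ False # v)"
  using assms unfolding matrix_product_weight_def by metis+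

text \<open>Induction on the length: each rule expresses the weight of a word by weights of shorter words.\<close>

lemma matrix_product_weight_unique:
  assumes "matrix_product_weight \<alpha> \<beta> \<omega>" "matrix_product_weight \<alpha> \<beta> \<omega>'"
  shows "\<omega> u = \<omega>' u"
proof (induction "length u" arbitrary: u rule: less_induct)
  case less
  note rules = assms[THEN matrix_product_weightD(1)] assms[THEN matrix_product_weightD(2)]
    assms[THEN matrix_product_weightD(3)] assms[THEN matrix_product_weightD(4)]
  consider "u = []" | v where "u = False # v" | v where "u = v @ [True]"
    | x y where "u = x @ True # False # y" using word_reducible[of u] by blast
  then show ?case
  proof cases
    case 4
    then have "\<omega> (x @ True # y) = \<omega>' (x @ True # y)" "\<omega> (x @ False # y) = \<omega>' (x @ False # y)"
      by (auto intro!: less)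
    then show ?thesis using 4 by (simp only: rules)
  qed (use less in \<open>simp_all add: rules\<close>)
qed

text \<open>Particle-hole symmetry: reading a word backwards and exchanging particles with empty
  sites exchanges the two boundary rules and preserves the bulk rule.\<close>

definition reflect :: "bool list \<Rightarrow> bool list" where
  "reflect u = map Not (rev u)"

lemma reflect_reflect [simp]: "reflect (reflect u) = u"
  by (simp add: reflect_def rev_map comp_def)

lemma reflect_append: "reflect (u @ v) = reflect v @ reflect u"
  by (simp add: reflect_def)

lemma bij_betw_reflect: "bij_betw reflect (words n) (words n)"
  by (rule bij_betwI[of _ _ _ reflect]) (auto simp: words_def, auto simp: reflect_def)

lemma sum_reflect: "(\<Sum>u\<in>words n. f (reflect u)) = (\<Sum>u\<in>words n. f u)"
  by (rule sum.reindex_bij_betw[OF bij_betw_reflect])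

lemma matrix_product_weight_reflect:
  assumes "matrix_product_weight \<alpha> \<beta> \<omega>"
  shows "matrix_product_weight \<beta> \<alpha> (\<lambda>u. \<omega> (reflect u))"
  using assms by (simp add: matrix_product_weight_def reflect_def)

text \<open>Both realisations of the weights used below let the letters act by linear operators that
  preserve nonnegativity on real functions of a natural number.\<close>

locale letter_operators =
  fixes A :: "bool \<Rightarrow> (nat \<Rightarrow> real) \<Rightarrow> nat \<Rightarrow> real"
  assumes add: "A c (\<lambda>k. f k + g k) k = A c f k + A c g k"
    and scale: "A c (\<lambda>k. r * f k) k = r * A c f k"
    and nonneg: "(\<And>k. 0 \<le> f k) \<Longrightarrow> 0 \<le> A c f k"
begin

definition total :: "(nat \<Rightarrow> real) \<Rightarrow> nat \<Rightarrow> real" where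
  "total f k = A True f k + A False f k"

lemma zero: "A c (\<lambda>k. 0) k = 0"
  using scale[of c 0 "\<lambda>k. 0" k] by simp

lemma sum: "finite S \<Longrightarrow> A c (\<lambda>k. \<Sum>i\<in>S. F i k) k = (\<Sum>i\<in>S. A c (F i) k)"
  by (induction S rule: finite_induct) (simp_all add: zero add)

lemma total_add: "total (\<lambda>k. f k + g k) k = total f k + total g k"
  by (simp add: total_def add)

lemma total_scale: "total (\<lambda>k. r * f k) k = r * total f k"
  by (simp add: total_def scale algebra_simps)

lemma total_nonneg: "(\<And>k. 0 \<le> f k) \<Longrightarrow> 0 \<le> total f k"
  by (simp add: total_def nonneg)

lemma word_add: "foldr A u (\<lambda>k. f k + g k) k = foldr A u f k + foldr A u g k"
proof (induction u arbitrary: k)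
  case (Cons c u)
  have "foldr A u (\<lambda>k. f k + g k) = (\<lambda>k. foldr A u f k + foldr A u g k)"
    using Cons by auto
  then show ?case by (simp add: add)
qed simp

lemma word_scale: "foldr A u (\<lambda>k. r * f k) k = r * foldr A u f k"
proof (induction u arbitrary: k)
  case (Cons c u)
  have "foldr A u (\<lambda>k. r * f k) = (\<lambda>k. r * foldr A u f k)" using Cons by auto
  then show ?case by (simp add: scale)
qed simp

lemma word_diff: "foldr A u (\<lambda>k. f k - g k) k = foldr A u f k - foldr A u g k"
  using word_add[of u f "\<lambda>k. -1 * g k" k] by (simp only: word_scale) simp

lemma word_nonneg: "(\<And>k. 0 \<le> f k) \<Longrightarrow> 0 \<le> foldr A u f k"
  by (induction u arbitrary: k) (simp_all add: nonneg)

lemma power_add: "(total ^^ n) (\<lambda>k. f k + g k) k = (total ^^ n) f k + (total ^^ n) g k"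
proof (induction n arbitrary: k)
  case (Suc n)
  have "(total ^^ n) (\<lambda>k. f k + g k) = (\<lambda>k. (total ^^ n) f k + (total ^^ n) g k)"
    using Suc by auto
  then show ?case by (simp add: total_add)
qed simp

lemma power_scale: "(total ^^ n) (\<lambda>k. r * f k) k = r * (total ^^ n) f k"
proof (induction n arbitrary: k)
  case (Suc n)
  have "(total ^^ n) (\<lambda>k. r * f k) = (\<lambda>k. r * (total ^^ n) f k)" using Suc by auto
  then show ?case by (simp add: total_scale)
qed simp

lemma power_diff: "(total ^^ n) (\<lambda>k. f k - g k) k = (total ^^ n) f k - (total ^^ n) g k"
  using power_add[of n f "\<lambda>k. -1 * g k" k] by (simp only: power_scale) simp

lemma power_nonneg: "(\<And>k. 0 \<le> f k) \<Longrightarrow> 0 \<le> (total ^^ n) f k"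
  by (induction n arbitrary: k) (simp_all add: total_nonneg)

lemma power_mono: "(\<And>k. f k \<le> g k) \<Longrightarrow> (total ^^ n) f k \<le> (total ^^ n) g k"
  using power_nonneg[of "\<lambda>k. g k - f k" n k] by (simp add: power_diff)

lemma power_abs: "\<bar>(total ^^ n) f k\<bar> \<le> (total ^^ n) (\<lambda>k. \<bar>f k\<bar>) k"
proof -
  have "(total ^^ n) f k \<le> (total ^^ n) (\<lambda>k. \<bar>f k\<bar>) k" by (rule power_mono) simp
  moreover have "(total ^^ n) (\<lambda>k. -1 * f k) k \<le> (total ^^ n) (\<lambda>k. \<bar>f k\<bar>) k"
    by (rule power_mono) simp
  ultimately show ?thesis unfolding power_scale by simp
qed

lemma word_mono: "(\<And>k. f k \<le> g k) \<Longrightarrow> foldr A u f k \<le> foldr A u g k"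
  using word_nonneg[of "\<lambda>k. g k - f k" u k] by (simp add: word_diff)

lemma word_abs: "\<bar>foldr A u f k\<bar> \<le> foldr A u (\<lambda>k. \<bar>f k\<bar>) k"
proof -
  have "foldr A u f k \<le> foldr A u (\<lambda>k. \<bar>f k\<bar>) k" by (rule word_mono) simp
  moreover have "foldr A u (\<lambda>k. -1 * f k) k \<le> foldr A u (\<lambda>k. \<bar>f k\<bar>) k"
    by (rule word_mono) simp
  ultimately show ?thesis unfolding word_scale by simp
qed

lemma sum_words: "(\<Sum>u\<in>words n. foldr A u f k) = (total ^^ n) f k"
proof (induction n arbitrary: k)
  case (Suc n)
  have "(total ^^ n) f = (\<lambda>k. \<Sum>u\<in>words n. foldr A u f k)" using Suc by auto
  then have "(total ^^ Suc n) f k = total (\<lambda>k. \<Sum>u\<in>words n. foldr A u f k) k" by simp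
  also have "\<dots> = (\<Sum>u\<in>words (Suc n). foldr A u f k)"
    unfolding total_def by (simp add: sum_words_Suc sum)
  finally show ?case by simp
qed simp

lemma word_sum: "finite S \<Longrightarrow> foldr A u (\<lambda>k. \<Sum>i\<in>S. F i k) k = (\<Sum>i\<in>S. foldr A u (F i) k)"
  by (induction S rule: finite_induct) (simp_all add: word_add word_scale[of u 0 "\<lambda>_. 0", simplified])

lemma power_sum: "finite S \<Longrightarrow> (total ^^ n) (\<lambda>k. \<Sum>i\<in>S. F i k) k = (\<Sum>i\<in>S. (total ^^ n) (F i) k)"
  by (induction S rule: finite_induct) (simp_all add: power_add power_scale[of n 0 "\<lambda>_. 0", simplified])

lemma sum_words_word:
  "(\<Sum>v\<in>words n. foldr A (u @ v) f k) = foldr A u ((total ^^ n) f) k"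
proof -
  have "(total ^^ n) f = (\<lambda>k. \<Sum>v\<in>words n. foldr A v f k)"
    by (rule ext) (simp add: sum_words)
  then show ?thesis by (simp add: word_sum)
qed

lemma sum_words_abs: "(\<Sum>u\<in>words n. \<bar>foldr A u f k\<bar>) \<le> (total ^^ n) (\<lambda>k. \<bar>f k\<bar>) k"
  unfolding sum_words[symmetric] by (intro sum_mono word_abs)

end

section \<open>A positive realisation of the weights\<close>

text \<open>The function \<open>g\<close> stands for the vector whose pairing with \<open>\<langle>W|D\<^sup>j\<close> is \<open>g j\<close>. In these coordinates a
  particle shifts, and an empty site acts through \<open>\<langle>W|D\<^sup>jE = \<langle>W|D\<^sup>j + \<dots> + \<langle>W|D + \<langle>W|/\<alpha>\<close>, which
  follows from \<open>DE = D + E\<close> and \<open>\<langle>W|E = \<langle>W|/\<alpha>\<close>. All entries are nonnegative for all positive rates.\<close>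

fun hole_op :: "real \<Rightarrow> (nat \<Rightarrow> real) \<Rightarrow> nat \<Rightarrow> real" where
  "hole_op \<alpha> g 0 = g 0 / \<alpha>"
| "hole_op \<alpha> g (Suc j) = g (Suc j) + hole_op \<alpha> g j"

definition site_op :: "real \<Rightarrow> bool \<Rightarrow> (nat \<Rightarrow> real) \<Rightarrow> nat \<Rightarrow> real" where
  "site_op \<alpha> c g = (if c then (\<lambda>j. g (Suc j)) else hole_op \<alpha> g)"

definition weight :: "real \<Rightarrow> real \<Rightarrow> bool list \<Rightarrow> real" where
  "weight \<alpha> \<beta> u = foldr (site_op \<alpha>) u (\<lambda>j. (1 / \<beta>) ^ j) 0"

definition total_weight :: "real \<Rightarrow> real \<Rightarrow> nat \<Rightarrow> real" where
  "total_weight \<alpha> \<beta> n = (\<Sum>u\<in>words n. weight \<alpha> \<beta> u)"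

lemma letter_operators_site_op:
  assumes "\<alpha> > 0"
  shows "letter_operators (site_op \<alpha>)"
proof
  fix c f g k and r :: real
  have "hole_op \<alpha> (\<lambda>k. f k + g k) k = hole_op \<alpha> f k + hole_op \<alpha> g k"
    by (induction k) (simp_all add: add_divide_distrib)
  then show "site_op \<alpha> c (\<lambda>k. f k + g k) k = site_op \<alpha> c f k + site_op \<alpha> c g k"
    by (simp add: site_op_def)
  have "hole_op \<alpha> (\<lambda>k. r * f k) k = r * hole_op \<alpha> f k"
    by (induction k) (simp_all add: algebra_simps)
  then show "site_op \<alpha> c (\<lambda>k. r * f k) k = r * site_op \<alpha> c f k"
    by (simp add: site_op_def)
next
  fix f :: "nat \<Rightarrow> real" and c k
  assume f: "\<And>k. 0 \<le> f k"
  have "0 \<le> hole_op \<alpha> f k"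
    by (induction k) (use f assms in simp_all)
  then show "0 \<le> site_op \<alpha> c f k" using f by (simp add: site_op_def)
qed

lemma site_op_relation:
  "site_op \<alpha> True (site_op \<alpha> False g) = (\<lambda>j. site_op \<alpha> True g j + site_op \<alpha> False g j)"
  by (rule ext) (simp add: site_op_def)

lemma matrix_product_weight_weight:
  assumes "\<alpha> > 0"
  shows "matrix_product_weight \<alpha> \<beta> (weight \<alpha> \<beta>)"
proof -
  interpret L: letter_operators "site_op \<alpha>" using assms by (rule letter_operators_site_op)
  have particle: "site_op \<alpha> True (\<lambda>j. (1 / \<beta>) ^ j) = (\<lambda>j. (1 / \<beta>) * (1 / \<beta>) ^ j)"
    by (simp add: site_op_def)
  show ?thesis
    unfolding matrix_product_weight_def weight_def
    by (auto simp only: foldr_append foldr.simps comp_apply id_apply site_op_relation L.word_add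
          particle L.word_scale)
       (simp_all add: site_op_def)
qed

lemma weight_pos:
  assumes "\<alpha> > 0" "\<beta> > 0"
  shows "weight \<alpha> \<beta> u > 0"
proof -
  have "foldr (site_op \<alpha>) u (\<lambda>j. (1 / \<beta>) ^ j) j > 0" for j
  proof (induction u arbitrary: j)
    case Nil
    show ?case using assms by simp
  next
    case (Cons c u)
    have "hole_op \<alpha> f j > 0" if "\<And>j. f j > 0" for f :: "nat \<Rightarrow> real" and j
      by (induction j) (use that assms in \<open>simp_all add: add_pos_pos\<close>)
    with Cons show ?case by (simp add: site_op_def)
  qed
  then show ?thesis by (simp add: weight_def)
qed

lemma words_nonempty [simp]: "words n \<noteq> {}"
  by (auto simp: words_def intro: exI[of _ "replicate n True"])

lemma total_weight_pos: "\<alpha> > 0 \<Longrightarrow> \<beta> > 0 \<Longrightarrow> total_weight \<alpha> \<beta> n > 0"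
  unfolding total_weight_def by (intro sum_pos) (auto simp: weight_pos)

lemma weight_eqI:
  "\<alpha> > 0 \<Longrightarrow> matrix_product_weight \<alpha> \<beta> \<omega> \<Longrightarrow> weight \<alpha> \<beta> u = \<omega> u"
  using matrix_product_weight_unique matrix_product_weight_weight by blast

lemma weight_reflect:
  assumes "\<alpha> > 0" "\<beta> > 0"
  shows "weight \<alpha> \<beta> (reflect u) = weight \<beta> \<alpha> u"
  using weight_eqI[OF assms(2) matrix_product_weight_reflect
      [OF matrix_product_weight_weight[OF assms(1)]]]
  by simp

lemma total_weight_commute:
  assumes "\<alpha> > 0" "\<beta> > 0"
  shows "total_weight \<alpha> \<beta> n = total_weight \<beta> \<alpha> n"
  unfolding total_weight_def using sum_reflect[of "weight \<alpha> \<beta>" n]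
  by (simp add: weight_reflect[OF assms])

section \<open>Deviation of a marginal from a Bernoulli product\<close>

definition bernoulli_weight :: "real \<Rightarrow> bool list \<Rightarrow> real" where
  "bernoulli_weight \<rho> u = (\<Prod>c\<leftarrow>u. if c then \<rho> else 1 - \<rho>)"

text \<open>Twice the total variation distance from the Bernoulli product, for the marginal on \<open>m\<close> consecutive sites with \<open>l\<close> sites to
  their left and \<open>r\<close> sites to their right, in terms of words instead of configurations.\<close>

definition marginal_error ::
    "real \<Rightarrow> real \<Rightarrow> nat \<Rightarrow> nat \<Rightarrow> nat \<Rightarrow> real \<Rightarrow> real" where
  "marginal_error \<alpha> \<beta> l m r \<rho> =
     (\<Sum>x\<in>words m. \<bar>(\<Sum>u\<in>words l. \<Sum>v\<in>words r. weight \<alpha> \<beta> (u @ x @ v))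
                      / total_weight \<alpha> \<beta> (l + m + r) - bernoulli_weight \<rho> x\<bar>)"

lemma bernoulli_weight_append:
  "bernoulli_weight \<rho> (u @ v) = bernoulli_weight \<rho> u * bernoulli_weight \<rho> v"
  by (simp add: bernoulli_weight_def)

lemma sum_bernoulli_weight: "(\<Sum>u\<in>words n. bernoulli_weight \<rho> u) = 1"
  by (induction n)
     (simp_all add: sum_words_Suc bernoulli_weight_def flip: sum_distrib_left)

lemma marginal_error_nonneg: "0 \<le> marginal_error \<alpha> \<beta> l m r \<rho>"
  unfolding marginal_error_def by (intro sum_nonneg) simp

text \<open>Passing from an interval to a subinterval sums the signed deviations over the forgotten sites,
  which can only decrease the total of their absolute values.\<close>

lemma marginal_error_mono_left:
  "marginal_error \<alpha> \<beta> l m r \<rho> \<le> marginal_error \<alpha> \<beta> 0 (l + m) r \<rho>"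
proof -
  let ?Z = "total_weight \<alpha> \<beta> (l + m + r)"
  let ?d = "\<lambda>u x. (\<Sum>v\<in>words r. weight \<alpha> \<beta> (u @ x @ v)) / ?Z - bernoulli_weight \<rho> (u @ x)"
  have "(\<Sum>u\<in>words l. \<Sum>v\<in>words r. weight \<alpha> \<beta> (u @ x @ v)) / ?Z - bernoulli_weight \<rho> x
      = (\<Sum>u\<in>words l. ?d u x)" for x
    by (simp add: sum_subtractf sum_divide_distrib bernoulli_weight_append sum_bernoulli_weight
        flip: sum_distrib_right)
  then have "marginal_error \<alpha> \<beta> l m r \<rho> = (\<Sum>x\<in>words m. \<bar>\<Sum>u\<in>words l. ?d u x\<bar>)"
    by (simp add: marginal_error_def)
  also have "\<dots> \<le> (\<Sum>x\<in>words m. \<Sum>u\<in>words l. \<bar>?d u x\<bar>)"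
    by (intro sum_mono sum_abs)
  also have "\<dots> = (\<Sum>u\<in>words l. \<Sum>x\<in>words m. \<bar>?d u x\<bar>)"
    by (rule sum.swap)
  also have "\<dots> = marginal_error \<alpha> \<beta> 0 (l + m) r \<rho>"
    by (simp add: marginal_error_def sum_words_add)
  finally show ?thesis .
qed

lemma bernoulli_weight_reflect: "bernoulli_weight \<rho> (reflect u) = bernoulli_weight (1 - \<rho>) u"
proof -
  have "bernoulli_weight \<rho> (reflect u) = prod_list (rev (map (\<lambda>c. if c then 1 - \<rho> else \<rho>) u))"
    by (simp add: bernoulli_weight_def reflect_def rev_map comp_def if_distrib cong: if_cong)
       (rule arg_cong[of _ _ prod_list], simp)
  then show ?thesis by (simp add: bernoulli_weight_def cong: if_cong)
qed

lemma marginal_error_reflect: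
  assumes "\<alpha> > 0" "\<beta> > 0"
  shows "marginal_error \<alpha> \<beta> l m r \<rho> = marginal_error \<beta> \<alpha> r m l (1 - \<rho>)"
proof -
  have inner: "(\<Sum>u\<in>words l. \<Sum>v\<in>words r. weight \<alpha> \<beta> (u @ reflect x @ v))
      = (\<Sum>v\<in>words r. \<Sum>u\<in>words l. weight \<beta> \<alpha> (v @ x @ u))" for x
  proof -
    have "(\<Sum>u\<in>words l. \<Sum>v\<in>words r. weight \<alpha> \<beta> (u @ reflect x @ v))
        = (\<Sum>u\<in>words l. \<Sum>v\<in>words r. weight \<alpha> \<beta> (reflect u @ reflect x @ reflect v))"
      by (subst sum_reflect[of "\<lambda>u. \<Sum>v\<in>words r. weight \<alpha> \<beta> (u @ reflect x @ v)", symmetric],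
          rule sum.cong[OF refl], rule sum_reflect[symmetric])
    also have "\<dots> = (\<Sum>u\<in>words l. \<Sum>v\<in>words r. weight \<beta> \<alpha> (v @ x @ u))"
      by (simp add: weight_reflect[OF assms, symmetric] reflect_append)
    also have "\<dots> = (\<Sum>v\<in>words r. \<Sum>u\<in>words l. weight \<beta> \<alpha> (v @ x @ u))"
      by (rule sum.swap)
    finally show ?thesis .
  qed
  have Z: "total_weight \<alpha> \<beta> (l + m + r) = total_weight \<beta> \<alpha> (r + m + l)"
    using total_weight_commute[OF assms] by (simp add: ac_simps)
  show ?thesis
    unfolding marginal_error_def
    by (subst sum_reflect[symmetric]) (simp only: inner bernoulli_weight_reflect Z)
qed

section \<open>The low density phase\<close>

text \<open>In the realisation by \<open>site_op\<close>, dividing \<open>C\<close> by \<open>lam\<close> and conjugating by the eigenfunction \<open>h\<close> gives a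
  random walk on \<open>{0, 1, \<dots>}\<close>, reflected at \<open>0\<close>: with probability \<open>\<alpha>\<close> it goes up by one, and with
  probability \<open>1 - \<alpha>\<close> it goes down by a geometric variable. For \<open>\<alpha> < 1/2\<close> its drift is negative, and
  the stationary weights are proportional to \<open>\<alpha>\<^sup>j h j\<close>. The proof uses this walk in unnormalized form.\<close>

locale low_density =
  fixes \<alpha> \<beta> :: real
  assumes pos: "0 < \<alpha>" and half: "\<alpha> < 1 / 2" and less: "\<alpha> < \<beta>"
begin

sublocale L: letter_operators "site_op \<alpha>"
  using pos by (rule letter_operators_site_op)

abbreviation C where "C \<equiv> L.total"

definition lam :: real where "lam = 1 / (\<alpha> * (1 - \<alpha>))"

definition h :: "nat \<Rightarrow> real" where "h j = (1 / (1 - \<alpha>)) ^ j"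

definition g :: "nat \<Rightarrow> real" where "g j = (1 / \<beta>) ^ j"

definition Lam :: "(nat \<Rightarrow> real) \<Rightarrow> real" where "Lam f = (\<Sum>j. \<alpha> ^ j * f j)"

lemma beta_pos: "\<beta> > 0" using pos less by simp

lemma lam_pos: "lam > 0" using pos half by (simp add: lam_def)

lemma lam_eq: "1 / \<alpha> + 1 / (1 - \<alpha>) = lam"
  using pos half by (simp add: lam_def field_simps)

lemma h_pos: "h j > 0" using half by (simp add: h_def)

lemma g_pos: "g j > 0" using beta_pos by (simp add: g_def)

lemma C_0: "C f 0 = f 1 + f 0 / \<alpha>"
  by (simp add: L.total_def site_op_def)

lemma C_Suc: "C f (Suc j) = f (Suc (Suc j)) + C f j"
  by (simp add: L.total_def site_op_def)

lemma hole_op_h: "hole_op \<alpha> h j = h j / \<alpha>"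
  by (induction j) (use pos half in \<open>simp_all add: h_def field_simps\<close>)

lemma C_h: "C h j = lam * h j"
proof -
  have "h (Suc j) = h j / (1 - \<alpha>)" by (simp add: h_def)
  then show ?thesis by (simp add: L.total_def site_op_def hole_op_h algebra_simps flip: lam_eq)
qed

lemma power_C_h: "(C ^^ n) h j = lam ^ n * h j"
proof (induction n arbitrary: j)
  case (Suc n)
  have "(C ^^ n) h = (\<lambda>j. lam ^ n * h j)" using Suc by auto
  then show ?case by (simp add: L.total_scale C_h)
qed simp

lemma word_h: "foldr (site_op \<alpha>) u h j = lam ^ length u * bernoulli_weight \<alpha> u * h j"
proof (induction u arbitrary: j)
  case (Cons c u)
  have eq: "foldr (site_op \<alpha>) u h = (\<lambda>j. lam ^ length u * bernoulli_weight \<alpha> u * h j)"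
    using Cons by auto
  have step: "site_op \<alpha> c h j = lam * (if c then \<alpha> else 1 - \<alpha>) * h j"
    using pos half by (simp add: site_op_def hole_op_h lam_def) (simp add: h_def)
  have "foldr (site_op \<alpha>) (c # u) h j
      = lam ^ length u * bernoulli_weight \<alpha> u * (lam * (if c then \<alpha> else 1 - \<alpha>) * h j)"
    by (simp only: foldr.simps comp_apply eq L.scale step)
  then show ?case by (simp add: bernoulli_weight_def)
qed (simp add: bernoulli_weight_def)

text \<open>This is the stationarity of the weights \<open>\<alpha>\<^sup>j\<close>. Summability for \<open>hole_op\<close> has to be shown first; it
  follows from its recursion, which bounds a partial sum by a constant plus \<open>\<alpha>\<close> times itself.\<close>

lemma Lam_C:
  assumes nonneg: "\<And>j. 0 \<le> f j" and f: "summable (\<lambda>j. \<alpha> ^ j * f j)"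
  shows "summable (\<lambda>j. \<alpha> ^ j * C f j)" and "Lam (C f) = lam * Lam f"
proof -
  let ?a = "\<lambda>j. \<alpha> ^ j * f j" and ?e = "\<lambda>j. \<alpha> ^ j * hole_op \<alpha> f j"
  have hole_nonneg: "0 \<le> hole_op \<alpha> f j" for j
    using L.nonneg[of f False j] nonneg by (simp add: site_op_def)
  have e_nonneg: "0 \<le> ?e j" for j using hole_nonneg pos by simp
  have e_Suc: "?e (Suc j) = ?a (Suc j) + \<alpha> * ?e j" for j
    by (simp add: algebra_simps)
  have a_Suc: "summable (\<lambda>j. ?a (Suc j))" using f by (subst summable_Suc_iff)
  have a_suminf: "(\<Sum>j. ?a (Suc j)) = Lam f - f 0"
    using suminf_split_head[OF f] by (simp add: Lam_def)
  have bound: "(\<Sum>j<n. ?e j) \<le> (f 0 / \<alpha> + Lam f) / (1 - \<alpha>)" for n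
  proof -
    have "(\<Sum>j<n. ?e j) \<le> (\<Sum>j<Suc n. ?e j)" using e_nonneg by simp
    also have "\<dots> = f 0 / \<alpha> + (\<Sum>j<n. ?a (Suc j)) + \<alpha> * (\<Sum>j<n. ?e j)"
      by (simp only: sum.lessThan_Suc_shift e_Suc sum.distrib sum_distrib_left) simp
    also have "(\<Sum>j<n. ?a (Suc j)) \<le> (\<Sum>j. ?a (Suc j))"
      using a_Suc nonneg pos by (intro sum_le_suminf) auto
    also have "\<dots> \<le> Lam f" using a_suminf nonneg[of 0] by simp
    finally have "(1 - \<alpha>) * (\<Sum>j<n. ?e j) \<le> f 0 / \<alpha> + Lam f" by (simp add: algebra_simps)
    then show ?thesis using half by (simp add: field_simps)
  qed
  have e: "summable ?e" by (rule summableI_nonneg_bounded[OF e_nonneg bound])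
  have "suminf ?e - f 0 / \<alpha> = (\<Sum>j. ?e (Suc j))"
    using suminf_split_head[OF e] by simp
  also have "\<dots> = Lam f - f 0 + \<alpha> * suminf ?e"
    by (simp only: e_Suc suminf_add[OF a_Suc summable_mult[OF e], symmetric] suminf_mult[OF e]
        a_suminf)
  finally have e_sum: "(1 - \<alpha>) * suminf ?e = f 0 / \<alpha> + Lam f - f 0" by (simp add: algebra_simps)
  have shift: "\<alpha> ^ j * f (Suc j) = ?a (Suc j) / \<alpha>" for j using pos by simp
  have s: "summable (\<lambda>j. \<alpha> ^ j * f (Suc j))" unfolding shift using a_Suc by (rule summable_divide)
  have s_sum: "(\<Sum>j. \<alpha> ^ j * f (Suc j)) = (Lam f - f 0) / \<alpha>"
    unfolding shift using a_Suc by (simp only: suminf_divide a_suminf)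
  have C: "\<alpha> ^ j * C f j = \<alpha> ^ j * f (Suc j) + ?e j" for j
    by (simp add: L.total_def site_op_def algebra_simps)
  show "summable (\<lambda>j. \<alpha> ^ j * C f j)" unfolding C using s e by (rule summable_add)
  have "Lam (C f) = (Lam f - f 0) / \<alpha> + suminf ?e"
    unfolding Lam_def C using s e s_sum by (simp add: suminf_add[symmetric] Lam_def)
  also have "suminf ?e = (f 0 / \<alpha> + Lam f - f 0) / (1 - \<alpha>)"
    using e_sum half by (simp add: field_simps)
  finally show "Lam (C f) = lam * Lam f"
    using pos half by (simp add: lam_def field_simps)
qed

lemma Lam_power_C:
  assumes nonneg: "\<And>j. 0 \<le> f j" and f: "summable (\<lambda>j. \<alpha> ^ j * f j)"
  shows "summable (\<lambda>j. \<alpha> ^ j * (C ^^ n) f j) \<and> Lam ((C ^^ n) f) = lam ^ n * Lam f"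
proof (induction n)
  case (Suc n)
  then show ?case
    using Lam_C[of "(C ^^ n) f"] L.power_nonneg[of f n] nonneg by simp
qed (use f in simp)

text \<open>The stationary sum contains the term of \<open>j = 0\<close>. Read as a statement on the coefficients of
  \<open>\<langle>W|C\<^sup>n\<close>, this says that \<open>\<langle>W|D\<^sup>j\<close> has coefficient at most \<open>lam\<^sup>n \<alpha>\<^sup>j\<close>.\<close>

lemma power_C_le_Lam:
  assumes nonneg: "\<And>j. 0 \<le> f j" and f: "summable (\<lambda>j. \<alpha> ^ j * f j)"
  shows "(C ^^ n) f 0 \<le> lam ^ n * Lam f"
proof -
  note * = Lam_power_C[OF assms, of n]
  have "(\<Sum>j<1. \<alpha> ^ j * (C ^^ n) f j) \<le> (\<Sum>j. \<alpha> ^ j * (C ^^ n) f j)"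
    using * nonneg pos by (intro sum_le_suminf) (auto intro!: mult_nonneg_nonneg L.power_nonneg)
  then show ?thesis using * by (simp add: Lam_def)
qed

text \<open>Divided by \<open>h\<close>, the condition says that \<open>f\<close> is nondecreasing. It is inherited by \<open>C f\<close> since
  \<open>C f / (lam h)\<close> averages \<open>f / h\<close> over \<open>{0..j+1}\<close>.\<close>

definition rel_incr :: "(nat \<Rightarrow> real) \<Rightarrow> bool" where
  "rel_incr f \<longleftrightarrow> (\<forall>j. f j \<le> (1 - \<alpha>) * f (Suc j))"

lemma rel_incr_C:
  assumes "rel_incr f"
  shows "rel_incr (C f)" and "lam * f 0 \<le> C f 0"
proof -
  have f: "f j \<le> (1 - \<alpha>) * f (Suc j)" for j using assms by (simp add: rel_incr_def)
  have avg: "\<alpha> * C f j \<le> f (Suc j)" for j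
  proof (induction j)
    case 0
    show ?case using f[of 0] pos by (simp add: C_0 algebra_simps)
  next
    case (Suc j)
    then show ?case using f[of "Suc j"] by (simp add: C_Suc algebra_simps)
  qed
  show "rel_incr (C f)" unfolding rel_incr_def
  proof
    fix j
    show "C f j \<le> (1 - \<alpha>) * C f (Suc j)"
      using avg[of j] f[of "Suc j"] by (simp add: C_Suc algebra_simps)
  qed
  have "f 0 / (1 - \<alpha>) \<le> f 1" using f[of 0] half by (simp add: field_simps)
  then have "f 0 * (1 / \<alpha> + 1 / (1 - \<alpha>)) \<le> C f 0" by (simp add: C_0 algebra_simps)
  then show "lam * f 0 \<le> C f 0" unfolding lam_eq by (simp add: mult.commute)
qed

lemma rel_incr_power: "rel_incr f \<Longrightarrow> rel_incr ((C ^^ n) f)"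
  by (induction n) (simp_all add: rel_incr_C)

text \<open>A monotone function of the walk has monotone expectation if the walk starts at its minimum \<open>0\<close>.\<close>

lemma rel_incr_limit_mono:
  assumes "rel_incr f"
  shows "incseq (\<lambda>n. (C ^^ n) f 0 / lam ^ n)"
proof (rule incseq_SucI)
  fix n
  have "lam * (C ^^ n) f 0 \<le> (C ^^ Suc n) f 0"
    using rel_incr_C(2)[OF rel_incr_power[OF assms, of n]] by simp
  then show "(C ^^ n) f 0 / lam ^ n \<le> (C ^^ Suc n) f 0 / lam ^ Suc n"
    using lam_pos by (simp add: field_simps)
qed

lemma summable_g: "summable (\<lambda>j. \<alpha> ^ j * g j)"
proof -
  have "(\<lambda>j. \<alpha> ^ j * g j) = (\<lambda>j. (\<alpha> / \<beta>) ^ j)" by (simp add: g_def fun_eq_iff power_divide)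
  moreover have "norm (\<alpha> / \<beta>) < 1" using pos less by simp
  ultimately show ?thesis by (simp only: summable_geometric)
qed

lemma summable_h: "summable (\<lambda>j. \<alpha> ^ j * h j)"
proof -
  have "(\<lambda>j. \<alpha> ^ j * h j) = (\<lambda>j. (\<alpha> / (1 - \<alpha>)) ^ j)"
    by (simp add: h_def fun_eq_iff power_divide)
  moreover have "norm (\<alpha> / (1 - \<alpha>)) < 1" using pos half by simp
  ultimately show ?thesis by (simp only: summable_geometric)
qed

lemma Lam_pos: "(\<And>j. f j > 0) \<Longrightarrow> summable (\<lambda>j. \<alpha> ^ j * f j) \<Longrightarrow> Lam f > 0"
  unfolding Lam_def using pos by (intro suminf_pos) auto

text \<open>The function \<open>g / h\<close> is nondecreasing if \<open>\<beta> \<le> 1 - \<alpha>\<close> and nonincreasing otherwise, so the sequence is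
  monotone. In the nondecreasing case it is bounded above by stationarity and below by its first term;
  in the nonincreasing case its terms are largest at \<open>j = 0\<close>, hence at least the stationary mean.\<close>

lemma normalized_weight_converges:
  obtains c where "c > 0" "(\<lambda>n. (C ^^ n) g 0 / lam ^ n) \<longlonglongrightarrow> c"
proof -
  let ?z = "\<lambda>n. (C ^^ n) g 0 / lam ^ n"
  show ?thesis
  proof (cases "\<beta> \<le> 1 - \<alpha>")
    case True
    have "rel_incr g" unfolding rel_incr_def
    proof
      fix j
      have "g j * \<beta> \<le> g j * (1 - \<alpha>)" using True g_pos[of j] by (intro mult_left_mono) auto
      then show "g j \<le> (1 - \<alpha>) * g (Suc j)" using beta_pos by (simp add: g_def field_simps)
    qed
    then have mono: "incseq ?z" by (rule rel_incr_limit_mono)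
    have "?z n \<le> Lam g" for n
      using power_C_le_Lam[OF less_imp_le[OF g_pos] summable_g, of n] lam_pos
      by (simp add: field_simps)
    then obtain c where c: "?z \<longlonglongrightarrow> c" "\<forall>i. ?z i \<le> c"
      using incseq_convergent[OF mono] by blast
    moreover from c(2) have "?z 0 \<le> c" by blast
    ultimately have "c > 0" by (simp add: g_def)
    with c(1) show ?thesis using that by blast
  next
    case False
    have "rel_incr (\<lambda>j. -1 * g j)" unfolding rel_incr_def
    proof
      fix j
      have "g j * (1 - \<alpha>) \<le> g j * \<beta>" using False g_pos[of j] by (intro mult_left_mono) auto
      then show "-1 * g j \<le> (1 - \<alpha>) * (-1 * g (Suc j))"
        using beta_pos by (simp add: g_def field_simps)
    qed
    then have incr: "rel_incr (\<lambda>j. -1 * (C ^^ n) g j)" for n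
      using rel_incr_power[of "\<lambda>j. -1 * g j" n] by (simp only: L.power_scale[abs_def])
    have "incseq (\<lambda>n. (C ^^ n) (\<lambda>j. -1 * g j) 0 / lam ^ n)"
      by (rule rel_incr_limit_mono) fact
    then have mono: "decseq ?z"
      unfolding L.power_scale by (simp add: decseq_eq_incseq)
    have "?z n \<ge> Lam g / Lam h" for n
    proof -
      have le: "(C ^^ n) g j \<le> h j * (C ^^ n) g 0" for j
      proof (induction j)
        case (Suc j)
        have "(1 - \<alpha>) * (C ^^ n) g (Suc j) \<le> (C ^^ n) g j"
          using incr[of n] by (simp add: rel_incr_def)
        with Suc have "(1 - \<alpha>) * (C ^^ n) g (Suc j) \<le> h j * (C ^^ n) g 0" by linarith
        then show ?case using half by (simp add: h_def field_simps)
      qed (simp add: h_def)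
      have "lam ^ n * Lam g = Lam ((C ^^ n) g)"
        using Lam_power_C[OF less_imp_le[OF g_pos] summable_g, of n] by simp
      also have "\<dots> \<le> (\<Sum>j. \<alpha> ^ j * h j * (C ^^ n) g 0)"
        unfolding Lam_def
      proof (rule suminf_le)
        show "summable (\<lambda>j. \<alpha> ^ j * (C ^^ n) g j)"
          using Lam_power_C[OF less_imp_le[OF g_pos] summable_g, of n] by simp
        show "summable (\<lambda>j. \<alpha> ^ j * h j * (C ^^ n) g 0)"
          using summable_h by (rule summable_mult2)
        show "\<alpha> ^ j * (C ^^ n) g j \<le> \<alpha> ^ j * h j * (C ^^ n) g 0" for j
          using le[of j] pos by (simp add: mult.assoc)
      qed
      also have "\<dots> = Lam h * (C ^^ n) g 0"
        unfolding Lam_def using summable_h by (rule suminf_mult2[symmetric])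
      finally have "lam ^ n * Lam g \<le> Lam h * (C ^^ n) g 0" .
      then show ?thesis
        using Lam_pos[OF h_pos summable_h] lam_pos by (simp add: field_simps)
    qed
    moreover have "Lam g / Lam h > 0"
      using Lam_pos[OF h_pos summable_h] Lam_pos[OF g_pos summable_g] by simp
    ultimately obtain c where c: "?z \<longlonglongrightarrow> c"
      using decseq_convergent[OF mono] by blast
    have "Lam g / Lam h \<le> c"
      by (rule LIMSEQ_le_const[OF c]) (use \<open>\<And>n. ?z n \<ge> Lam g / Lam h\<close> in blast)
    with \<open>Lam g / Lam h > 0\<close> c show ?thesis using that[of c] by simp
  qed
qed

text \<open>The values at \<open>j > 0\<close> are linear combinations of values at smaller \<open>j\<close> for \<open>n\<close> and \<open>n + 1\<close>, by \<open>C_0\<close> and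
  \<open>C_Suc\<close>; \<open>c h j\<close> satisfies the limiting recursion.\<close>

lemma right_vector_converges:
  assumes "(\<lambda>n. (C ^^ n) g 0 / lam ^ n) \<longlonglongrightarrow> c"
  shows "(\<lambda>n. (C ^^ n) g j / lam ^ n) \<longlonglongrightarrow> c * h j"
proof -
  let ?y = "\<lambda>j n. (C ^^ n) g j / lam ^ n"
  have shift: "C ((C ^^ n) g) j / lam ^ n = lam * ?y j (Suc n)" for j n
    using lam_pos by simp
  have "?y j \<longlonglongrightarrow> c * h j \<and> ?y (Suc j) \<longlonglongrightarrow> c * h (Suc j)"
  proof (induction j)
    case 0
    have "?y (Suc 0) n = lam * ?y 0 (Suc n) - ?y 0 n / \<alpha>" for n
      by (simp only: shift[symmetric] C_0) (simp add: add_divide_distrib mult.commute)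
    then have eq: "?y (Suc 0) = (\<lambda>n. lam * ?y 0 (Suc n) - ?y 0 n / \<alpha>)" by (rule ext)
    have "(\<lambda>n. lam * ?y 0 (Suc n) - ?y 0 n / \<alpha>) \<longlonglongrightarrow> lam * c - c / \<alpha>"
      by (intro tendsto_intros LIMSEQ_Suc assms) (use pos in simp)
    moreover have "lam * c - c / \<alpha> = c * h (Suc 0)"
      unfolding lam_eq[symmetric] by (simp add: h_def algebra_simps)
    ultimately have "?y (Suc 0) \<longlonglongrightarrow> c * h (Suc 0)" unfolding eq by simp
    moreover have "?y 0 \<longlonglongrightarrow> c * h 0" using assms by (simp add: h_def)
    ultimately show ?case by blast
  next
    case (Suc j)
    have "?y (Suc (Suc j)) n = lam * (?y (Suc j) (Suc n) - ?y j (Suc n))" for n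
      by (simp only: right_diff_distrib shift[symmetric] C_Suc) (simp add: add_divide_distrib)
    then have eq: "?y (Suc (Suc j)) = (\<lambda>n. lam * (?y (Suc j) (Suc n) - ?y j (Suc n)))"
      by (rule ext)
    have "(\<lambda>n. lam * (?y (Suc j) (Suc n) - ?y j (Suc n)))
        \<longlonglongrightarrow> lam * (c * h (Suc j) - c * h j)"
      by (rule tendsto_mult[OF tendsto_const tendsto_diff])
         (rule LIMSEQ_Suc, simp add: Suc)+
    moreover have "lam * (c * h (Suc j) - c * h j) = c * h (Suc (Suc j))"
    proof -
      have "lam * (c * h (Suc j) - c * h j) = c * h j * (lam * (1 / (1 - \<alpha>) - 1))"
        by (simp add: h_def algebra_simps)
      also have "1 / (1 - \<alpha>) - 1 = \<alpha> / (1 - \<alpha>)"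
        using half by (simp add: field_simps)
      also have "lam * (\<alpha> / (1 - \<alpha>)) = 1 / (1 - \<alpha>) * (1 / (1 - \<alpha>))"
        using pos by (simp add: lam_def)
      finally show ?thesis by (simp add: h_def)
    qed
    ultimately show ?case using Suc eq by simp
  qed
  then show ?thesis by blast
qed

lemma weight_eq: "weight \<alpha> \<beta> u = foldr (site_op \<alpha>) u g 0"
  by (simp add: weight_def g_def[abs_def])

lemma total_weight_eq: "total_weight \<alpha> \<beta> n = (C ^^ n) g 0"
  by (simp add: total_weight_def weight_eq L.sum_words)

text \<open>By the triangle inequality the deviation is at most \<open>(C\<^sup>m |\<psi>|) 0\<close>, where \<open>\<psi>\<close> is the difference of the
  normalized right vectors. Since \<open>(C\<^sup>m \<psi>) 0 = 1 - 1\<close>, the absolute value may be replaced by twice the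
  negative part (Scheffe's trick), which stays below a multiple of \<open>h\<close> and is therefore dominated.\<close>

lemma left_marginal_error_bound:
  fixes m r defines "Z \<equiv> total_weight \<alpha> \<beta> (m + r)"
  shows "marginal_error \<alpha> \<beta> 0 m r \<alpha> \<le> 2 * Lam (\<lambda>j. max 0 (h j - lam ^ m * (C ^^ r) g j / Z))"
proof -
  let ?\<psi> = "\<lambda>j. 1 / Z * (C ^^ r) g j - 1 / lam ^ m * h j"
  let ?\<phi> = "\<lambda>j. max 0 (h j - lam ^ m * (C ^^ r) g j / Z)"
  have Z: "Z > 0" unfolding Z_def by (rule total_weight_pos[OF pos beta_pos])
  have "(\<Sum>v\<in>words r. weight \<alpha> \<beta> (x @ v)) / Z - bernoulli_weight \<alpha> x
      = foldr (site_op \<alpha>) x ?\<psi> 0" if "x \<in> words m" for x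
  proof -
    have "(\<Sum>v\<in>words r. weight \<alpha> \<beta> (x @ v)) / Z = foldr (site_op \<alpha>) x ((C ^^ r) g) 0 / Z"
      by (simp only: weight_eq L.sum_words_word)
    moreover have "foldr (site_op \<alpha>) x h 0 / lam ^ m = bernoulli_weight \<alpha> x"
      using lam_pos that by (simp add: word_h words_def h_def)
    ultimately show ?thesis
      by (simp only: L.word_diff L.word_scale) simp
  qed
  then have "marginal_error \<alpha> \<beta> 0 m r \<alpha> = (\<Sum>x\<in>words m. \<bar>foldr (site_op \<alpha>) x ?\<psi> 0\<bar>)"
    by (simp add: marginal_error_def Z_def)
  also have "\<dots> \<le> (C ^^ m) (\<lambda>j. \<bar>?\<psi> j\<bar>) 0" by (rule L.sum_words_abs)
  also have "(\<lambda>j. \<bar>?\<psi> j\<bar>) = (\<lambda>j. ?\<psi> j + 2 / lam ^ m * ?\<phi> j)"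
  proof
    fix j
    have "2 / lam ^ m * ?\<phi> j = 2 * max 0 (- ?\<psi> j)"
    proof -
      have "1 / lam ^ m * max 0 (h j - lam ^ m * (C ^^ r) g j / Z)
          = max (1 / lam ^ m * 0) (1 / lam ^ m * (h j - lam ^ m * (C ^^ r) g j / Z))"
        using lam_pos by (intro max_mult_distrib_left[THEN trans]) simp
      then show ?thesis using lam_pos by (simp add: algebra_simps)
    qed
    moreover have "\<bar>x\<bar> = x + 2 * max 0 (- x)" for x :: real by simp
    ultimately show "\<bar>?\<psi> j\<bar> = ?\<psi> j + 2 / lam ^ m * ?\<phi> j" by (simp only:)
  qed
  also have "(C ^^ m) (\<lambda>j. ?\<psi> j + 2 / lam ^ m * ?\<phi> j) 0
      = (1 / Z * (C ^^ m) ((C ^^ r) g) 0 - 1 / lam ^ m * (C ^^ m) h 0)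
        + 2 / lam ^ m * (C ^^ m) ?\<phi> 0"
    by (simp only: L.power_add L.power_diff L.power_scale)
  also have "(C ^^ m) ((C ^^ r) g) 0 = Z"
    by (simp add: Z_def total_weight_eq funpow_add)
  also have "1 / Z * Z - 1 / lam ^ m * (C ^^ m) h 0 = 0"
    using Z lam_pos by (simp add: power_C_h h_def)
  also have "(C ^^ m) ?\<phi> 0 \<le> lam ^ m * Lam ?\<phi>"
  proof (rule power_C_le_Lam)
    have "\<bar>\<alpha> ^ j * ?\<phi> j\<bar> \<le> \<alpha> ^ j * h j" for j
    proof -
      have "0 \<le> lam ^ m * (C ^^ r) g j / Z"
        using Z lam_pos L.power_nonneg[of g r j] g_pos by (simp add: less_imp_le)
      then have "?\<phi> j \<le> h j" using h_pos[of j] by simp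
      then show ?thesis using pos by (simp add: abs_mult)
    qed
    then show "summable (\<lambda>j. \<alpha> ^ j * ?\<phi> j)"
      by (intro summable_comparison_test[OF _ summable_h]) auto
  qed simp
  finally show ?thesis using lam_pos by (simp add: mult_left_mono divide_right_mono)
qed

text \<open>The bound above is a sum over \<open>j\<close> whose terms tend to \<open>0\<close> and are dominated by the summable
  \<open>\<alpha>\<^sup>j h j\<close>, with a majorant that depends neither on the interval nor on \<open>r\<close>.\<close>

lemma marginal_error_tendsto:
  assumes "filterlim r at_top sequentially"
  shows "(\<lambda>k. marginal_error \<alpha> \<beta> (l k) (m k) (r k) \<alpha>) \<longlonglongrightarrow> 0"
proof -
  obtain c where c: "c > 0" and z: "(\<lambda>n. (C ^^ n) g 0 / lam ^ n) \<longlonglongrightarrow> c"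
    by (rule normalized_weight_converges)
  define s where "s k = l k + m k" for k
  define \<phi> where
    "\<phi> j k = max 0 (h j - lam ^ s k * (C ^^ r k) g j / total_weight \<alpha> \<beta> (s k + r k))" for j k
  have large: "filterlim (\<lambda>k. s k + r k) at_top sequentially"
    by (rule filterlim_at_top_mono[OF assms]) simp
  have eq: "lam ^ s k * (C ^^ r k) g j / total_weight \<alpha> \<beta> (s k + r k)
      = ((C ^^ r k) g j / lam ^ r k) / ((C ^^ (s k + r k)) g 0 / lam ^ (s k + r k))" for j k
    using lam_pos by (simp add: total_weight_eq power_add)
  have ratio: "(\<lambda>k. lam ^ s k * (C ^^ r k) g j / total_weight \<alpha> \<beta> (s k + r k)) \<longlonglongrightarrow> c * h j / c" for j
    unfolding eq
    using filterlim_compose[OF right_vector_converges[OF z] assms]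
      filterlim_compose[OF z large] c
    by (intro tendsto_divide) auto
  have "(\<lambda>k. \<alpha> ^ j * \<phi> j k) \<longlonglongrightarrow> \<alpha> ^ j * max 0 (h j - c * h j / c)" for j
    unfolding \<phi>_def by (intro tendsto_mult tendsto_max tendsto_diff tendsto_const ratio)
  then have lim: "(\<lambda>k. \<alpha> ^ j * \<phi> j k) \<longlonglongrightarrow> 0" for j using c by simp
  have bound: "norm (\<alpha> ^ j * \<phi> j k) \<le> \<alpha> ^ j * h j" for j k
  proof -
    have "0 \<le> lam ^ s k * (C ^^ r k) g j / total_weight \<alpha> \<beta> (s k + r k)"
      using total_weight_pos[OF pos beta_pos, of "s k + r k"] lam_pos
        L.power_nonneg[of g "r k" j] g_pos by (simp add: less_imp_le)
    then have "0 \<le> \<phi> j k" "\<phi> j k \<le> h j" using h_pos[of j] by (simp_all add: \<phi>_def)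
    then show ?thesis using pos by (simp add: abs_mult)
  qed
  have "(\<lambda>k. Lam (\<lambda>j. \<phi> j k)) \<longlonglongrightarrow> (\<Sum>j. 0)"
    unfolding Lam_def
    by (rule tannerys_theorem[THEN conjunct2, THEN conjunct2, OF lim _ summable_h])
       (use bound in \<open>auto intro!: always_eventually\<close>)
  then have "(\<lambda>k. 2 * Lam (\<lambda>j. \<phi> j k)) \<longlonglongrightarrow> 2 * 0"
    by (intro tendsto_mult) auto
  then have lim0: "(\<lambda>k. 2 * Lam (\<lambda>j. \<phi> j k)) \<longlonglongrightarrow> 0" by simp
  have "marginal_error \<alpha> \<beta> (l k) (m k) (r k) \<alpha> \<le> 2 * Lam (\<lambda>j. \<phi> j k)" for k
    using marginal_error_mono_left[of \<alpha> \<beta> "l k" "m k" "r k" \<alpha>]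
      left_marginal_error_bound[of "s k" "r k"]
    by (simp add: \<phi>_def s_def)
  then show ?thesis
    by (intro tendsto_sandwich[OF _ _ tendsto_const lim0])
       (auto intro!: always_eventually marginal_error_nonneg)
qed

end

section \<open>The kernel of the lazy random walk\<close>

text \<open>\<open>kern n x\<close> is the probability that a walk on \<open>\<int>\<close> with steps \<open>-1, 0, 1\<close> of probabilities
  \<open>1/4, 1/2, 1/4\<close> is at \<open>x\<close> after \<open>n\<close> steps, that is, \<open>(2n choose n + x)/4\<^sup>n\<close>. The recursion avoids binomial
  coefficients with negative arguments; \<open>kern_ratio\<close> is the quotient of neighbouring coefficients.\<close>

fun kern :: "nat \<Rightarrow> int \<Rightarrow> real" where
  "kern 0 x = of_bool (x = 0)"
| "kern (Suc n) x = (kern n (x - 1) + 2 * kern n x + kern n (x + 1)) / 4"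

lemma kern_minus: "kern n (- x) = kern n x"
proof (induction n arbitrary: x)
  case (Suc n)
  have "kern n (- x - 1) = kern n (x + 1)" using Suc[of "x + 1"] by simp
  moreover have "kern n (- x + 1) = kern n (x - 1)" using Suc[of "x - 1"] by simp
  ultimately show ?case using Suc[of x] by simp
qed simp

lemma kern_nonneg: "0 \<le> kern n x"
  by (induction n arbitrary: x) simp_all

lemma kern_ratio: "(real n + of_int x + 1) * kern n (x + 1) = (real n - of_int x) * kern n x"
proof (induction n arbitrary: x)
  case (Suc n)
  have 1: "(real n + of_int x + 2) * kern n (x + 2) = (real n - of_int x - 1) * kern n (x + 1)"
    using Suc[of "x + 1"] by (simp add: algebra_simps)
  have 2: "(real n + of_int x) * kern n x = (real n - of_int x + 1) * kern n (x - 1)"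
    using Suc[of "x - 1"] by (simp add: algebra_simps)
  have "(N + X + 2) * (B + 2 * C + D) = (N + 1 - X) * (A + 2 * B + C)"
    if "(N + X + 1) * C = (N - X) * B" "(N + X + 2) * D = (N - X - 1) * C"
      "(N + X) * B = (N - X + 1) * A" for N X A B C D :: real
    using that by algebra
  from this[OF Suc[of x] 1 2] show ?case by (simp add: add.commute add.left_commute)
qed simp

text \<open>Since \<open>4 (kern (n + 1) x - kern n x)\<close> is the second difference of \<open>kern n\<close> at \<open>x\<close>, this gives the
  second difference in closed form.\<close>

lemma kern_Suc_eq:
  "((real n + 1)\<^sup>2 - (of_int x)\<^sup>2) * (kern (Suc n) x - kern n x)
     = ((of_int x)\<^sup>2 - (real n + 1) / 2) * kern n x"
proof -
  let ?p = "real n + 1 + of_int x" and ?q = "real n + 1 - of_int x"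
  have 1: "?p * kern n (x + 1) = (real n - of_int x) * kern n x"
    using kern_ratio[of n x] by (simp add: algebra_simps)
  have 2: "?q * kern n (x - 1) = (real n + of_int x) * kern n x"
    using kern_ratio[of n "x - 1"] by (simp add: algebra_simps)
  have "(real n + 1)\<^sup>2 - (of_int x)\<^sup>2 = ?p * ?q" by (simp add: power2_eq_square algebra_simps)
  moreover have "?p * ?q * (kern (Suc n) x - kern n x)
      = (?p * (?q * kern n (x - 1)) + ?q * (?p * kern n (x + 1)) - 2 * (?p * ?q) * kern n x) / 4"
    by (simp add: field_simps)
  moreover have "\<dots> = ((of_int x)\<^sup>2 - (real n + 1) / 2) * kern n x"
    unfolding 1 2 by (simp add: power2_eq_square field_simps)
  ultimately show ?thesis by simp
qed

text \<open>A crude substitute for the Gaussian tail: the left hand side is nonincreasing in \<open>|x|\<close> by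
  \<open>kern_ratio\<close>, and the right hand side is its value at \<open>0\<close>.\<close>

lemma kern_tail: "(2 * real n + (of_int x)\<^sup>2) * kern n x \<le> 2 * real n * kern n 0"
proof -
  have nat: "(2 * real n + (real k)\<^sup>2) * kern n (int k) \<le> 2 * real n * kern n 0" for k
  proof (induction k)
    case (Suc k)
    let ?k = "real k"
    have "(real n + ?k + 1) * ((2 * real n + (?k + 1)\<^sup>2) * kern n (int k + 1))
        = (2 * real n + (?k + 1)\<^sup>2) * ((real n - ?k) * kern n (int k))"
      using kern_ratio[of n "int k"] unfolding of_int_of_nat_eq by algebra
    also have "\<dots> \<le> (real n + ?k + 1) * ((2 * real n + ?k\<^sup>2) * kern n (int k))"
    proof -
      have "(real n + ?k + 1) * (2 * real n + ?k\<^sup>2) - (2 * real n + (?k + 1)\<^sup>2) * (real n - ?k)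
          = 2 * real n * ?k + real n + 2 * ?k ^ 3 + 3 * ?k\<^sup>2 + ?k"
        by (simp add: power2_eq_square power3_eq_cube algebra_simps)
      moreover have "\<dots> \<ge> 0" by simp
      ultimately have "(2 * real n + (?k + 1)\<^sup>2) * (real n - ?k)
          \<le> (real n + ?k + 1) * (2 * real n + ?k\<^sup>2)" by linarith
      from mult_right_mono[OF this kern_nonneg[of n "int k"]] show ?thesis by (simp add: mult.assoc)
    qed
    finally have "(2 * real n + (?k + 1)\<^sup>2) * kern n (int k + 1)
        \<le> (2 * real n + ?k\<^sup>2) * kern n (int k)"
      by (rule mult_left_le_imp_le) linarith
    with Suc show ?case by (simp add: add.commute)
  qed simp
  show ?thesis
  proof (cases "x \<ge> 0")
    case True
    then show ?thesis using nat[of "nat x"] by simp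
  next
    case False
    then show ?thesis using nat[of "nat (- x)"] by (simp add: kern_minus)
  qed
qed

lemma kern_le_0: "kern n x \<le> kern n 0"
proof (cases "n = 0")
  case False
  have "2 * real n * kern n x \<le> (2 * real n + (of_int x)\<^sup>2) * kern n x"
    by (intro mult_right_mono kern_nonneg) simp
  also have "\<dots> \<le> 2 * real n * kern n 0" by (rule kern_tail)
  finally show ?thesis using False by simp
qed simp

lemma kern_Suc_0: "kern (Suc n) 0 = kern n 0 * (2 * real n + 1) / (2 * real n + 2)"
proof -
  have "(real n + 1)\<^sup>2 * (kern (Suc n) 0 - kern n 0) = - ((real n + 1) / 2) * kern n 0"
    using kern_Suc_eq[of n 0] by (simp del: kern.simps)
  then have "(real n + 1) * ((real n + 1) * (kern (Suc n) 0 - kern n 0) + kern n 0 / 2) = 0"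
    by (simp add: power2_eq_square field_simps del: kern.simps)
  then have "(real n + 1) * (kern (Suc n) 0 - kern n 0) + kern n 0 / 2 = 0"
    by (simp del: kern.simps)
  then show ?thesis by (simp add: field_simps del: kern.simps)
qed

text \<open>The recursion \<open>kern_Suc_0\<close> shows that \<open>(kern n 0)\<^sup>2 (n + 1)\<close> does not increase; in the next lemma,
  \<open>(kern n 0)\<^sup>2 n\<close> does not decrease.\<close>

lemma kern_0_upper: "kern n 0 \<le> 1 / sqrt (real n + 1)"
proof -
  have "(kern n 0)\<^sup>2 * (real n + 1) \<le> 1"
  proof (induction n)
    case (Suc n)
    have "(kern (Suc n) 0)\<^sup>2 * (real (Suc n) + 1)
        = (kern n 0)\<^sup>2 * (real n + 1) * (((2 * real n + 1)\<^sup>2 * (real n + 2))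
            / ((2 * real n + 2)\<^sup>2 * (real n + 1)))"
      unfolding kern_Suc_0 by (simp add: power_divide power_mult_distrib)
    also have "\<dots> \<le> 1 * 1"
    proof (rule mult_mono)
      have "(2 * real n + 1)\<^sup>2 * (real n + 2) \<le> (2 * real n + 2)\<^sup>2 * (real n + 1)"
        by (simp add: power2_eq_square algebra_simps)
      then show "((2 * real n + 1)\<^sup>2 * (real n + 2)) / ((2 * real n + 2)\<^sup>2 * (real n + 1)) \<le> 1"
        by (simp add: divide_le_eq)
    qed (use Suc in auto)
    finally show ?case by simp
  qed simp
  then have "(kern n 0 * sqrt (real n + 1))\<^sup>2 \<le> 1\<^sup>2" by (simp add: power_mult_distrib)
  then have "kern n 0 * sqrt (real n + 1) \<le> 1" by (rule power2_le_imp_le) simp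
  then show ?thesis by (simp add: field_simps)
qed

lemma kern_0_lower: "1 / (2 * sqrt (real n + 1)) \<le> kern n 0"
proof -
  have "1 \<le> (kern (Suc n) 0)\<^sup>2 * (4 * real (Suc n))" for n
  proof (induction n)
    case 0
    show ?case by (simp add: power2_eq_square)
  next
    case (Suc n)
    let ?m = "real (Suc n)"
    have "1 * 1 \<le> (kern (Suc n) 0)\<^sup>2 * (4 * ?m) * (((2 * ?m + 1)\<^sup>2 * (?m + 1)) / ((2 * ?m + 2)\<^sup>2 * ?m))"
    proof (rule mult_mono[OF Suc])
      have "(2 * m + 2)\<^sup>2 * m \<le> (2 * m + 1)\<^sup>2 * (m + 1)" if "m \<ge> 0" for m :: real
        using that by (simp add: power2_eq_square algebra_simps)
      from this[of ?m] show "1 \<le> ((2 * ?m + 1)\<^sup>2 * (?m + 1)) / ((2 * ?m + 2)\<^sup>2 * ?m)"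
        by (simp add: le_divide_eq del: of_nat_Suc)
    qed (auto simp del: kern.simps)
    also have "\<dots> = (kern (Suc (Suc n)) 0)\<^sup>2 * (4 * real (Suc (Suc n)))"
      unfolding kern_Suc_0[of "Suc n"] of_nat_Suc[of "Suc n"]
      by (simp add: power_divide power_mult_distrib add.commute del: of_nat_Suc kern.simps)
    finally show ?case by simp
  qed
  then have "1 \<le> (kern n 0)\<^sup>2 * (4 * (real n + 1))"
  proof (cases n)
    case (Suc k)
    have "(kern n 0)\<^sup>2 * (4 * real n) \<le> (kern n 0)\<^sup>2 * (4 * (real n + 1))"
      by (intro mult_left_mono) auto
    with \<open>\<And>n. 1 \<le> (kern (Suc n) 0)\<^sup>2 * (4 * real (Suc n))\<close>[of k] Suc show ?thesis
      by (simp del: kern.simps of_nat_Suc)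
  qed simp
  then have "1\<^sup>2 \<le> (kern n 0 * (2 * sqrt (real n + 1)))\<^sup>2" by (simp add: power_mult_distrib)
  then have "1 \<le> kern n 0 * (2 * sqrt (real n + 1))"
    by (rule power2_le_imp_le) (simp add: kern_nonneg)
  then show ?thesis by (simp add: field_simps)
qed

lemma kern_Suc_le: "kern (Suc n) 0 \<le> kern n 0"
  using kern_le_0[of n 1] kern_le_0[of n "-1"] by simp

text \<open>The second difference of the Gaussian kernel is smaller than the kernel at \<open>0\<close> by a factor \<open>1/n\<close>. For
  \<open>2 x\<^sup>2 \<le> n\<^sup>2\<close> this is \<open>kern_Suc_eq\<close>, with the tail bound absorbing the factor \<open>x\<^sup>2\<close>; for larger \<open>x\<close>
  the tail bound makes each term small by itself.\<close>

lemma kern_second_difference: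
  "\<bar>kern n (x + 1) - 2 * kern n x + kern n (x - 1)\<bar> \<le> 20 * kern n 0 / (real n + 1)"
proof -
  let ?N = "real n + 1" and ?X = "(of_int x :: real)\<^sup>2" and ?d = "kern (Suc n) x - kern n x"
  have N: "?N > 0" by simp
  have K0: "0 \<le> kern n 0" by (rule kern_nonneg)
  have X: "?X \<ge> 0" by simp
  have "\<bar>?d\<bar> \<le> 5 * kern n 0 / ?N"
  proof (cases "2 * ?X \<le> (real n)\<^sup>2")
    case True
    have D: "?N\<^sup>2 / 2 \<le> ?N\<^sup>2 - ?X"
    proof -
      have "(real n)\<^sup>2 \<le> ?N\<^sup>2" by (rule power_mono) auto
      then show ?thesis using True by linarith
    qed
    have "?N\<^sup>2 / 2 * \<bar>?d\<bar> \<le> (?N\<^sup>2 - ?X) * \<bar>?d\<bar>"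
      using D by (rule mult_right_mono) simp
    also have "\<dots> = \<bar>(?N\<^sup>2 - ?X) * ?d\<bar>"
    proof -
      have "0 \<le> ?N\<^sup>2 - ?X" using D zero_le_power2[of ?N] by linarith
      then show ?thesis by (simp add: abs_mult del: kern.simps)
    qed
    also have "\<dots> = \<bar>?X - ?N / 2\<bar> * kern n x"
      unfolding kern_Suc_eq by (simp add: abs_mult kern_nonneg)
    also have "\<dots> \<le> (?X + ?N / 2) * kern n x"
    proof (rule mult_right_mono)
      show "\<bar>?X - ?N / 2\<bar> \<le> ?X + ?N / 2"
        unfolding abs_le_iff using X N by (auto simp: field_simps)
    qed (rule kern_nonneg)
    also have "\<dots> \<le> 2 * real n * kern n 0 + ?N / 2 * kern n 0"
    proof -
      have "?X * kern n x \<le> (2 * real n + ?X) * kern n x"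
        by (intro mult_right_mono kern_nonneg) simp
      also have "\<dots> \<le> 2 * real n * kern n 0" by (rule kern_tail)
      finally have 1: "?X * kern n x \<le> 2 * real n * kern n 0" .
      have 2: "?N / 2 * kern n x \<le> ?N / 2 * kern n 0"
        using kern_le_0[of n x] by (intro mult_left_mono) auto
      show ?thesis unfolding distrib_right using 1 2 by (rule add_mono)
    qed
    also have "\<dots> \<le> 5 / 2 * ?N * kern n 0"
    proof -
      have "2 * real n + ?N / 2 \<le> 5 / 2 * ?N" by simp
      from mult_right_mono[OF this K0] show ?thesis by (simp only: distrib_right)
    qed
    finally have "?N\<^sup>2 / 2 * \<bar>?d\<bar> \<le> 5 / 2 * ?N * kern n 0" .
    moreover have "M * (M * D) \<le> M * (5 * K)" if "M\<^sup>2 / 2 * D \<le> 5 / 2 * M * K" for M D K :: real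
      using that by (simp add: power2_eq_square field_simps)
    ultimately have "?N * (?N * \<bar>?d\<bar>) \<le> ?N * (5 * kern n 0)" by blast
    then have "?N * \<bar>?d\<bar> \<le> 5 * kern n 0" using N by (rule mult_left_le_imp_le)
    then show ?thesis using N by (simp add: field_simps del: kern.simps)
  next
    case False
    have far: "kern k x \<le> 5 * kern k 0 / (real k + 3)" if k: "k = n \<or> k = Suc n" for k
    proof (cases "k = 0")
      case True
      then show ?thesis using False that by (cases "x = 0") auto
    next
      case nz: False
      have "4 * (real k * (real k + 3)) \<le> 5 * (4 * real k + (real n)\<^sup>2)"
      proof -
        have "4 * (y * (y + 3)) \<le> 5 * (4 * y + y\<^sup>2)"
          "4 * ((y + 1) * (y + 1 + 3)) \<le> 5 * (4 * (y + 1) + y\<^sup>2)" if "y \<ge> 0" for y :: real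
          using that zero_le_power2[of y] unfolding power2_eq_square by (simp_all add: algebra_simps)
        from this[of "real n"] show ?thesis using k by (auto simp: add.commute)
      qed
      also have "\<dots> \<le> 5 * (2 * (2 * real k + ?X))" using False by simp
      finally have "2 * (real k * (real k + 3)) * kern k x \<le> 5 * (2 * real k + ?X) * kern k x"
        by (intro mult_right_mono kern_nonneg) simp
      also have "\<dots> \<le> 5 * (2 * real k * kern k 0)"
        using mult_left_mono[OF kern_tail[of k x], of 5, OF zero_le_numeral]
        by (simp only: mult.assoc)
      finally have "2 * (real k * (real k + 3)) * kern k x \<le> 5 * (2 * real k * kern k 0)" .
      moreover have "y * (z * K) \<le> y * (5 * K')" if "2 * (y * z) * K \<le> 5 * (2 * y * K')"
        for y z K K' :: real
        using that by (simp add: mult_ac)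
      ultimately have "real k * ((real k + 3) * kern k x) \<le> real k * (5 * kern k 0)" by blast
      then have "(real k + 3) * kern k x \<le> 5 * kern k 0"
        by (rule mult_left_le_imp_le) (use nz in simp)
      then show ?thesis by (simp add: field_simps)
    qed
    have "kern n x \<le> 5 * kern n 0 / (real n + 3)" by (rule far) auto
    also have "\<dots> \<le> 5 * kern n 0 / ?N" using K0 by (intro frac_le) auto
    finally have 1: "kern n x \<le> 5 * kern n 0 / ?N" .
    have "kern (Suc n) x \<le> 5 * kern (Suc n) 0 / (real (Suc n) + 3)" by (rule far) auto
    also have "\<dots> \<le> 5 * kern n 0 / ?N"
      using kern_Suc_le[of n] K0 by (intro frac_le) (auto simp del: kern.simps)
    finally have 2: "kern (Suc n) x \<le> 5 * kern n 0 / ?N" .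
    show ?thesis using 1 2 kern_nonneg[of n x] kern_nonneg[of "Suc n" x]
      by (simp only: abs_le_iff) linarith
  qed
  moreover have "kern n (x + 1) - 2 * kern n x + kern n (x - 1) = 4 * ?d" by simp
  ultimately show ?thesis by (simp only: abs_mult) (simp add: field_simps del: kern.simps)
qed

lemma kern_0_minus_kern_2: "kern n 0 / (real n + 1) \<le> kern n 0 - kern n 2"
proof -
  have 1: "(real n + 1) * kern n 1 = real n * kern n 0" using kern_ratio[of n 0] by simp
  have 2: "(real n + 2) * kern n 2 = (real n - 1) * kern n 1"
    using kern_ratio[of n 1] by (simp add: add.commute)
  have "(real n + 1) * ((real n + 2) * (kern n 0 - kern n 2)) = (4 * real n + 2) * kern n 0"
    using 1 2 by algebra
  moreover have "(real n + 2) * kern n 0 \<le> (4 * real n + 2) * kern n 0"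
    by (intro mult_right_mono kern_nonneg) simp
  ultimately have "(real n + 2) * kern n 0 \<le> (real n + 2) * ((real n + 1) * (kern n 0 - kern n 2))"
    by (simp add: mult.left_commute)
  then have "kern n 0 \<le> (real n + 1) * (kern n 0 - kern n 2)"
    by (rule mult_left_le_imp_le) simp
  then show ?thesis by (simp add: field_simps)
qed

section \<open>The absorbed random walk\<close>

text \<open>Given a particle, the walker stays or moves up, given an empty site, it stays or moves down, with
  probability \<open>1/2\<close> each, unless it has been absorbed at \<open>0\<close>. With the factor \<open>2\<close> at \<open>0\<close> the operators
  multiply constants by \<open>2\<close>, so that they are twice transition operators.\<close>

definition absorbed_op :: "bool \<Rightarrow> (nat \<Rightarrow> real) \<Rightarrow> nat \<Rightarrow> real" where
  "absorbed_op c f k = (if k = 0 then 2 * f 0 else f k + f (if c then Suc k else k - 1))"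

interpretation walk: letter_operators absorbed_op
  by unfold_locales (auto simp: absorbed_op_def algebra_simps intro!: add_nonneg_nonneg)

abbreviation step where "step \<equiv> walk.total"

lemma step_0: "step f 0 = 4 * f 0"
  by (simp add: walk.total_def absorbed_op_def)

lemma step_Suc: "step f (Suc k) = f k + 2 * f (Suc k) + f (Suc (Suc k))"
  by (simp add: walk.total_def absorbed_op_def)

lemma absorbed_op_0: "absorbed_op c f 0 = 2 * f 0"
  and absorbed_op_Suc: "absorbed_op c f (Suc k) = f (Suc k) + f (if c then Suc (Suc k) else k)"
  by (simp_all add: absorbed_op_def)

lemma absorbed_op_relation:
  "absorbed_op True (absorbed_op False f) = (\<lambda>k. absorbed_op True f k + absorbed_op False f k)"
  by (rule ext) (auto simp: absorbed_op_def)

lemma word_const: "foldr absorbed_op u (\<lambda>_. r) k = 2 ^ length u * r"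
proof (induction u arbitrary: k)
  case (Cons c u)
  then have "foldr absorbed_op u (\<lambda>_. r) = (\<lambda>_. 2 ^ length u * r)" by auto
  then show ?case by (cases k) (simp_all add: absorbed_op_0 absorbed_op_Suc)
qed simp

lemma word_0: "foldr absorbed_op u f 0 = 2 ^ length u * f 0"
  by (induction u) (simp_all add: absorbed_op_0)

lemma step_power_0: "(step ^^ n) f 0 = 4 ^ n * f 0"
  by (induction n) (simp_all add: step_0)

lemma step_const: "(step ^^ n) (\<lambda>_. r) k = 4 ^ n * r"
proof (induction n arbitrary: k)
  case (Suc n)
  then have "(step ^^ n) (\<lambda>_. r) = (\<lambda>_. 4 ^ n * r)" by auto
  then show ?case by (cases k) (simp_all add: step_0 step_Suc)
qed simp

lemma step_local:
  assumes "\<And>i. i \<le> k + n \<Longrightarrow> f i = f' i"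
  shows "(step ^^ n) f k = (step ^^ n) f' k"
  using assms
proof (induction n arbitrary: k)
  case (Suc n)
  have "(step ^^ n) f i = (step ^^ n) f' i" if "i \<le> Suc k" for i
    by (rule Suc.IH) (use Suc.prems that in auto)
  then show ?case by (cases k) (simp_all add: step_0 step_Suc)
qed simp

text \<open>The squared displacement grows by at most \<open>1/2\<close> per step, and not at all after absorption.\<close>

lemma step_second_moment:
  "(step ^^ n) (\<lambda>j. (real j - z)\<^sup>2) k \<le> 4 ^ n * ((real k - z)\<^sup>2 + real n / 2)"
proof (induction n arbitrary: k)
  case (Suc n)
  have "(step ^^ Suc n) (\<lambda>j. (real j - z)\<^sup>2) k = (step ^^ n) (step (\<lambda>j. (real j - z)\<^sup>2)) k"
    by (simp add: funpow_swap1)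
  also have "\<dots> \<le> (step ^^ n) (\<lambda>j. 4 * (real j - z)\<^sup>2 + 2) k"
  proof (rule walk.power_mono)
    fix j
    show "step (\<lambda>j. (real j - z)\<^sup>2) j \<le> 4 * (real j - z)\<^sup>2 + 2"
      by (cases j) (simp_all add: step_0 step_Suc power2_eq_square algebra_simps)
  qed
  also have "\<dots> = 4 * (step ^^ n) (\<lambda>j. (real j - z)\<^sup>2) k + 4 ^ n * 2"
    by (simp only: walk.power_add walk.power_scale step_const)
  also have "\<dots> \<le> 4 * (4 ^ n * ((real k - z)\<^sup>2 + real n / 2)) + 4 ^ n * 2"
    using Suc by simp
  also have "\<dots> = 4 ^ Suc n * ((real k - z)\<^sup>2 + real (Suc n) / 2)"
    by (simp add: field_simps)
  finally show ?case .
qed simp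

text \<open>Averaged over the word \<open>x\<close>, the displacement of the walker has second moment at most \<open>m/2\<close>, and a
  Lipschitz function changes by at most \<open>\<kappa>\<close> times the displacement. A direct summation of the changes letter
  by letter would give \<open>m\<close> instead of \<open>\<surd>m\<close>.\<close>

lemma word_fluctuation:
  assumes lip: "\<And>k. \<bar>f (Suc k) - f k\<bar> \<le> \<kappa>"
  shows "(\<Sum>x\<in>words m. \<bar>foldr absorbed_op x f k - 2 ^ m * f k\<bar>) \<le> 4 ^ m * \<kappa> * sqrt m"
proof (cases "m = 0")
  case False
  \<comment> \<open>This choice balances the two terms of Young's inequality below.\<close>
  define \<epsilon> where "\<epsilon> = 1 / sqrt m"
  have \<epsilon>: "\<epsilon> > 0" using False by (simp add: \<epsilon>_def)
  have \<kappa>: "\<kappa> \<ge> 0" using lip[of 0] by linarith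
  have up: "\<bar>f (i + d) - f i\<bar> \<le> \<kappa> * real d" for i d
  proof (induction d)
    case (Suc d)
    then show ?case using lip[of "i + d"] by (simp add: algebra_simps)
  qed simp
  have Lip: "\<bar>f j - f k\<bar> \<le> \<kappa> * \<bar>real j - real k\<bar>" for j
  proof (cases "j \<le> k")
    case True
    then show ?thesis using up[of j "k - j"] by (simp add: abs_minus_commute of_nat_diff)
  next
    case False
    then show ?thesis using up[of k "j - k"] by (simp add: of_nat_diff)
  qed
  have young: "\<bar>y\<bar> \<le> \<epsilon> / 2 * y\<^sup>2 + 1 / (2 * \<epsilon>)" for y :: real
  proof -
    have "0 \<le> (\<epsilon> * \<bar>y\<bar> - 1)\<^sup>2 / (2 * \<epsilon>)" using \<epsilon> by simp
    also have "\<dots> = \<epsilon> / 2 * \<bar>y\<bar>\<^sup>2 + 1 / (2 * \<epsilon>) - \<bar>y\<bar>"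
      using \<epsilon> by (simp add: power2_eq_square field_simps)
    finally show ?thesis by simp
  qed
  have "foldr absorbed_op x f k - 2 ^ m * f k = foldr absorbed_op x (\<lambda>j. f j - f k) k"
    if "x \<in> words m" for x
    using that by (simp add: walk.word_diff word_const words_def)
  then have "(\<Sum>x\<in>words m. \<bar>foldr absorbed_op x f k - 2 ^ m * f k\<bar>)
      \<le> (step ^^ m) (\<lambda>j. \<bar>f j - f k\<bar>) k"
    using walk.sum_words_abs[where f = "\<lambda>j. f j - f k"] by simp
  also have "\<dots> \<le> (step ^^ m) (\<lambda>j. \<kappa> * (\<epsilon> / 2 * (real j - real k)\<^sup>2 + 1 / (2 * \<epsilon>))) k"
  proof (rule walk.power_mono)
    fix j
    show "\<bar>f j - f k\<bar> \<le> \<kappa> * (\<epsilon> / 2 * (real j - real k)\<^sup>2 + 1 / (2 * \<epsilon>))"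
      by (rule order_trans[OF Lip mult_left_mono[OF young \<kappa>]])
  qed
  also have "\<dots> = \<kappa> * (\<epsilon> / 2 * (step ^^ m) (\<lambda>j. (real j - real k)\<^sup>2) k + 4 ^ m * (1 / (2 * \<epsilon>)))"
    by (simp only: walk.power_add walk.power_scale step_const)
  also have "\<dots> \<le> \<kappa> * (\<epsilon> / 2 * (4 ^ m * (real m / 2)) + 4 ^ m * (1 / (2 * \<epsilon>)))"
    using step_second_moment[of m "real k" k] \<epsilon> \<kappa>
    by (intro mult_left_mono add_mono) auto
  also have "\<dots> = 4 ^ m * \<kappa> * (3 / 4 * sqrt m)"
    using False by (simp add: \<epsilon>_def field_simps)
  also have "\<dots> \<le> 4 ^ m * \<kappa> * sqrt m"
    using \<kappa> by (intro mult_left_mono) auto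
  finally show ?thesis .
qed simp

section \<open>Transition probabilities of the absorbed walk\<close>

lemma kern_rec: "4 * kern (Suc n) x = kern n (x - 1) + 2 * kern n x + kern n (x + 1)"
  by simp

text \<open>Reflection principle: the kernel antisymmetrized about \<open>0\<close> vanishes at \<open>0\<close> and satisfies the recursion of the
  unrestricted walk, so that it also describes the walk killed at \<open>0\<close>.\<close>

lemma step_point:
  assumes "p \<ge> 1"
  shows "(step ^^ n) (\<lambda>i. of_bool (i = p)) k
    = 4 ^ n * (kern n (int k - int p) - kern n (int k + int p))"
proof (induction n arbitrary: k)
  case 0
  show ?case using assms by auto
next
  case (Suc n)
  show ?case
  proof (cases k)
    case 0
    have "kern (Suc n) (int 0 - int p) = kern (Suc n) (int 0 + int p)"
      using kern_minus[of "Suc n" "int p"] by (simp del: kern.simps)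
    moreover have "of_bool (0 = p) = (0 :: real)" using assms by simp
    ultimately show ?thesis unfolding 0 step_power_0 by (simp only: diff_self mult_zero_right)
  next
    case k: (Suc j)
    let ?x = "int (Suc j)"
    have IH: "(step ^^ n) (\<lambda>i. of_bool (i = p)) j
        = 4 ^ n * (kern n (?x - int p - 1) - kern n (?x + int p - 1))"
      "(step ^^ n) (\<lambda>i. of_bool (i = p)) (Suc (Suc j))
        = 4 ^ n * (kern n (?x - int p + 1) - kern n (?x + int p + 1))"
      using Suc.IH[of j] Suc.IH[of "Suc (Suc j)"] by (simp_all add: algebra_simps)
    have "(step ^^ Suc n) (\<lambda>i. of_bool (i = p)) (Suc j)
        = 4 ^ n * (4 * kern (Suc n) (?x - int p) - 4 * kern (Suc n) (?x + int p))"
      unfolding kern_rec funpow.simps comp_apply step_Suc IH Suc.IH[of "Suc j"]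
      by (simp only: distrib_left right_diff_distrib mult.left_commute[of 2 "4 ^ n"])
    also have "\<dots> = 4 ^ Suc n * (kern (Suc n) (?x - int p) - kern (Suc n) (?x + int p))"
      by (simp only: right_diff_distrib power_Suc mult_ac)
    finally show ?thesis unfolding k .
  qed
qed

text \<open>Summing \<open>step_point\<close> over the target \<open>p\<close> telescopes; the induction on \<open>n\<close> is shorter. It rests on
  the fact that \<open>kern n i + kern n (i + 1)\<close> obeys the recursion of \<open>kern\<close> and is symmetric about \<open>-1/2\<close>.\<close>

lemma step_survival:
  "(step ^^ n) (\<lambda>i. of_bool (0 < i)) k = 4 ^ n * (\<Sum>i<k. kern n (int i) + kern n (int i + 1))"
proof (induction n arbitrary: k)
  case 0
  have "(\<Sum>i<k. kern 0 (int i) + kern 0 (int i + 1)) = of_bool (0 < k)"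
    by (induction k) auto
  then show ?case by simp
next
  case (Suc n)
  define t where "t n i = kern n (int i) + kern n (int i + 1)" for n i
  define s where "s n k = (\<Sum>i<k. t n i)" for n k
  have s_Suc: "s n (Suc k) = s n k + t n k" for n k by (simp add: s_def)
  have IH: "(step ^^ n) (\<lambda>i. of_bool (0 < i)) k = 4 ^ n * s n k" for k
    unfolding s_def t_def by (rule Suc)
  have t_rec: "4 * t (Suc n) (Suc k) = t n k + 2 * t n (Suc k) + t n (Suc (Suc k))" for k
    using kern_rec[of n "int k + 1"] kern_rec[of n "int k + 2"]
    by (simp add: t_def algebra_simps del: kern.simps)
  have t_0: "4 * t (Suc n) 0 = 3 * t n 0 + t n 1"
    using kern_minus[of n 1] kern_rec[of n 0] kern_rec[of n 1]
    by (simp add: t_def del: kern.simps)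
  have s_rec: "4 * s (Suc n) (Suc k) = s n k + 2 * s n (Suc k) + s n (Suc (Suc k))" for k
  proof (induction k)
    case 0
    show ?case using t_0 by (simp add: s_Suc) (simp add: s_def)
  next
    case (Suc k)
    then show ?case using t_rec[of k] s_Suc[of "Suc n" "Suc k"] s_Suc[of n k]
        s_Suc[of n "Suc k"] s_Suc[of n "Suc (Suc k)"]
      by linarith
  qed
  have "(step ^^ Suc n) (\<lambda>i. of_bool (0 < i)) k = 4 ^ Suc n * s (Suc n) k"
  proof (cases k)
    case 0
    then show ?thesis by (simp add: step_0 step_power_0 s_def)
  next
    case k: (Suc j)
    have "(step ^^ Suc n) (\<lambda>i. of_bool (0 < i)) k
        = 4 ^ n * (s n j + 2 * s n (Suc j) + s n (Suc (Suc j)))"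
      by (simp add: k step_Suc IH algebra_simps)
    then show ?thesis by (simp add: k flip: s_rec)
  qed
  then show ?case unfolding s_def t_def .
qed

lemma step_survival_le: "(step ^^ n) (\<lambda>i. of_bool (0 < i)) k \<le> 4 ^ n * (2 * real k * kern n 0)"
proof -
  have "(\<Sum>i<k. kern n (int i) + kern n (int i + 1)) \<le> (\<Sum>i<k. 2 * kern n 0)"
  proof (rule sum_mono)
    fix i
    show "kern n (int i) + kern n (int i + 1) \<le> 2 * kern n 0"
      using kern_le_0[of n "int i"] kern_le_0[of n "int i + 1"] by linarith
  qed
  then show ?thesis by (simp add: step_survival mult.commute mult.left_commute)
qed

lemma step_survival_lipschitz:
  "\<bar>(step ^^ n) (\<lambda>i. of_bool (0 < i)) (Suc k) - (step ^^ n) (\<lambda>i. of_bool (0 < i)) k\<bar>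
     \<le> 4 ^ n * (2 * kern n 0)"
proof -
  have "(step ^^ n) (\<lambda>i. of_bool (0 < i)) (Suc k) - (step ^^ n) (\<lambda>i. of_bool (0 < i)) k
      = 4 ^ n * (kern n (int k) + kern n (int k + 1))"
    by (simp add: step_survival algebra_simps)
  moreover have "kern n (int k) + kern n (int k + 1) \<le> 2 * kern n 0"
    using kern_le_0[of n "int k"] kern_le_0[of n "int k + 1"] by linarith
  ultimately show ?thesis
    using kern_nonneg[of n "int k"] kern_nonneg[of n "int k + 1"] by simp
qed

text \<open>By the reflection principle the increment in \<open>k\<close> is a difference of first differences of \<open>kern n\<close> at
  two points that are \<open>2p\<close> apart, hence a sum of \<open>2p\<close> second differences.\<close>

lemma step_point_lipschitz:
  assumes "p \<ge> 1"
  shows "\<bar>(step ^^ n) (\<lambda>i. of_bool (i = p)) (Suc k) - (step ^^ n) (\<lambda>i. of_bool (i = p)) k\<bar>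
     \<le> 4 ^ n * (40 * real p * kern n 0 / (real n + 1))"
proof -
  let ?S = "20 * kern n 0 / (real n + 1)"
  let ?d = "\<lambda>y. kern n (y + 1) - kern n y"
  have tele: "\<bar>?d (y + int i) - ?d y\<bar> \<le> real i * ?S" for y i
  proof (induction i)
    case (Suc i)
    let ?z = "y + int i + 1"
    have "?d (y + int (Suc i)) - ?d (y + int i) = kern n (?z + 1) - 2 * kern n ?z + kern n (?z - 1)"
      by (simp add: algebra_simps)
    then have "\<bar>?d (y + int (Suc i)) - ?d (y + int i)\<bar> \<le> ?S"
      using kern_second_difference[of n ?z] by simp
    moreover have "real (Suc i) * ?S = real i * ?S + ?S"
      by (simp only: of_nat_Suc distrib_right mult_1 add.commute)
    ultimately show ?case using Suc by linarith
  qed simp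
  have "(step ^^ n) (\<lambda>i. of_bool (i = p)) (Suc k) - (step ^^ n) (\<lambda>i. of_bool (i = p)) k
      = 4 ^ n * - (?d (int k - int p + int (2 * p)) - ?d (int k - int p))"
    unfolding step_point[OF assms] by (simp add: algebra_simps)
  then have "\<bar>(step ^^ n) (\<lambda>i. of_bool (i = p)) (Suc k) - (step ^^ n) (\<lambda>i. of_bool (i = p)) k\<bar>
      = 4 ^ n * \<bar>?d (int k - int p + int (2 * p)) - ?d (int k - int p)\<bar>"
    by (simp only: abs_mult abs_minus_cancel) simp
  also have "\<dots> \<le> 4 ^ n * (real (2 * p) * ?S)"
    using tele by (rule mult_left_mono) simp
  finally show ?thesis by (simp add: mult.assoc)
qed

lemma weighted_geometric_sums:
  fixes z :: real
  assumes "\<bar>z\<bar> < 1"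
  shows "summable (\<lambda>n. \<bar>z\<bar> ^ n * real (Suc n))" "(\<Sum>n. \<bar>z\<bar> ^ n * real (Suc n)) = 1 / (1 - \<bar>z\<bar>)\<^sup>2"
  using geometric_deriv_sums[of "\<bar>z\<bar>"] assms
  by (simp_all add: sums_iff mult.commute)

text \<open>The right boundary vector, an eigenvector of \<open>D\<close> with eigenvalue \<open>1 + v\<close>, shifted by one so that the
  absorbing state is \<open>0\<close>.\<close>

definition geometric :: "real \<Rightarrow> nat \<Rightarrow> real" where
  "geometric v k = (if k = 0 then 0 else v ^ (k - 1))"

lemma step_geometric_lipschitz:
  assumes "\<bar>v\<bar> < 1"
  shows "\<bar>(step ^^ n) (geometric v) (Suc k) - (step ^^ n) (geometric v) k\<bar>
     \<le> 4 ^ n * (40 * kern n 0 / (real n + 1) / (1 - \<bar>v\<bar>)\<^sup>2)"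
proof -
  \<comment> \<open>In \<open>n\<close> steps the walk does not get further than \<open>n\<close> from its start, so \<open>geometric v\<close> may be cut off here.\<close>
  let ?M = "Suc k + n"
  let ?f = "\<lambda>j. \<Sum>i<?M. v ^ i * of_bool (j = Suc i)"
  let ?D = "\<lambda>f. (step ^^ n) f (Suc k) - (step ^^ n) f k"
  let ?\<delta> = "\<lambda>p i. of_bool (i = p) :: real"
  have trunc: "geometric v j = ?f j" if "j \<le> ?M" for j
  proof (cases j)
    case (Suc i)
    have "?f j = (\<Sum>i'<?M. if i' = i then v ^ i' else 0)"
      unfolding Suc by (rule sum.cong) auto
    then show ?thesis using Suc that by (simp add: geometric_def)
  qed (simp add: geometric_def)
  have "?D (geometric v) = ?D ?f"
    using step_local[of "Suc k" n "geometric v" ?f] step_local[of k n "geometric v" ?f] trunc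
    by simp
  also have "\<dots> = (\<Sum>i<?M. v ^ i * ?D (?\<delta> (Suc i)))"
    by (simp only: walk.power_sum[OF finite_lessThan] walk.power_scale right_diff_distrib
        sum_subtractf)
  finally have "\<bar>?D (geometric v)\<bar> = \<bar>\<Sum>i<?M. v ^ i * ?D (?\<delta> (Suc i))\<bar>" by simp
  also have "\<dots> \<le> (\<Sum>i<?M. \<bar>v ^ i * ?D (?\<delta> (Suc i))\<bar>)" by (rule sum_abs)
  also have "\<dots> \<le> (\<Sum>i<?M. 4 ^ n * (40 * kern n 0 / (real n + 1)) * (\<bar>v\<bar> ^ i * real (Suc i)))"
  proof (rule sum_mono)
    fix i
    have "\<bar>v ^ i * ?D (?\<delta> (Suc i))\<bar> \<le> \<bar>v\<bar> ^ i * (4 ^ n * (40 * real (Suc i) * kern n 0 / (real n + 1)))"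
      unfolding abs_mult power_abs by (intro mult_left_mono step_point_lipschitz) auto
    then show "\<bar>v ^ i * ?D (?\<delta> (Suc i))\<bar>
        \<le> 4 ^ n * (40 * kern n 0 / (real n + 1)) * (\<bar>v\<bar> ^ i * real (Suc i))"
      by (simp only: mult_ac times_divide_eq_left times_divide_eq_right)
  qed
  also have "\<dots> = 4 ^ n * (40 * kern n 0 / (real n + 1)) * (\<Sum>i<?M. \<bar>v\<bar> ^ i * real (Suc i))"
    by (rule sum_distrib_left[symmetric])
  also have "\<dots> \<le> 4 ^ n * (40 * kern n 0 / (real n + 1)) * (1 / (1 - \<bar>v\<bar>)\<^sup>2)"
    unfolding weighted_geometric_sums(2)[OF assms, symmetric]
    by (intro mult_left_mono sum_le_suminf weighted_geometric_sums(1)[OF assms])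
       (auto simp: kern_nonneg)
  finally show ?thesis by simp
qed

section \<open>The maximal current phase\<close>

text \<open>Pairing with the left boundary covector \<open>(1, w, w\<^sup>2, \<dots>)\<close>, an eigenvector of \<open>E\<close> on functions that vanish
  at \<open>0\<close>. For \<open>|w| < 1\<close> it is defined on all bounded functions.\<close>

definition pairing :: "real \<Rightarrow> (nat \<Rightarrow> real) \<Rightarrow> real" where
  "pairing w f = (\<Sum>h. w ^ h * f (Suc h))"

definition bounded_fun :: "(nat \<Rightarrow> real) \<Rightarrow> bool" where
  "bounded_fun f \<longleftrightarrow> (\<exists>M. \<forall>k. \<bar>f k\<bar> \<le> M)"

lemma summable_pairing:
  assumes w: "\<bar>w\<bar> < 1" and "bounded_fun f"
  shows "summable (\<lambda>h. \<bar>w ^ h * f (Suc h)\<bar>)" "summable (\<lambda>h. w ^ h * f (Suc h))"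
proof -
  obtain M where M: "\<And>k. \<bar>f k\<bar> \<le> M" using assms(2) by (auto simp: bounded_fun_def)
  have "summable (\<lambda>h. \<bar>w\<bar> ^ h * M)"
    using w by (intro summable_mult2 summable_geometric) simp
  moreover have "norm \<bar>w ^ h * f (Suc h)\<bar> \<le> \<bar>w\<bar> ^ h * M" for h
    using M[of "Suc h"] by (simp add: abs_mult power_abs mult_left_mono)
  ultimately show 1: "summable (\<lambda>h. \<bar>w ^ h * f (Suc h)\<bar>)"
    by (rule summable_comparison_test'[of _ 0])
  show "summable (\<lambda>h. w ^ h * f (Suc h))" by (rule summable_rabs_cancel[OF 1])
qed

lemma bounded_word: "bounded_fun f \<Longrightarrow> bounded_fun (foldr absorbed_op u f)"
proof -
  assume "bounded_fun f"
  then obtain M where M: "\<And>k. \<bar>f k\<bar> \<le> M" by (auto simp: bounded_fun_def)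
  have "\<bar>foldr absorbed_op u f k\<bar> \<le> 2 ^ length u * M" for k
  proof -
    have "\<bar>foldr absorbed_op u f k\<bar> \<le> foldr absorbed_op u (\<lambda>k. \<bar>f k\<bar>) k" by (rule walk.word_abs)
    also have "\<dots> \<le> foldr absorbed_op u (\<lambda>_. M) k" using M by (rule walk.word_mono)
    finally show ?thesis by (simp only: word_const)
  qed
  then show ?thesis by (auto simp: bounded_fun_def)
qed

lemma bounded_power: "bounded_fun f \<Longrightarrow> bounded_fun ((step ^^ n) f)"
proof -
  assume "bounded_fun f"
  then obtain M where M: "\<And>k. \<bar>f k\<bar> \<le> M" by (auto simp: bounded_fun_def)
  have "\<bar>(step ^^ n) f k\<bar> \<le> 4 ^ n * M" for k
  proof -
    have "\<bar>(step ^^ n) f k\<bar> \<le> (step ^^ n) (\<lambda>k. \<bar>f k\<bar>) k" by (rule walk.power_abs)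
    also have "\<dots> \<le> (step ^^ n) (\<lambda>_. M) k" using M by (rule walk.power_mono)
    finally show ?thesis by (simp only: step_const)
  qed
  then show ?thesis by (auto simp: bounded_fun_def)
qed

lemma bounded_geometric: "\<bar>v\<bar> \<le> 1 \<Longrightarrow> bounded_fun (geometric v)"
  unfolding bounded_fun_def geometric_def
  by (intro exI[of _ 1]) (auto simp: power_abs power_le_one)

lemma pairing_add:
  assumes "\<bar>w\<bar> < 1" "bounded_fun f" "bounded_fun f'"
  shows "pairing w (\<lambda>k. f k + f' k) = pairing w f + pairing w f'"
  unfolding pairing_def
  using suminf_add[OF summable_pairing(2)[OF assms(1,2)] summable_pairing(2)[OF assms(1,3)]]
  by (simp add: distrib_left)

lemma pairing_scale:
  assumes "\<bar>w\<bar> < 1" "bounded_fun f"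
  shows "pairing w (\<lambda>k. c * f k) = c * pairing w f"
  unfolding pairing_def
  using suminf_mult[OF summable_pairing(2)[OF assms], of c] by (simp add: mult.left_commute)

lemma bounded_scale: "bounded_fun f \<Longrightarrow> bounded_fun (\<lambda>k. c * f k)"
proof -
  assume "bounded_fun f"
  then obtain M where "\<And>k. \<bar>f k\<bar> \<le> M" by (auto simp: bounded_fun_def)
  then have "\<bar>c * f k\<bar> \<le> \<bar>c\<bar> * M" for k by (simp add: abs_mult mult_left_mono)
  then show ?thesis unfolding bounded_fun_def by blast
qed

lemma bounded_diff: "bounded_fun f \<Longrightarrow> bounded_fun f' \<Longrightarrow> bounded_fun (\<lambda>k. f k - f' k)"
proof -
  assume "bounded_fun f" "bounded_fun f'"
  then obtain M M' where "\<And>k. \<bar>f k\<bar> \<le> M" "\<And>k. \<bar>f' k\<bar> \<le> M'"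
    by (auto simp: bounded_fun_def)
  then have "\<bar>f k - f' k\<bar> \<le> M + M'" for k
    by (intro order_trans[OF abs_triangle_ineq4] add_mono) auto
  then show ?thesis unfolding bounded_fun_def by blast
qed

lemma pairing_diff:
  assumes "\<bar>w\<bar> < 1" "bounded_fun f" "bounded_fun f'"
  shows "pairing w (\<lambda>k. f k - f' k) = pairing w f - pairing w f'"
  unfolding pairing_def
  using suminf_diff[OF summable_pairing(2)[OF assms(1,2)] summable_pairing(2)[OF assms(1,3)]]
  by (simp add: right_diff_distrib)

lemma pairing_sum:
  assumes "\<bar>w\<bar> < 1" "\<And>i. i \<in> S \<Longrightarrow> bounded_fun (F i)"
  shows "pairing w (\<lambda>k. \<Sum>i\<in>S. F i k) = (\<Sum>i\<in>S. pairing w (F i))"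
  unfolding pairing_def sum_distrib_left
  using suminf_sum[of S "\<lambda>i h. w ^ h * F i (Suc h)"] summable_pairing(2)[OF assms(1)] assms(2)
  by simp

text \<open>The covector \<open>(w\<^sup>h)\<close> satisfies \<open>\<langle>W|E = (1 + w)\<langle>W|\<close> and the vector \<open>geometric v\<close> satisfies
  \<open>D|V\<rangle> = (1 + v)|V\<rangle>\<close>, which are the boundary rules for \<open>\<alpha> = 1/(1 + w)\<close> and \<open>\<beta> = 1/(1 + v)\<close>. The factor
  \<open>1 - w v\<close> gives the empty word weight \<open>1\<close>.\<close>

lemma weight_absorbed:
  assumes w: "\<bar>w\<bar> < 1" and v: "-1 < v" "v \<le> 1"
  shows "weight (1 / (1 + w)) (1 / (1 + v)) u
    = (1 - w * v) * pairing w (foldr absorbed_op u (geometric v))"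
proof (rule weight_eqI)
  have wv: "\<bar>w * v\<bar> < 1"
  proof -
    have "\<bar>w * v\<bar> \<le> \<bar>w\<bar> * 1" unfolding abs_mult using v by (intro mult_left_mono) auto
    then show ?thesis using w by simp
  qed
  note bd = bounded_word[OF bounded_geometric[of v]]
  have v1: "\<bar>v\<bar> \<le> 1" using v by simp
  have "pairing w (geometric v) = (\<Sum>h. (w * v) ^ h)"
    by (simp add: pairing_def geometric_def power_mult_distrib)
  also have "\<dots> = 1 / (1 - w * v)" using wv by (simp add: suminf_geometric)
  finally have empty: "(1 - w * v) * pairing w (geometric v) = 1" using wv by auto
  have left: "pairing w (absorbed_op False f) = (1 + w) * pairing w f"
    if f: "bounded_fun f" "f 0 = 0" for f
  proof -
    have s: "summable (\<lambda>h. w ^ h * f h)"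
      using summable_pairing(2)[OF w f(1)] unfolding summable_Suc_iff[of "\<lambda>h. w ^ h * f h", symmetric]
      by (simp add: mult.assoc summable_mult)
    have "(\<Sum>h. w ^ h * f h) = (\<Sum>h. w * (w ^ h * f (Suc h)))"
      using suminf_split_head[OF s] f(2) by (simp add: mult.assoc)
    also have "\<dots> = w * pairing w f"
      unfolding pairing_def by (rule suminf_mult[OF summable_pairing(2)[OF w f(1)]])
    finally have "(\<Sum>h. w ^ h * f h) = w * pairing w f" .
    then show ?thesis
      unfolding pairing_def[of w "absorbed_op False f"] absorbed_op_Suc
      using suminf_add[OF summable_pairing(2)[OF w f(1)] s]
      by (simp add: distrib_left distrib_right pairing_def)
  qed
  have right: "absorbed_op True (geometric v) = (\<lambda>k. (1 + v) * geometric v k)"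
  proof
    fix k
    show "absorbed_op True (geometric v) k = (1 + v) * geometric v k"
      by (cases k) (simp_all add: absorbed_op_0 absorbed_op_Suc geometric_def algebra_simps)
  qed
  have zero: "foldr absorbed_op u (geometric v) 0 = 0" for u
    by (simp add: word_0 geometric_def)
  show "matrix_product_weight (1 / (1 + w)) (1 / (1 + v))
      (\<lambda>u. (1 - w * v) * pairing w (foldr absorbed_op u (geometric v)))"
    unfolding matrix_product_weight_def
  proof (intro conjI allI)
    show "(1 - w * v) * pairing w (foldr absorbed_op [] (geometric v)) = 1"
      using empty by simp
  next
    fix u
    show "(1 - w * v) * pairing w (foldr absorbed_op (False # u) (geometric v))
        = (1 - w * v) * pairing w (foldr absorbed_op u (geometric v)) / (1 / (1 + w))"
      using left[OF bd[OF v1] zero, of u] by simp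
  next
    fix u
    have "foldr absorbed_op (u @ [True]) (geometric v)
        = (\<lambda>k. (1 + v) * foldr absorbed_op u (geometric v) k)"
      by (rule ext) (simp add: right walk.word_scale)
    then show "(1 - w * v) * pairing w (foldr absorbed_op (u @ [True]) (geometric v))
        = (1 - w * v) * pairing w (foldr absorbed_op u (geometric v)) / (1 / (1 + v))"
      using pairing_scale[OF w bd[OF v1], of "1 + v" u] by simp
  next
    fix x y
    have "foldr absorbed_op (x @ True # False # y) (geometric v)
        = (\<lambda>k. foldr absorbed_op (x @ True # y) (geometric v) k
             + foldr absorbed_op (x @ False # y) (geometric v) k)"
      by (rule ext) (simp add: absorbed_op_relation walk.word_add)
    then show "(1 - w * v) * pairing w (foldr absorbed_op (x @ True # False # y) (geometric v))
        = (1 - w * v) * pairing w (foldr absorbed_op (x @ True # y) (geometric v))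
        + (1 - w * v) * pairing w (foldr absorbed_op (x @ False # y) (geometric v))"
      using pairing_add[OF w bd[OF v1] bd[OF v1], of "x @ True # y" "x @ False # y"]
      by (simp only: distrib_left)
  qed
qed (use w in auto)

text \<open>Replacing the constant \<open>t\<close> by the mean \<open>Z/2\<^sup>m\<close> of \<open>S\<close> costs no more than the original deviation.\<close>

lemma sum_deviation_bound:
  fixes S :: "bool list \<Rightarrow> real"
  assumes Z: "(\<Sum>x\<in>words m. S x) = Z" "Z > 0"
    and B: "(\<Sum>x\<in>words m. \<bar>S x - t\<bar>) \<le> B"
  shows "(\<Sum>x\<in>words m. \<bar>S x / Z - (1 / 2) ^ m\<bar>) \<le> 2 * B / Z"
proof -
  have "\<bar>Z - 2 ^ m * t\<bar> = \<bar>\<Sum>x\<in>words m. S x - t\<bar>"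
    by (simp add: sum_subtractf Z card_words)
  also have "\<dots> \<le> B" using B sum_abs[of "\<lambda>x. S x - t" "words m"] by linarith
  finally have tot: "\<bar>Z - 2 ^ m * t\<bar> \<le> B" .
  have "\<bar>S x / Z - (1 / 2) ^ m\<bar> \<le> (\<bar>S x - t\<bar> + (1 / 2) ^ m * \<bar>Z - 2 ^ m * t\<bar>) / Z" for x
  proof -
    have "S x / Z - (1 / 2) ^ m = ((S x - t) - (1 / 2) ^ m * (Z - 2 ^ m * t)) / Z"
      using Z(2) by (simp add: field_simps power_one_over)
    then have "\<bar>S x / Z - (1 / 2) ^ m\<bar> = \<bar>(S x - t) - (1 / 2) ^ m * (Z - 2 ^ m * t)\<bar> / Z"
      using Z(2) by simp
    also have "\<dots> \<le> (\<bar>S x - t\<bar> + \<bar>(1 / 2) ^ m * (Z - 2 ^ m * t)\<bar>) / Z"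
      using Z(2) by (intro divide_right_mono abs_triangle_ineq4) simp
    finally show ?thesis by (simp add: abs_mult)
  qed
  then have "(\<Sum>x\<in>words m. \<bar>S x / Z - (1 / 2) ^ m\<bar>)
      \<le> (\<Sum>x\<in>words m. (\<bar>S x - t\<bar> + (1 / 2) ^ m * \<bar>Z - 2 ^ m * t\<bar>) / Z)"
    by (rule sum_mono)
  also have "\<dots> = ((\<Sum>x\<in>words m. \<bar>S x - t\<bar>) + \<bar>Z - 2 ^ m * t\<bar>) / Z"
    by (simp add: sum.distrib card_words power_one_over flip: sum_divide_distrib)
  also have "\<dots> \<le> (B + B) / Z"
    using B tot Z(2) by (intro divide_right_mono add_mono) auto
  finally show ?thesis by simp
qed

lemma bernoulli_weight_half: "bernoulli_weight (1 / 2) x = (1 / 2) ^ length x"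
  by (induction x) (simp_all add: bernoulli_weight_def)

text \<open>Three factors: \<open>word_fluctuation\<close> for the interval, \<open>\<kappa>\<close> for the sites to its right, and, since the
  fluctuation vanishes at the absorbing state, the survival probability for the sites to its left,
  which is at most \<open>2(h + 1) kern l 0\<close> from height \<open>h + 1\<close> and is summed against \<open>|w|\<^sup>h\<close>.\<close>

lemma marginal_error_absorbed:
  fixes l m r :: nat
  assumes w: "\<bar>w\<bar> < 1" and v: "-1 < v" "v \<le> 1"
    and lip: "\<And>k. \<bar>(step ^^ r) (geometric v) (Suc k) - (step ^^ r) (geometric v) k\<bar> \<le> 4 ^ r * \<kappa>"
  defines "Z \<equiv> total_weight (1 / (1 + w)) (1 / (1 + v)) (l + m + r)"
  shows "marginal_error (1 / (1 + w)) (1 / (1 + v)) l m r (1 / 2)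
    \<le> 2 * (4 ^ (l + m + r) * ((1 - w * v) * (2 / (1 - \<bar>w\<bar>)\<^sup>2) * (\<kappa> * sqrt m * kern l 0))) / Z"
proof -
  let ?\<alpha> = "1 / (1 + w)" and ?\<beta> = "1 / (1 + v)"
  define c where "c = 1 - w * v"
  define R where "R = (step ^^ r) (geometric v)"
  define S where "S x = (\<Sum>u\<in>words l. \<Sum>y\<in>words r. weight ?\<alpha> ?\<beta> (u @ x @ y))" for x
  define t where "t = c * pairing w ((step ^^ l) (\<lambda>k. 2 ^ m * R k))"
  have "\<bar>w * v\<bar> \<le> \<bar>w\<bar> * 1" unfolding abs_mult using v by (intro mult_left_mono) auto
  then have c: "c > 0" using w unfolding c_def by linarith
  have \<kappa>: "\<kappa> \<ge> 0"
  proof -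
    have "0 \<le> 4 ^ r * \<kappa>" using lip[of 0] by linarith
    then have "4 ^ r * 0 \<le> 4 ^ r * \<kappa>" by simp
    then show ?thesis by (rule mult_left_le_imp_le) simp
  qed
  have v1: "\<bar>v\<bar> \<le> 1" using v by simp
  have bR: "bounded_fun R" unfolding R_def by (rule bounded_power[OF bounded_geometric[OF v1]])
  have rates: "?\<alpha> > 0" "?\<beta> > 0" using w v by auto
  have S: "S x = c * pairing w ((step ^^ l) (foldr absorbed_op x R))" for x
  proof -
    have right: "(\<Sum>y\<in>words r. pairing w (foldr absorbed_op (u @ x @ y) (geometric v)))
        = pairing w (foldr absorbed_op (u @ x) R)" for u
    proof -
      have "foldr absorbed_op (u @ x) R
          = (\<lambda>k. \<Sum>y\<in>words r. foldr absorbed_op ((u @ x) @ y) (geometric v) k)"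
        unfolding R_def by (rule ext) (rule walk.sum_words_word[symmetric])
      then show ?thesis
        by (simp only: append_assoc)
           (rule pairing_sum[OF w bounded_word[OF bounded_geometric[OF v1]], symmetric])
    qed
    have left: "(\<Sum>u\<in>words l. pairing w (foldr absorbed_op (u @ x) R))
        = pairing w ((step ^^ l) (foldr absorbed_op x R))"
    proof -
      have "(step ^^ l) (foldr absorbed_op x R) = (\<lambda>k. \<Sum>u\<in>words l. foldr absorbed_op (u @ x) R k)"
        by (rule ext) (simp add: walk.sum_words[symmetric])
      then show ?thesis
        by (simp only:) (rule pairing_sum[OF w bounded_word[OF bR], symmetric])
    qed
    have "S x = c * (\<Sum>u\<in>words l. \<Sum>y\<in>words r. pairing w (foldr absorbed_op (u @ x @ y) (geometric v)))"
      unfolding S_def weight_absorbed[OF w v] c_def by (simp only: sum_distrib_left)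
    then show ?thesis by (simp only: right left)
  qed
  have Z: "(\<Sum>x\<in>words m. S x) = Z"
    unfolding S_def Z_def total_weight_def
    by (subst sum.swap) (simp add: sum_words_add)
  have Z_pos: "Z > 0" unfolding Z_def by (rule total_weight_pos[OF rates])
  define G where "G x k = \<bar>foldr absorbed_op x R k - 2 ^ m * R k\<bar>" for x k
  let ?K = "4 ^ m * (4 ^ r * \<kappa>) * sqrt m"
  have G_sum: "(\<Sum>x\<in>words m. G x k) \<le> ?K * of_bool (0 < k)" for k
  proof (cases "k = 0")
    case True
    have "G x 0 = 0" if "x \<in> words m" for x
      using that by (simp add: G_def word_0 words_def)
    then show ?thesis using True by simp
  next
    case False
    then show ?thesis unfolding G_def
      using word_fluctuation[of R "4 ^ r * \<kappa>" k m] lip by (simp add: R_def)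
  qed
  have bG: "bounded_fun (G x)" for x
    using bounded_diff[OF bounded_word[OF bR] bounded_scale[OF bR]]
    unfolding bounded_fun_def G_def by simp
  have dev: "\<bar>S x - t\<bar> \<le> c * (\<Sum>h. \<bar>w\<bar> ^ h * (step ^^ l) (G x) (Suc h))" for x
  proof -
    have "S x - t = c * pairing w ((step ^^ l) (\<lambda>k. foldr absorbed_op x R k - 2 ^ m * R k))"
    proof -
      have "(step ^^ l) (\<lambda>k. foldr absorbed_op x R k - 2 ^ m * R k)
          = (\<lambda>k. (step ^^ l) (foldr absorbed_op x R) k - (step ^^ l) (\<lambda>k. 2 ^ m * R k) k)"
        by (rule ext) (rule walk.power_diff)
      then show ?thesis
        using pairing_diff[OF w bounded_power[OF bounded_word[OF bR]]
            bounded_power[OF bounded_scale[OF bR]], of l x l "2 ^ m"]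
        by (simp add: S t_def right_diff_distrib)
    qed
    then have "\<bar>S x - t\<bar>
        = c * \<bar>pairing w ((step ^^ l) (\<lambda>k. foldr absorbed_op x R k - 2 ^ m * R k))\<bar>"
      using c by (simp add: abs_mult)
    also have "\<dots> \<le> c * (\<Sum>h. \<bar>w\<bar> ^ h * (step ^^ l) (G x) (Suc h))"
    proof (rule mult_left_mono)
      let ?f = "(step ^^ l) (\<lambda>k. foldr absorbed_op x R k - 2 ^ m * R k)"
      have bf: "bounded_fun ?f"
        by (rule bounded_power[OF bounded_diff[OF bounded_word[OF bR] bounded_scale[OF bR]]])
      have "\<bar>pairing w ?f\<bar> \<le> (\<Sum>h. \<bar>w ^ h * ?f (Suc h)\<bar>)"
        unfolding pairing_def by (rule summable_rabs[OF summable_pairing(1)[OF w bf]])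
      also have "\<dots> \<le> (\<Sum>h. \<bar>w\<bar> ^ h * (step ^^ l) (G x) (Suc h))"
      proof (rule suminf_le[OF _ summable_pairing(1)[OF w bf]])
        show "\<bar>w ^ h * ?f (Suc h)\<bar> \<le> \<bar>w\<bar> ^ h * (step ^^ l) (G x) (Suc h)" for h
          unfolding abs_mult power_abs G_def by (intro mult_left_mono walk.power_abs) simp
        show "summable (\<lambda>h. \<bar>w\<bar> ^ h * (step ^^ l) (G x) (Suc h))"
          using w by (intro summable_pairing(2) bounded_power bG) simp
      qed
      finally show "\<bar>pairing w ?f\<bar> \<le> (\<Sum>h. \<bar>w\<bar> ^ h * (step ^^ l) (G x) (Suc h))" .
    qed (use c in simp)
    finally show ?thesis .
  qed
  have "(\<Sum>x\<in>words m. \<bar>S x - t\<bar>)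
      \<le> (\<Sum>x\<in>words m. c * pairing \<bar>w\<bar> ((step ^^ l) (G x)))"
    unfolding pairing_def using dev by (rule sum_mono)
  also have "\<dots> = c * pairing \<bar>w\<bar> (\<lambda>k. \<Sum>x\<in>words m. (step ^^ l) (G x) k)"
    using w by (simp add: pairing_sum bounded_power bG sum_distrib_left)
  also have "\<dots> \<le> c * (\<Sum>h. ?K * 4 ^ l * 2 * kern l 0 * (\<bar>w\<bar> ^ h * real (Suc h)))"
    unfolding pairing_def
  proof (rule mult_left_mono, rule suminf_le)
    fix h
    have "(\<Sum>x\<in>words m. (step ^^ l) (G x) (Suc h)) = (step ^^ l) (\<lambda>k. \<Sum>x\<in>words m. G x k) (Suc h)"
      by (simp add: walk.power_sum)
    also have "\<dots> \<le> (step ^^ l) (\<lambda>k. ?K * of_bool (0 < k)) (Suc h)"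
      using G_sum by (rule walk.power_mono)
    also have "\<dots> = ?K * (step ^^ l) (\<lambda>k. of_bool (0 < k)) (Suc h)"
      by (rule walk.power_scale)
    also have "\<dots> \<le> ?K * (4 ^ l * (2 * real (Suc h) * kern l 0))"
      using \<kappa> by (intro mult_left_mono step_survival_le) simp
    finally have "\<bar>w\<bar> ^ h * (\<Sum>x\<in>words m. (step ^^ l) (G x) (Suc h))
        \<le> \<bar>w\<bar> ^ h * (?K * (4 ^ l * (2 * real (Suc h) * kern l 0)))"
      by (rule mult_left_mono) simp
    then show "\<bar>w\<bar> ^ h * (\<Sum>x\<in>words m. (step ^^ l) (G x) (Suc h))
        \<le> ?K * 4 ^ l * 2 * kern l 0 * (\<bar>w\<bar> ^ h * real (Suc h))"
      by (simp only: mult_ac)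
  next
    have "(\<lambda>h. \<bar>w\<bar> ^ h * (\<Sum>x\<in>words m. (step ^^ l) (G x) (Suc h)))
        = (\<lambda>h. \<Sum>x\<in>words m. \<bar>w\<bar> ^ h * (step ^^ l) (G x) (Suc h))"
      by (simp only: sum_distrib_left)
    then show "summable (\<lambda>h. \<bar>w\<bar> ^ h * (\<Sum>x\<in>words m. (step ^^ l) (G x) (Suc h)))"
      using w by (auto intro!: summable_sum summable_pairing(2) bounded_power bG)
    show "summable (\<lambda>h. ?K * 4 ^ l * 2 * kern l 0 * (\<bar>w\<bar> ^ h * real (Suc h)))"
      by (intro summable_mult weighted_geometric_sums(1)[OF w])
  qed (use c in simp)
  also have "\<dots> = 4 ^ (l + m + r) * (c * (2 / (1 - \<bar>w\<bar>)\<^sup>2) * (\<kappa> * sqrt m * kern l 0))"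
    unfolding suminf_mult[OF weighted_geometric_sums(1)[OF w]] weighted_geometric_sums(2)[OF w]
    by (simp add: power_add)
  finally have B: "(\<Sum>x\<in>words m. \<bar>S x - t\<bar>)
      \<le> 4 ^ (l + m + r) * (c * (2 / (1 - \<bar>w\<bar>)\<^sup>2) * (\<kappa> * sqrt m * kern l 0))" .
  have "marginal_error ?\<alpha> ?\<beta> l m r (1 / 2) = (\<Sum>x\<in>words m. \<bar>S x / Z - (1 / 2) ^ m\<bar>)"
    unfolding marginal_error_def Z_def S_def
    by (rule sum.cong) (auto simp: words_def bernoulli_weight_half)
  also have "\<dots> \<le> 2 * (4 ^ (l + m + r) * (c * (2 / (1 - \<bar>w\<bar>)\<^sup>2) * (\<kappa> * sqrt m * kern l 0))) / Z"
    by (rule sum_deviation_bound[OF Z Z_pos B])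
  finally show ?thesis unfolding c_def .
qed

text \<open>All coefficients in the positive realisation are nonnegative, so the right vector \<open>\<beta>\<^sup>-\<^sup>j\<close> may be replaced
  by the smaller indicator of \<open>j = 0\<close>, which one application of \<open>C\<close> turns into the constant \<open>1/\<alpha>\<close>,
  the right vector for \<open>\<beta> = 1\<close>. Together with the symmetry in \<open>\<alpha>\<close> and \<open>\<beta>\<close> this bounds the normalization from
  below by one with rates \<open>1\<close>, where the absorbed walk starts from a point mass. A direct
  estimate with the absorbed walk would meet cancellations, as \<open>w < 0\<close> for \<open>\<alpha> > 1\<close>.\<close>

lemma total_weight_Suc_ge:
  assumes "\<alpha> > 0" "\<beta> > 0"
  shows "total_weight \<alpha> 1 n / \<alpha> \<le> total_weight \<alpha> \<beta> (Suc n)"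
proof -
  interpret L: letter_operators "site_op \<alpha>" using assms(1) by (rule letter_operators_site_op)
  have eq: "total_weight \<alpha> \<beta>' n = (L.total ^^ n) (\<lambda>j. (1 / \<beta>') ^ j) 0" for \<beta>' n
    by (simp only: total_weight_def weight_def L.sum_words)
  have hole: "hole_op \<alpha> (\<lambda>j. of_bool (j = 0)) j = 1 / \<alpha>" for j by (induction j) auto
  have first: "L.total (\<lambda>j. of_bool (j = 0)) = (\<lambda>j. 1 / \<alpha> * (1 / 1) ^ j)"
    by (rule ext) (simp add: L.total_def site_op_def hole)
  have "total_weight \<alpha> 1 n / \<alpha> = (L.total ^^ n) (\<lambda>j. 1 / \<alpha> * (1 / 1) ^ j) 0"
    by (simp only: eq L.power_scale) simp
  also have "\<dots> = (L.total ^^ Suc n) (\<lambda>j. of_bool (j = 0)) 0"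
    by (simp only: funpow_Suc_right comp_apply first)
  also have "\<dots> \<le> (L.total ^^ Suc n) (\<lambda>j. (1 / \<beta>) ^ j) 0"
    using assms(2) by (intro L.power_mono) simp
  finally show ?thesis by (simp only: eq)
qed

lemma total_weight_absorbed_0:
  assumes "-1 < v" "v \<le> 1"
  shows "total_weight 1 (1 / (1 + v)) n = (step ^^ n) (geometric v) 1"
proof -
  have "pairing 0 f = f 1" for f
    using powser_zero[of "\<lambda>h. f (Suc h)"] by (simp add: pairing_def mult.commute)
  then have "weight 1 (1 / (1 + v)) u = foldr absorbed_op u (geometric v) 1" for u
    using weight_absorbed[of 0 v u] assms by simp
  then show ?thesis by (simp only: total_weight_def walk.sum_words)
qed

lemma total_weight_1_1: "total_weight 1 1 n = 4 ^ n * (kern n 0 - kern n 2)"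
proof -
  have "geometric 0 = (\<lambda>i. of_bool (i = 1))"
    by (rule ext) (auto simp: geometric_def)
  then show ?thesis
    using total_weight_absorbed_0[of 0 n] step_point[of 1 n 1] by simp
qed

lemma geometric_1: "geometric 1 = (\<lambda>i. of_bool (0 < i))"
  by (rule ext) (auto simp: geometric_def)

lemma total_weight_1_half: "4 ^ n * kern n 0 \<le> total_weight 1 (1 / 2) n"
  using total_weight_absorbed_0[of 1 n] step_survival[of n 1] kern_nonneg[of n 1]
  by (simp add: geometric_1)

text \<open>The bound combines \<open>marginal_error_absorbed\<close> with a lower bound \<open>4\<^sup>N z\<close> for the normalization \<open>Z\<close>,
  \<open>N = l + m + r\<close>. For
  \<open>\<beta> > 1/2\<close>, \<open>z\<close> is of order \<open>N\<^sup>-\<^sup>3\<^sup>/\<^sup>2\<close> and \<open>\<kappa>\<close> of order \<open>r\<^sup>-\<^sup>3\<^sup>/\<^sup>2\<close>; for \<open>\<beta> = 1/2\<close> they are of order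
  \<open>N\<^sup>-\<^sup>1\<^sup>/\<^sup>2\<close> and \<open>r\<^sup>-\<^sup>1\<^sup>/\<^sup>2\<close>, which is no worse than the common bound, as \<open>N \<ge> r + 1\<close>.\<close>

lemma maximal_current_bound:
  assumes \<alpha>: "\<alpha> > 1 / 2" and \<beta>: "\<beta> \<ge> 1 / 2"
  shows "\<exists>C\<ge>0. \<forall>l m r. 1 \<le> m \<longrightarrow> 1 \<le> r \<longrightarrow>
    marginal_error \<alpha> \<beta> l m r (1 / 2) \<le> C * sqrt m * (real (l + m + r) * sqrt (l + m + r))
      / (sqrt (real l + 1) * ((real r + 1) * sqrt (real r + 1)))"
proof -
  define w where "w = 1 / \<alpha> - 1"
  define v where "v = 1 / \<beta> - 1"
  have w: "\<bar>w\<bar> < 1" using \<alpha> by (auto simp: w_def abs_less_iff field_simps)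
  have v: "-1 < v" "v \<le> 1" using \<beta> by (auto simp: v_def field_simps)
  have rates: "1 / (1 + w) = \<alpha>" "1 / (1 + v) = \<beta>" using \<alpha> \<beta> by (auto simp: w_def v_def)
  have pos: "\<alpha> > 0" "\<beta> > 0" using \<alpha> \<beta> by auto
  have "\<bar>w * v\<bar> \<le> \<bar>w\<bar> * 1" unfolding abs_mult using v by (intro mult_left_mono) auto
  then have wv: "1 - w * v > 0" using w by linarith
  define c where "c = (1 - w * v) * (2 / (1 - \<bar>w\<bar>)\<^sup>2)"
  have c: "c \<ge> 0" using wv by (simp add: c_def)
  have error: "marginal_error \<alpha> \<beta> l m r (1 / 2) \<le> 2 * c * b * (1 / sqrt (real l + 1)) * sqrt m / z"
    if lip: "\<And>k. \<bar>(step ^^ r) (geometric v) (Suc k) - (step ^^ r) (geometric v) k\<bar> \<le> 4 ^ r * \<kappa>"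
      and b: "\<kappa> \<le> b" and z: "0 < z" "4 ^ (l + m + r) * z \<le> total_weight \<alpha> \<beta> (l + m + r)"
    for l m r \<kappa> b z
  proof -
    have "0 \<le> 4 ^ r * \<kappa>" using lip[of 0] by linarith
    then have "4 ^ r * 0 \<le> 4 ^ r * \<kappa>" by simp
    then have \<kappa>: "0 \<le> \<kappa>" by (rule mult_left_le_imp_le) simp
    let ?e = "c * (\<kappa> * sqrt m * kern l 0)" and ?e' = "c * (b * sqrt m * (1 / sqrt (real l + 1)))"
    have "marginal_error \<alpha> \<beta> l m r (1 / 2)
        \<le> 2 * (4 ^ (l + m + r) * ?e) / total_weight \<alpha> \<beta> (l + m + r)"
      using marginal_error_absorbed[OF w v lip, where l = l and m = m] by (simp only: rates c_def)
    also have "\<dots> \<le> 2 * (4 ^ (l + m + r) * ?e) / (4 ^ (l + m + r) * z)"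
      using z c \<kappa> kern_nonneg[of l 0] total_weight_pos[OF pos, of "l + m + r"]
      by (intro divide_left_mono) auto
    also have "\<dots> = 2 * ?e / z" by simp
    also have "\<dots> \<le> 2 * ?e' / z"
      using z(1) c \<kappa> b kern_nonneg[of l 0] kern_0_upper[of l]
      by (intro divide_right_mono mult_left_mono mult_mono) auto
    finally show ?thesis by (simp only: mult_ac)
  qed
  show ?thesis
  proof (cases "\<beta> = 1 / 2")
    case False
    then have v': "\<bar>v\<bar> < 1" using \<beta> by (auto simp: v_def abs_less_iff field_simps)
    show ?thesis
    proof (intro exI[of _ "2560 * c * \<alpha> / (1 - \<bar>v\<bar>)\<^sup>2"] conjI allI impI)
      fix l m r :: nat
      assume "1 \<le> m" "1 \<le> r"
      then obtain n where n: "l + m + r = Suc (Suc n)"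
        by (metis One_nat_def Suc_le_D add_Suc_right add_Suc)
      let ?N = "real (l + m + r)"
      have N: "?N > 0" using n by simp
      \<comment> \<open>Two applications of \<open>total_weight_Suc_ge\<close> lose a factor \<open>4\<^sup>2\<close>; another \<open>2\<close> comes from \<open>kern_0_lower\<close>.\<close>
      define z where "z = 1 / (32 * \<alpha> * (?N * sqrt ?N))"
      have z: "z > 0" using pos N by (simp add: z_def)
      have "16 * z \<le> 1 / (2 * sqrt (real n + 1)) / (real n + 1) / \<alpha>"
      proof -
        have "(real n + 1) * sqrt (real n + 1) \<le> ?N * sqrt ?N"
          unfolding n by (intro mult_mono) auto
        then have "1 / (2 * \<alpha> * (?N * sqrt ?N)) \<le> 1 / (2 * \<alpha> * ((real n + 1) * sqrt (real n + 1)))"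
          using pos N by (intro divide_left_mono mult_left_mono) auto
        then show ?thesis by (simp add: z_def mult_ac)
      qed
      also have "\<dots> \<le> kern n 0 / (real n + 1) / \<alpha>"
        using pos by (intro divide_right_mono kern_0_lower) auto
      also have "\<dots> \<le> (kern n 0 - kern n 2) / \<alpha>"
        using pos by (intro divide_right_mono kern_0_minus_kern_2) auto
      finally have "4 ^ n * (16 * z) \<le> 4 ^ n * ((kern n 0 - kern n 2) / \<alpha>)"
        by (rule mult_left_mono) simp
      also have "\<dots> = total_weight 1 1 n / 1 / \<alpha>" by (simp add: total_weight_1_1)
      also have "\<dots> \<le> total_weight 1 \<alpha> (Suc n) / \<alpha>"
        using pos total_weight_Suc_ge[of 1 \<alpha> n] by (intro divide_right_mono) auto
      also have "\<dots> = total_weight \<alpha> 1 (Suc n) / \<alpha>"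
        using total_weight_commute[of 1 \<alpha>] pos by simp
      also have "\<dots> \<le> total_weight \<alpha> \<beta> (l + m + r)"
        unfolding n by (rule total_weight_Suc_ge[OF pos])
      finally have Z: "4 ^ (l + m + r) * z \<le> total_weight \<alpha> \<beta> (l + m + r)"
        by (simp add: n)
      let ?b = "40 * (1 / sqrt (real r + 1)) / (real r + 1) / (1 - \<bar>v\<bar>)\<^sup>2"
      have "marginal_error \<alpha> \<beta> l m r (1 / 2)
          \<le> 2 * c * ?b * (1 / sqrt (real l + 1)) * sqrt m / z"
        by (rule error[OF step_geometric_lipschitz[OF v'] _ z Z])
           (intro divide_right_mono mult_left_mono kern_0_upper; simp)
      also have "\<dots> = 2560 * c * \<alpha> / (1 - \<bar>v\<bar>)\<^sup>2 * sqrt m * (?N * sqrt ?N)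
          / (sqrt (real l + 1) * ((real r + 1) * sqrt (real r + 1)))"
        by (simp add: z_def mult_ac)
      finally show "marginal_error \<alpha> \<beta> l m r (1 / 2)
          \<le> 2560 * c * \<alpha> / (1 - \<bar>v\<bar>)\<^sup>2 * sqrt m * (?N * sqrt ?N)
            / (sqrt (real l + 1) * ((real r + 1) * sqrt (real r + 1)))" .
    qed (use c pos in simp)
  next
    case True
    then have v1: "v = 1" unfolding v_def True by simp
    show ?thesis
    proof (intro exI[of _ "16 * c"] conjI allI impI)
      fix l m r :: nat
      assume "1 \<le> m" "1 \<le> r"
      then obtain n where n: "l + m + r = Suc n" by (metis Suc_le_D add_Suc_right One_nat_def)
      let ?N = "real (l + m + r)"
      have N: "?N > 0" using n by simp
      \<comment> \<open>One application of \<open>total_weight_Suc_ge\<close> loses \<open>4\<close> and gains the inverse rate \<open>2\<close>; \<open>kern_0_lower\<close> loses \<open>2\<close>.\<close>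
      define z where "z = 1 / (4 * sqrt ?N)"
      have z: "z > 0" using N by (simp add: z_def)
      have "4 * z = 2 * (1 / (2 * sqrt (real n + 1)))" unfolding z_def n by (simp add: add.commute)
      also have "\<dots> \<le> 2 * kern n 0" by (intro mult_left_mono kern_0_lower) simp
      finally have "4 ^ n * (4 * z) \<le> 4 ^ n * (2 * kern n 0)" by (rule mult_left_mono) simp
      also have "\<dots> \<le> total_weight 1 (1 / 2) n / (1 / 2)" using total_weight_1_half[of n] by simp
      also have "\<dots> = total_weight (1 / 2) 1 n / (1 / 2)"
        using total_weight_commute[of 1 "1 / 2" n] by simp
      also have "\<dots> \<le> total_weight (1 / 2) \<alpha> (Suc n)"
        using pos by (intro total_weight_Suc_ge) auto
      also have "\<dots> = total_weight \<alpha> \<beta> (l + m + r)"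
        using total_weight_commute[of \<alpha> "1 / 2" "Suc n"] pos unfolding True n by simp
      finally have Z: "4 ^ (l + m + r) * z \<le> total_weight \<alpha> \<beta> (l + m + r)"
        by (simp add: n)
      have lip: "\<bar>(step ^^ r) (geometric v) (Suc k) - (step ^^ r) (geometric v) k\<bar>
          \<le> 4 ^ r * (2 * kern r 0)" for k
        unfolding v1 geometric_1 by (rule step_survival_lipschitz)
      have "marginal_error \<alpha> \<beta> l m r (1 / 2)
          \<le> 2 * c * (2 * (1 / sqrt (real r + 1))) * (1 / sqrt (real l + 1)) * sqrt m / z"
        by (rule error[OF lip _ z Z]) (intro mult_left_mono kern_0_upper; simp)
      also have "\<dots> = 16 * c * sqrt m * (1 * sqrt ?N)
          / (sqrt (real l + 1) * sqrt (real r + 1))"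
        by (simp add: z_def mult_ac)
      also have "\<dots> \<le> 16 * c * sqrt m * (?N / (real r + 1) * sqrt ?N)
          / (sqrt (real l + 1) * sqrt (real r + 1))"
      proof -
        have "1 \<le> ?N / (real r + 1)" using \<open>1 \<le> m\<close> by simp
        then show ?thesis using c
          by (intro divide_right_mono mult_left_mono mult_right_mono) auto
      qed
      also have "\<dots> = 16 * c * sqrt m * (?N * sqrt ?N)
          / (sqrt (real l + 1) * ((real r + 1) * sqrt (real r + 1)))"
        by simp
      finally show "marginal_error \<alpha> \<beta> l m r (1 / 2) \<le> 16 * c * sqrt m * (?N * sqrt ?N)
          / (sqrt (real l + 1) * ((real r + 1) * sqrt (real r + 1)))" .
    qed (use c in simp)
  qed
qed

text \<open>For \<open>\<alpha> = \<beta> = 1/2\<close> the rules are satisfied by the scalars \<open>D = E = 2\<close>.\<close>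

lemma marginal_error_half_half: "marginal_error (1 / 2) (1 / 2) l m r (1 / 2) = 0"
proof -
  have w: "weight (1 / 2) (1 / 2) u = 2 ^ length u" for u
    by (rule weight_eqI) (auto simp: matrix_product_weight_def)
  have Z: "total_weight (1 / 2) (1 / 2) n = 2 ^ n * 2 ^ n" for n
    by (simp add: total_weight_def w words_def) (simp add: card_words[unfolded words_def])
  have "(\<Sum>u\<in>words l. \<Sum>y\<in>words r. weight (1 / 2) (1 / 2) (u @ x @ y))
      / total_weight (1 / 2) (1 / 2) (l + m + r) = bernoulli_weight (1 / 2) x"
    if x: "x \<in> words m" for x
  proof -
    have "(\<Sum>u\<in>words l. \<Sum>y\<in>words r. weight (1 / 2) (1 / 2) (u @ x @ y))
        = (\<Sum>u\<in>words l. \<Sum>y\<in>words r. 2 ^ (l + m + r))"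
      using x by (intro sum.cong refl) (auto simp: w words_def)
    moreover have "length x = m" using x by (simp add: words_def)
    ultimately show ?thesis
      by (simp add: Z card_words bernoulli_weight_half power_add power_one_over)
  qed
  then show ?thesis by (simp add: marginal_error_def)
qed

lemma maximal_current_error:
  assumes \<alpha>: "\<alpha> \<ge> 1 / 2" and \<beta>: "\<beta> \<ge> 1 / 2" and \<delta>: "\<delta> > 0"
  shows "\<exists>C. \<forall>l m r. 1 \<le> l \<longrightarrow> 1 \<le> m \<longrightarrow> 1 \<le> r \<longrightarrow>
    \<delta> * real (l + m + r) \<le> real l + 1 \<longrightarrow> \<delta> * real (l + m + r) \<le> real r + 1 \<longrightarrow>
    marginal_error \<alpha> \<beta> l m r (1 / 2) \<le> C * sqrt (real m / real (l + m + r))"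
proof -
  have scale: "C * sqrt m * (N * sqrt N) / (sqrt x * (y * sqrt y)) \<le> C / \<delta>\<^sup>2 * sqrt (m / N)"
    if "C \<ge> 0" "N > 0" "\<delta> * N \<le> x" "\<delta> * N \<le> y" "m \<ge> 0" for C m N x y :: real
  proof -
    have p: "\<delta> * N > 0" using \<delta> that by simp
    then have xy: "x > 0" "y > 0" using that by linarith+
    have "\<delta>\<^sup>2 * (N * N) = sqrt (\<delta> * N) * (\<delta> * N * sqrt (\<delta> * N))"
      using p by (simp add: power2_eq_square mult_ac)
    also have "\<dots> \<le> sqrt x * (y * sqrt y)"
      using that p by (intro mult_mono) auto
    finally have D: "\<delta>\<^sup>2 * (N * N) \<le> sqrt x * (y * sqrt y)" .
    have D0: "0 < \<delta>\<^sup>2 * (N * N)" using \<delta> that by simp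
    have "C * sqrt m * (N * sqrt N) / (sqrt x * (y * sqrt y))
        \<le> C * sqrt m * (N * sqrt N) / (\<delta>\<^sup>2 * (N * N))"
      using D D0 xy that by (intro divide_left_mono mult_nonneg_nonneg mult_pos_pos) auto
    also have "\<dots> = C / \<delta>\<^sup>2 * (sqrt m * (sqrt N / N))" using that by simp
    also have "sqrt N / N = 1 / sqrt N" using that by (simp add: field_simps)
    finally show ?thesis by (simp add: real_sqrt_divide)
  qed
  consider "\<alpha> > 1 / 2" | "\<alpha> = 1 / 2" "\<beta> > 1 / 2" | "\<alpha> = 1 / 2" "\<beta> = 1 / 2" using \<alpha> \<beta> by linarith
  then show ?thesis
  proof cases
    case 1
    obtain C where C: "C \<ge> 0" "\<And>l m r. 1 \<le> m \<Longrightarrow> 1 \<le> r \<Longrightarrow>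
      marginal_error \<alpha> \<beta> l m r (1 / 2) \<le> C * sqrt m * (real (l + m + r) * sqrt (l + m + r))
        / (sqrt (real l + 1) * ((real r + 1) * sqrt (real r + 1)))"
      using maximal_current_bound[OF 1 \<beta>] by blast
    show ?thesis
    proof (intro exI[of _ "C / \<delta>\<^sup>2"] allI impI)
      fix l m r :: nat
      assume lmr: "1 \<le> l" "1 \<le> m" "1 \<le> r" "\<delta> * real (l + m + r) \<le> real l + 1"
        "\<delta> * real (l + m + r) \<le> real r + 1"
      show "marginal_error \<alpha> \<beta> l m r (1 / 2) \<le> C / \<delta>\<^sup>2 * sqrt (real m / real (l + m + r))"
        by (rule order_trans[OF C(2)[OF lmr(2,3)] scale]) (use C lmr in auto)
    qed
  next
    case 2
    obtain C where C: "C \<ge> 0" "\<And>l m r. 1 \<le> m \<Longrightarrow> 1 \<le> r \<Longrightarrow>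
      marginal_error \<beta> \<alpha> l m r (1 / 2) \<le> C * sqrt m * (real (l + m + r) * sqrt (l + m + r))
        / (sqrt (real l + 1) * ((real r + 1) * sqrt (real r + 1)))"
      using maximal_current_bound[OF 2(2) \<alpha>] by blast
    show ?thesis
    proof (intro exI[of _ "C / \<delta>\<^sup>2"] allI impI)
      fix l m r :: nat
      assume lmr: "1 \<le> l" "1 \<le> m" "1 \<le> r" "\<delta> * real (l + m + r) \<le> real l + 1"
        "\<delta> * real (l + m + r) \<le> real r + 1"
      have "marginal_error \<alpha> \<beta> l m r (1 / 2) = marginal_error \<beta> \<alpha> r m l (1 / 2)"
        using marginal_error_reflect[of \<alpha> \<beta> l m r "1 / 2"] \<alpha> \<beta> by simp
      also have "\<dots> \<le> C / \<delta>\<^sup>2 * sqrt (real m / real (r + m + l))"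
        by (rule order_trans[OF C(2)[OF lmr(2,1)] scale]) (use C lmr in \<open>auto simp: add_ac\<close>)
      finally show "marginal_error \<alpha> \<beta> l m r (1 / 2) \<le> C / \<delta>\<^sup>2 * sqrt (real m / real (l + m + r))"
        by (simp add: add_ac)
    qed
  next
    case 3
    show ?thesis
      unfolding 3 by (intro exI[of _ 0]) (simp add: marginal_error_half_half)
  qed
qed

section \<open>The stationary measure\<close>

lemma configs_extensional: "\<eta> \<in> configs S \<Longrightarrow> x \<notin> S \<Longrightarrow> \<eta> x = undefined"
  by (auto simp: configs_def PiE_def extensional_def)

lemma configs_eqI:
  "\<eta> \<in> configs S \<Longrightarrow> \<zeta> \<in> configs S \<Longrightarrow> (\<And>x. x \<in> S \<Longrightarrow> \<eta> x = \<zeta> x) \<Longrightarrow> \<eta> = \<zeta>"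
  unfolding configs_def by (rule PiE_ext)

lemma configs_update: "\<eta> \<in> configs S \<Longrightarrow> x \<in> S \<Longrightarrow> \<eta>(x := c) \<in> configs S"
  by (auto simp: configs_def PiE_def extensional_def)

lemma finite_configs: "finite S \<Longrightarrow> finite (configs S)"
  unfolding configs_def by (intro finite_PiE) auto

lemma swap_at_configs: "\<eta> \<in> configs S \<Longrightarrow> x \<in> S \<Longrightarrow> y \<in> S \<Longrightarrow> swap_at x y \<eta> \<in> configs S"
  unfolding swap_at_def by (intro configs_update)

lemma flip_at_configs: "\<eta> \<in> configs S \<Longrightarrow> x \<in> S \<Longrightarrow> flip_at x \<eta> \<in> configs S"
  unfolding flip_at_def by (intro configs_update)

lemma swap_at_swap_at: "swap_at x y (swap_at x y \<eta>) = \<eta>"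
  by (auto simp: swap_at_def fun_eq_iff)

lemma swap_at_left: "x \<noteq> y \<Longrightarrow> swap_at x y \<eta> x = \<eta> y"
  and swap_at_right: "swap_at x y \<eta> y = \<eta> x"
  by (simp_all add: swap_at_def)

lemma flip_at_same: "flip_at x \<eta> x \<longleftrightarrow> \<not> \<eta> x"
  by (simp add: flip_at_def)

lemma flip_at_flip_at: "flip_at x (flip_at x \<eta>) = \<eta>"
  by (auto simp: flip_at_def fun_eq_iff)

text \<open>The transpose of the generator: inflow minus outflow of mass at \<open>\<eta>\<close>.\<close>

definition tasep_adjoint :: "nat \<Rightarrow> real \<Rightarrow> real \<Rightarrow> (config \<Rightarrow> real) \<Rightarrow> config \<Rightarrow> real" where
  "tasep_adjoint N \<alpha> \<beta> p \<eta> =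
     (\<Sum>x\<in>{1..<N}. of_bool (\<not> \<eta> x \<and> \<eta> (x + 1)) * p (swap_at x (x + 1) \<eta>)
                  - of_bool (\<eta> x \<and> \<not> \<eta> (x + 1)) * p \<eta>)
     + \<alpha> * (if \<eta> 1 then p (flip_at 1 \<eta>) else - p \<eta>)
     + \<beta> * (if \<eta> N then - p \<eta> else p (flip_at N \<eta>))"

lemma sum_involution:
  fixes p f c :: "'a \<Rightarrow> real"
  assumes T: "\<And>\<eta>. \<eta> \<in> S \<Longrightarrow> T \<eta> \<in> S" "\<And>\<eta>. \<eta> \<in> S \<Longrightarrow> T (T \<eta>) = \<eta>"
  shows "(\<Sum>\<eta>\<in>S. p \<eta> * (c \<eta> * (f (T \<eta>) - f \<eta>))) = (\<Sum>\<eta>\<in>S. (c (T \<eta>) * p (T \<eta>) - c \<eta> * p \<eta>) * f \<eta>)"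
proof -
  have "bij_betw T S S" by (rule bij_betwI[of _ _ _ T]) (use T in auto)
  then have "(\<Sum>\<eta>\<in>S. c (T \<eta>) * p (T \<eta>) * f (T (T \<eta>))) = (\<Sum>\<eta>\<in>S. c \<eta> * p \<eta> * f (T \<eta>))"
    by (rule sum.reindex_bij_betw)
  then have "(\<Sum>\<eta>\<in>S. c (T \<eta>) * p (T \<eta>) * f \<eta>) = (\<Sum>\<eta>\<in>S. c \<eta> * p \<eta> * f (T \<eta>))"
    using T by simp
  then show ?thesis by (simp add: algebra_simps sum_subtractf sum.distrib)
qed

lemma sum_tasep_gen:
  assumes N: "N \<ge> 1"
  shows "(\<Sum>\<eta>\<in>configs {1..N}. p \<eta> * tasep_gen N \<alpha> \<beta> f \<eta>)
    = (\<Sum>\<eta>\<in>configs {1..N}. tasep_adjoint N \<alpha> \<beta> p \<eta> * f \<eta>)"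
proof -
  let ?S = "configs {1..N}"
  let ?b = "\<lambda>x \<eta>. of_bool (\<eta> x) * (1 - of_bool (\<eta> (x + 1))) :: real"
  have bulk: "(\<Sum>\<eta>\<in>?S. p \<eta> * (?b x \<eta> * (f (swap_at x (x + 1) \<eta>) - f \<eta>)))
      = (\<Sum>\<eta>\<in>?S. (of_bool (\<not> \<eta> x \<and> \<eta> (x + 1)) * p (swap_at x (x + 1) \<eta>)
                  - of_bool (\<eta> x \<and> \<not> \<eta> (x + 1)) * p \<eta>) * f \<eta>)" if "x \<in> {1..<N}" for x
    using that
    by (subst sum_involution[of _ "swap_at x (x + 1)"])
       (auto simp: swap_at_configs swap_at_swap_at of_bool_def swap_at_left swap_at_right
         intro!: sum.cong)
  have left: "(\<Sum>\<eta>\<in>?S. p \<eta> * (\<alpha> * (1 - of_bool (\<eta> 1)) * (f (flip_at 1 \<eta>) - f \<eta>)))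
      = (\<Sum>\<eta>\<in>?S. \<alpha> * (if \<eta> 1 then p (flip_at 1 \<eta>) else - p \<eta>) * f \<eta>)"
    using N
    by (subst sum_involution[of _ "flip_at 1"])
       (auto simp: flip_at_configs flip_at_flip_at flip_at_same intro!: sum.cong)
  have right: "(\<Sum>\<eta>\<in>?S. p \<eta> * (\<beta> * of_bool (\<eta> N) * (f (flip_at N \<eta>) - f \<eta>)))
      = (\<Sum>\<eta>\<in>?S. \<beta> * (if \<eta> N then - p \<eta> else p (flip_at N \<eta>)) * f \<eta>)"
    using N
    by (subst sum_involution[of _ "flip_at N"])
       (auto simp: flip_at_configs flip_at_flip_at flip_at_same intro!: sum.cong)
  have "(\<Sum>\<eta>\<in>?S. p \<eta> * tasep_gen N \<alpha> \<beta> f \<eta>)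
      = (\<Sum>\<eta>\<in>?S. \<Sum>x\<in>{1..<N}. p \<eta> * (?b x \<eta> * (f (swap_at x (x + 1) \<eta>) - f \<eta>)))
        + (\<Sum>\<eta>\<in>?S. p \<eta> * (\<alpha> * (1 - of_bool (\<eta> 1)) * (f (flip_at 1 \<eta>) - f \<eta>)))
        + (\<Sum>\<eta>\<in>?S. p \<eta> * (\<beta> * of_bool (\<eta> N) * (f (flip_at N \<eta>) - f \<eta>)))"
    unfolding tasep_gen_def by (simp only: distrib_left sum.distrib sum_distrib_left)
  also have "(\<Sum>\<eta>\<in>?S. \<Sum>x\<in>{1..<N}. p \<eta> * (?b x \<eta> * (f (swap_at x (x + 1) \<eta>) - f \<eta>)))
      = (\<Sum>x\<in>{1..<N}. \<Sum>\<eta>\<in>?S. p \<eta> * (?b x \<eta> * (f (swap_at x (x + 1) \<eta>) - f \<eta>)))"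
    by (rule sum.swap)
  also have "\<dots> = (\<Sum>x\<in>{1..<N}. \<Sum>\<eta>\<in>?S. (of_bool (\<not> \<eta> x \<and> \<eta> (x + 1)) * p (swap_at x (x + 1) \<eta>)
                  - of_bool (\<eta> x \<and> \<not> \<eta> (x + 1)) * p \<eta>) * f \<eta>)"
    by (rule sum.cong[OF refl bulk])
  also have "\<dots> = (\<Sum>\<eta>\<in>?S. \<Sum>x\<in>{1..<N}. (of_bool (\<not> \<eta> x \<and> \<eta> (x + 1)) * p (swap_at x (x + 1) \<eta>)
                  - of_bool (\<eta> x \<and> \<not> \<eta> (x + 1)) * p \<eta>) * f \<eta>)"
    by (rule sum.swap)
  finally show ?thesis
    unfolding left right tasep_adjoint_def
    by (simp only: distrib_right sum.distrib sum_distrib_right)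
qed

lemma tasep_gen_bound:
  assumes N: "N \<ge> 1" and \<alpha>\<beta>: "\<alpha> > 0" "\<beta> > 0"
    and f: "\<And>\<eta>. \<eta> \<in> configs {1..N} \<Longrightarrow> \<bar>f \<eta>\<bar> \<le> M"
    and \<eta>: "\<eta> \<in> configs {1..N}"
  shows "\<bar>tasep_gen N \<alpha> \<beta> f \<eta>\<bar> \<le> (real N + \<alpha> + \<beta>) * 2 * M"
proof -
  have M: "M \<ge> 0" using f[OF \<eta>] by linarith
  have diff: "\<bar>f \<zeta> - f \<eta>\<bar> \<le> 2 * M" if "\<zeta> \<in> configs {1..N}" for \<zeta>
    using f[OF that] f[OF \<eta>] by linarith
  have bulk: "\<bar>of_bool (\<eta> x) * (1 - of_bool (\<eta> (x + 1))) * (f (swap_at x (x + 1) \<eta>) - f \<eta>)\<bar> \<le> 2 * M"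
    if "x \<in> {1..<N}" for x
    using diff[OF swap_at_configs[OF \<eta>, of x "x + 1"]] that M by (auto simp: of_bool_def)
  have "\<bar>\<Sum>x\<in>{1..<N}. of_bool (\<eta> x) * (1 - of_bool (\<eta> (x + 1))) * (f (swap_at x (x + 1) \<eta>) - f \<eta>)\<bar>
      \<le> (\<Sum>x\<in>{1..<N}. 2 * M)"
    by (rule order_trans[OF sum_abs sum_mono[OF bulk]])
  also have "\<dots> \<le> real N * (2 * M)" using M by (simp add: mult_right_mono)
  finally have 1: "\<bar>\<Sum>x\<in>{1..<N}. of_bool (\<eta> x) * (1 - of_bool (\<eta> (x + 1)))
      * (f (swap_at x (x + 1) \<eta>) - f \<eta>)\<bar> \<le> real N * (2 * M)" .
  have 2: "\<bar>\<alpha> * (1 - of_bool (\<eta> 1)) * (f (flip_at 1 \<eta>) - f \<eta>)\<bar> \<le> \<alpha> * (2 * M)"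
    using diff[OF flip_at_configs[OF \<eta>, of 1]] N \<alpha>\<beta> M by (auto simp: of_bool_def abs_mult)
  have 3: "\<bar>\<beta> * of_bool (\<eta> N) * (f (flip_at N \<eta>) - f \<eta>)\<bar> \<le> \<beta> * (2 * M)"
    using diff[OF flip_at_configs[OF \<eta>, of N]] N \<alpha>\<beta> M by (auto simp: of_bool_def abs_mult)
  have "(real N + \<alpha> + \<beta>) * 2 * M = real N * (2 * M) + \<alpha> * (2 * M) + \<beta> * (2 * M)"
    by (simp add: algebra_simps)
  then show ?thesis unfolding tasep_gen_def using 1 2 3 by linarith
qed

text \<open>The semigroup is only given for \<open>t \<ge> 0\<close>, so the derivative at \<open>0\<close> is evaluated along \<open>t = 1/(n + 1)\<close>.\<close>

lemma constant_power_series_coeff: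
  fixes c :: "nat \<Rightarrow> real"
  assumes summable: "\<And>t. summable (\<lambda>n. c n * t ^ n)"
    and const: "\<And>t. t \<ge> 0 \<Longrightarrow> (\<Sum>n. c n * t ^ n) = c 0"
  shows "c 1 = 0"
proof -
  let ?F = "\<lambda>t. \<Sum>n. c n * t ^ n"
  have "(?F has_real_derivative (\<Sum>n. diffs c n * 0 ^ n)) (at 0)"
    by (rule termdiffs_strong[of c 1]) (use summable[of 1] in auto)
  moreover have "(\<Sum>n. diffs c n * 0 ^ n) = c 1"
    by (simp add: powser_zero diffs_def)
  ultimately have "(\<lambda>t. (?F (0 + t) - ?F 0) / t) \<midarrow>0\<rightarrow> c 1"
    by (simp add: DERIV_def)
  moreover have "filterlim (\<lambda>n. 1 / real (Suc n)) (at 0) sequentially"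
    by (intro filterlim_atI LIMSEQ_Suc lim_1_over_n) auto
  ultimately have "(\<lambda>n. (?F (0 + 1 / real (Suc n)) - ?F 0) / (1 / real (Suc n))) \<longlonglongrightarrow> c 1"
    by (rule filterlim_compose)
  moreover have "?F (0 + 1 / real (Suc n)) - ?F 0 = 0" for n
    using const[of "1 / real (Suc n)"] const[of 0] by simp
  ultimately have "(\<lambda>n. 0) \<longlonglongrightarrow> c 1" by simp
  then show ?thesis using LIMSEQ_unique tendsto_const by blast
qed

text \<open>The expectation of the exponential series is a power series in \<open>t\<close> with linear coefficient the
  expectation of \<open>L f\<close>, and stationarity makes it constant. The generator is bounded on a finite state
  space, so the series converges for all \<open>t\<close>.\<close>

lemma stationary_sum_gen:
  assumes N: "N \<ge> 1" and \<alpha>\<beta>: "\<alpha> > 0" "\<beta> > 0" and st: "tasep_stationary N \<alpha> \<beta> \<mu>"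
  shows "(\<Sum>\<eta>\<in>configs {1..N}. pmf \<mu> \<eta> * tasep_gen N \<alpha> \<beta> f \<eta>) = 0"
proof -
  let ?S = "configs {1..N}" and ?L = "tasep_gen N \<alpha> \<beta>"
  define M where "M = (\<Sum>\<eta>\<in>?S. \<bar>f \<eta>\<bar>)"
  define K where "K = (real N + \<alpha> + \<beta>) * 2"
  have K: "K \<ge> 0" using \<alpha>\<beta> by (simp add: K_def)
  have bound: "\<bar>(?L ^^ n) f \<eta>\<bar> \<le> K ^ n * M" if "\<eta> \<in> ?S" for n \<eta>
    using that
  proof (induction n arbitrary: \<eta>)
    case 0
    then show ?case using finite_configs[of "{1..N}"]
      by (auto simp: M_def intro: member_le_sum[of _ _ "\<lambda>\<eta>. \<bar>f \<eta>\<bar>"])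
  next
    case (Suc n)
    then show ?case
      using tasep_gen_bound[OF N \<alpha>\<beta>, of "(?L ^^ n) f" "K ^ n * M" \<eta>] by (simp add: K_def mult.assoc)
  qed
  have sm: "summable (\<lambda>n. t ^ n / fact n * (?L ^^ n) f \<eta>)" if "\<eta> \<in> ?S" for t \<eta>
  proof (rule summable_comparison_test'[of _ 0])
    show "summable (\<lambda>n. inverse (fact n) * (\<bar>t\<bar> * K) ^ n * M)"
      by (intro summable_mult2 summable_exp)
    show "norm (t ^ n / fact n * (?L ^^ n) f \<eta>) \<le> inverse (fact n) * (\<bar>t\<bar> * K) ^ n * M" for n
    proof -
      have "norm (t ^ n / fact n * (?L ^^ n) f \<eta>) = \<bar>t\<bar> ^ n / fact n * \<bar>(?L ^^ n) f \<eta>\<bar>"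
        by (simp add: abs_mult power_abs)
      also have "\<dots> \<le> \<bar>t\<bar> ^ n / fact n * (K ^ n * M)"
        using bound[OF that] by (intro mult_left_mono) auto
      finally show ?thesis by (simp add: power_mult_distrib field_simps)
    qed
  qed
  define c where "c n = (\<Sum>\<eta>\<in>?S. pmf \<mu> \<eta> * (?L ^^ n) f \<eta>) / fact n" for n
  have eq: "c n * t ^ n = (\<Sum>\<eta>\<in>?S. pmf \<mu> \<eta> * (t ^ n / fact n * (?L ^^ n) f \<eta>))" for n t
    by (simp add: c_def sum_distrib_left sum_distrib_right sum_divide_distrib mult_ac)
  have "c 1 = 0"
  proof (rule constant_power_series_coeff)
    show "summable (\<lambda>n. c n * t ^ n)" for t
      unfolding eq by (intro summable_sum summable_mult sm)
    fix t :: real assume t: "t \<ge> 0"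
    have "(\<Sum>n. c n * t ^ n) = (\<Sum>\<eta>\<in>?S. \<Sum>n. pmf \<mu> \<eta> * (t ^ n / fact n * (?L ^^ n) f \<eta>))"
      unfolding eq by (rule suminf_sum) (intro summable_mult sm)
    also have "\<dots> = (\<Sum>\<eta>\<in>?S. pmf \<mu> \<eta> * tasep_semigroup N \<alpha> \<beta> t f \<eta>)"
      unfolding tasep_semigroup_def by (intro sum.cong refl suminf_mult sm)
    also have "\<dots> = c 0" using st t by (simp add: tasep_stationary_def c_def)
    finally show "(\<Sum>n. c n * t ^ n) = c 0" .
  qed
  then show ?thesis by (simp add: c_def)
qed

lemma stationary_adjoint:
  assumes N: "N \<ge> 1" and \<alpha>\<beta>: "\<alpha> > 0" "\<beta> > 0" and st: "tasep_stationary N \<alpha> \<beta> \<mu>"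
    and \<eta>: "\<eta> \<in> configs {1..N}"
  shows "tasep_adjoint N \<alpha> \<beta> (pmf \<mu>) \<eta> = 0"
proof -
  have "(\<Sum>\<zeta>\<in>configs {1..N}. tasep_adjoint N \<alpha> \<beta> (pmf \<mu>) \<zeta> * of_bool (\<zeta> = \<eta>)) = 0"
    using stationary_sum_gen[OF N \<alpha>\<beta> st] unfolding sum_tasep_gen[OF N] .
  also have "(\<Sum>\<zeta>\<in>configs {1..N}. tasep_adjoint N \<alpha> \<beta> (pmf \<mu>) \<zeta> * of_bool (\<zeta> = \<eta>))
      = (\<Sum>\<zeta>\<in>configs {1..N}. if \<zeta> = \<eta> then tasep_adjoint N \<alpha> \<beta> (pmf \<mu>) \<zeta> else 0)"
    by (intro sum.cong) auto
  finally show ?thesis using \<eta> finite_configs[of "{1..N}"] by simp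
qed

lemma tasep_adjoint_diff:
  "tasep_adjoint N \<alpha> \<beta> (\<lambda>\<eta>. p \<eta> - c * q \<eta>) \<eta>
     = tasep_adjoint N \<alpha> \<beta> p \<eta> - c * tasep_adjoint N \<alpha> \<beta> q \<eta>"
proof -
  have "(\<Sum>x\<in>{1..<N}. of_bool (\<not> \<eta> x \<and> \<eta> (x + 1)) * (p (swap_at x (x + 1) \<eta>) - c * q (swap_at x (x + 1) \<eta>))
                  - of_bool (\<eta> x \<and> \<not> \<eta> (x + 1)) * (p \<eta> - c * q \<eta>))
      = (\<Sum>x\<in>{1..<N}. of_bool (\<not> \<eta> x \<and> \<eta> (x + 1)) * p (swap_at x (x + 1) \<eta>)
                  - of_bool (\<eta> x \<and> \<not> \<eta> (x + 1)) * p \<eta>)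
       - c * (\<Sum>x\<in>{1..<N}. of_bool (\<not> \<eta> x \<and> \<eta> (x + 1)) * q (swap_at x (x + 1) \<eta>)
                  - of_bool (\<eta> x \<and> \<not> \<eta> (x + 1)) * q \<eta>)"
    by (simp add: sum_distrib_left algebra_simps flip: sum_subtractf)
  then show ?thesis unfolding tasep_adjoint_def by (simp add: algebra_simps)
qed

text \<open>Where a nonnegative stationary \<open>\<theta>\<close> vanishes there is no outflow, hence no inflow, so \<open>\<theta>\<close> vanishes at all
  configurations with a transition to \<open>\<eta>\<close>.\<close>

lemma adjoint_zero_predecessors:
  assumes \<alpha>\<beta>: "\<alpha> > 0" "\<beta> > 0" and N: "N \<ge> 1"
    and nonneg: "\<And>\<eta>. \<eta> \<in> configs {1..N} \<Longrightarrow> 0 \<le> \<theta> \<eta>"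
    and \<eta>: "\<eta> \<in> configs {1..N}" "\<theta> \<eta> = 0" and zero: "tasep_adjoint N \<alpha> \<beta> \<theta> \<eta> = 0"
  shows "\<And>x. 1 \<le> x \<Longrightarrow> x < N \<Longrightarrow> \<not> \<eta> x \<Longrightarrow> \<eta> (Suc x) \<Longrightarrow> \<theta> (swap_at x (Suc x) \<eta>) = 0"
    and "\<eta> 1 \<Longrightarrow> \<theta> (flip_at 1 \<eta>) = 0"
    and "\<not> \<eta> N \<Longrightarrow> \<theta> (flip_at N \<eta>) = 0"
proof -
  let ?A = "\<Sum>x\<in>{1..<N}. of_bool (\<not> \<eta> x \<and> \<eta> (x + 1)) * \<theta> (swap_at x (x + 1) \<eta>)"
  let ?B = "of_bool (\<eta> 1) * \<theta> (flip_at 1 \<eta>)" and ?C = "of_bool (\<not> \<eta> N) * \<theta> (flip_at N \<eta>)"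
  have "?A + \<alpha> * ?B + \<beta> * ?C = 0"
    using zero \<eta>(2) by (simp add: tasep_adjoint_def split: if_splits)
  moreover have summand: "0 \<le> of_bool (\<not> \<eta> x \<and> \<eta> (x + 1)) * \<theta> (swap_at x (x + 1) \<eta>)" if "x \<in> {1..<N}" for x
    using that \<eta> by (auto intro!: nonneg swap_at_configs)
  then have "0 \<le> ?A" by (rule sum_nonneg)
  moreover have "0 \<le> \<alpha> * ?B" "0 \<le> \<beta> * ?C"
    using \<alpha>\<beta> N \<eta> by (auto intro!: mult_nonneg_nonneg nonneg flip_at_configs)
  ultimately have z: "?A = 0" "\<alpha> * ?B = 0" "\<beta> * ?C = 0" by linarith+
  show "\<theta> (swap_at x (Suc x) \<eta>) = 0" if "1 \<le> x" "x < N" "\<not> \<eta> x" "\<eta> (Suc x)" for x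
  proof -
    have "\<forall>x\<in>{1..<N}. of_bool (\<not> \<eta> x \<and> \<eta> (x + 1)) * \<theta> (swap_at x (x + 1) \<eta>) = 0"
      using z(1) summand by (subst (asm) sum_nonneg_eq_0_iff) auto
    then show ?thesis using that by (auto dest!: bspec[of _ _ x])
  qed
  show "\<theta> (flip_at 1 \<eta>) = 0" if "\<eta> 1" using z(2) \<alpha>\<beta> that by simp
  show "\<theta> (flip_at N \<eta>) = 0" if "\<not> \<eta> N" using z(3) \<alpha>\<beta> that by simp
qed

text \<open>Irreducibility, in terms of reversed transitions: particles jump to the left, leave at site \<open>1\<close> and
  enter at site \<open>N\<close>. From any configuration the leftmost particle can be moved out, until
  none is left; from the empty configuration any other is built by inserting its particles from
  left to right, each of them travelling from site \<open>N\<close>.\<close>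

lemma predecessor_closed_everything:
  assumes N: "N \<ge> 1"
    and sub: "Z \<subseteq> configs {1..N}" and ne: "Z \<noteq> {}"
    and swap: "\<And>\<eta> x. \<eta> \<in> Z \<Longrightarrow> 1 \<le> x \<Longrightarrow> x < N \<Longrightarrow> \<not> \<eta> x \<Longrightarrow> \<eta> (Suc x) \<Longrightarrow> swap_at x (Suc x) \<eta> \<in> Z"
    and left: "\<And>\<eta>. \<eta> \<in> Z \<Longrightarrow> \<eta> 1 \<Longrightarrow> flip_at 1 \<eta> \<in> Z"
    and right: "\<And>\<eta>. \<eta> \<in> Z \<Longrightarrow> \<not> \<eta> N \<Longrightarrow> flip_at N \<eta> \<in> Z"
  shows "Z = configs {1..N}"
proof -
  define P where "P \<eta> = {x \<in> {1..N}. \<eta> x}" for \<eta> :: config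
  have finP: "finite (P \<eta>)" for \<eta> by (simp add: P_def)
  have P_upd: "P (\<eta>(x := False)) = P \<eta> - {x}" for \<eta> x by (auto simp: P_def)
  have remove: "\<eta>(Suc x := False) \<in> Z"
    if "\<eta> \<in> Z" "Suc x \<le> N" "\<eta> (Suc x)" "\<And>y. 1 \<le> y \<Longrightarrow> y \<le> x \<Longrightarrow> \<not> \<eta> y" for \<eta> x
    using that
  proof (induction x arbitrary: \<eta>)
    case 0
    then have "flip_at 1 \<eta> \<in> Z" using left by simp
    moreover have "flip_at 1 \<eta> = \<eta>(Suc 0 := False)" using 0 by (simp add: flip_at_def)
    ultimately show ?case by (simp only:)
  next
    case (Suc x)
    let ?\<zeta> = "swap_at (Suc x) (Suc (Suc x)) \<eta>"
    have \<zeta>: "?\<zeta> = \<eta>(Suc x := True, Suc (Suc x) := False)"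
      using Suc.prems by (simp add: swap_at_def)
    have "?\<zeta> \<in> Z" using Suc.prems by (intro swap) auto
    then have "?\<zeta>(Suc x := False) \<in> Z"
      by (rule Suc.IH) (use Suc.prems \<zeta> in auto)
    moreover have "?\<zeta>(Suc x := False) = \<eta>(Suc (Suc x) := False)"
      using Suc.prems unfolding \<zeta> by (auto simp: fun_eq_iff)
    ultimately show ?case by (simp only:)
  qed
  have "\<exists>\<zeta>\<in>Z. P \<zeta> = {}" if "\<eta> \<in> Z" for \<eta>
    using that
  proof (induction "card (P \<eta>)" arbitrary: \<eta> rule: less_induct)
    case less
    show ?case
    proof (cases "P \<eta> = {}")
      case False
      define x where "x = Min (P \<eta>)"
      have x: "x \<in> P \<eta>" "\<And>y. y \<in> P \<eta> \<Longrightarrow> x \<le> y"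
        unfolding x_def using False finP by auto
      then obtain k where k: "x = Suc k" by (cases x) (auto simp: P_def)
      have "\<eta>(Suc k := False) \<in> Z"
      proof (rule remove[OF less.prems])
        show "Suc k \<le> N" "\<eta> (Suc k)" using x(1) k by (auto simp: P_def)
        fix y assume "1 \<le> y" "y \<le> k"
        then show "\<not> \<eta> y" using x(2)[of y] x(1) k by (auto simp: P_def)
      qed
      moreover have "card (P (\<eta>(Suc k := False))) < card (P \<eta>)"
        unfolding P_upd using x(1) k finP by (intro psubset_card_mono) auto
      ultimately show ?thesis using less.hyps by blast
    qed (use less.prems in blast)
  qed
  then obtain \<eta>0 where \<eta>0: "\<eta>0 \<in> Z" "P \<eta>0 = {}" using ne by blast
  have insert: "\<zeta> \<in> Z"
    if "\<zeta> \<in> configs {1..N}" "\<zeta>(x := False) \<in> Z" "1 \<le> x" "x \<le> N" "\<zeta> x"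
      "\<And>y. x < y \<Longrightarrow> y \<le> N \<Longrightarrow> \<not> \<zeta> y" for \<zeta> x
    using that
  proof (induction "N - x" arbitrary: \<zeta> x)
    case 0
    then have "x = N" by simp
    with 0 have "\<zeta>(N := False) \<in> Z" by blast
    then have "flip_at N (\<zeta>(N := False)) \<in> Z" by (rule right) simp
    moreover have "flip_at N (\<zeta>(N := False)) = \<zeta>"
      using 0 \<open>x = N\<close> by (auto simp: flip_at_def fun_eq_iff)
    ultimately show ?case by (simp only:)
  next
    case (Suc d)
    let ?\<zeta> = "\<zeta>(x := False, Suc x := True)"
    have less: "x < N" using Suc.hyps(2) by simp
    have "?\<zeta> \<in> Z"
    proof (rule Suc.hyps(1))
      show "d = N - Suc x" using Suc.hyps(2) by simp
      show "?\<zeta> \<in> configs {1..N}" using Suc.prems less by (intro configs_update) auto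
      have "?\<zeta>(Suc x := False) = \<zeta>(x := False)"
        using Suc.prems(6)[of "Suc x"] less by (auto simp: fun_eq_iff)
      then show "?\<zeta>(Suc x := False) \<in> Z" using Suc.prems by simp
    qed (use Suc.prems less in auto)
    then have "swap_at x (Suc x) ?\<zeta> \<in> Z" using Suc.prems less by (intro swap) auto
    moreover have "swap_at x (Suc x) ?\<zeta> = \<zeta>"
      using Suc.prems(5) Suc.prems(6)[of "Suc x"] less by (auto simp: swap_at_def fun_eq_iff)
    ultimately show ?case by simp
  qed
  have "\<zeta> \<in> Z" if "\<zeta> \<in> configs {1..N}" for \<zeta>
    using that
  proof (induction "card (P \<zeta>)" arbitrary: \<zeta> rule: less_induct)
    case less
    show ?case
    proof (cases "P \<zeta> = {}")
      case True
      have "\<zeta> = \<eta>0"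
        using less.prems \<eta>0 sub True by (intro configs_eqI) (auto simp: P_def)
      then show ?thesis using \<eta>0 by simp
    next
      case False
      define x where "x = Max (P \<zeta>)"
      have x: "x \<in> P \<zeta>" "\<And>y. y \<in> P \<zeta> \<Longrightarrow> y \<le> x"
        unfolding x_def using False finP by auto
      have "card (P (\<zeta>(x := False))) < card (P \<zeta>)"
        unfolding P_upd using x(1) finP by (intro psubset_card_mono) auto
      moreover have "\<zeta>(x := False) \<in> configs {1..N}"
        using less.prems x(1) by (intro configs_update) (auto simp: P_def)
      ultimately have "\<zeta>(x := False) \<in> Z" by (rule less.hyps)
      then show ?thesis
      proof (rule insert[OF less.prems])
        show "1 \<le> x" "x \<le> N" "\<zeta> x" using x(1) by (auto simp: P_def)
        fix y assume "x < y" "y \<le> N"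
        then show "\<not> \<zeta> y" using x(2)[of y] by (auto simp: P_def)
      qed
    qed
  qed
  then show ?thesis using sub by blast
qed

text \<open>Subtract the largest multiple of \<open>q\<close> that leaves a nonnegative function. The difference vanishes
  somewhere, and by irreducibility everywhere.\<close>

lemma adjoint_kernel_unique:
  assumes \<alpha>\<beta>: "\<alpha> > 0" "\<beta> > 0" and N: "N \<ge> 1"
    and p: "\<And>\<eta>. \<eta> \<in> configs {1..N} \<Longrightarrow> tasep_adjoint N \<alpha> \<beta> p \<eta> = 0"
    and q: "\<And>\<eta>. \<eta> \<in> configs {1..N} \<Longrightarrow> 0 < q \<eta>"
      "\<And>\<eta>. \<eta> \<in> configs {1..N} \<Longrightarrow> tasep_adjoint N \<alpha> \<beta> q \<eta> = 0"
  obtains c where "\<And>\<eta>. \<eta> \<in> configs {1..N} \<Longrightarrow> p \<eta> = c * q \<eta>"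
proof -
  let ?S = "configs {1..N}"
  define c where "c = Min ((\<lambda>\<eta>. p \<eta> / q \<eta>) ` ?S)"
  define \<theta> where "\<theta> \<eta> = p \<eta> - c * q \<eta>" for \<eta>
  have fin: "finite ?S" by (rule finite_configs) simp
  have ne: "?S \<noteq> {}" by (simp add: configs_def PiE_eq_empty_iff)
  have nonneg: "0 \<le> \<theta> \<eta>" if "\<eta> \<in> ?S" for \<eta>
  proof -
    have "c \<le> p \<eta> / q \<eta>" unfolding c_def using fin that by (intro Min_le) auto
    then show ?thesis using q(1)[OF that] by (simp add: \<theta>_def field_simps)
  qed
  have "c \<in> (\<lambda>\<eta>. p \<eta> / q \<eta>) ` ?S" unfolding c_def using fin ne by (intro Min_in) auto
  then obtain \<eta>0 where \<eta>0: "\<eta>0 \<in> ?S" "c = p \<eta>0 / q \<eta>0" by blast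
  then have "\<theta> \<eta>0 = 0" using q(1)[OF \<eta>0(1)] by (simp add: \<theta>_def)
  have adj: "tasep_adjoint N \<alpha> \<beta> \<theta> \<eta> = 0" if "\<eta> \<in> ?S" for \<eta>
    using tasep_adjoint_diff[of N \<alpha> \<beta> p c q \<eta>] p[OF that] q(2)[OF that]
    by (simp add: \<theta>_def[abs_def])
  have "{\<eta> \<in> ?S. \<theta> \<eta> = 0} = ?S"
  proof (rule predecessor_closed_everything[OF N])
    show "{\<eta> \<in> ?S. \<theta> \<eta> = 0} \<noteq> {}" using \<eta>0 \<open>\<theta> \<eta>0 = 0\<close> by blast
  next
    fix \<eta> x assume a: "\<eta> \<in> {\<eta> \<in> ?S. \<theta> \<eta> = 0}" "1 \<le> x" "x < N" "\<not> \<eta> x" "\<eta> (Suc x)"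
    then have \<eta>: "\<eta> \<in> ?S" "\<theta> \<eta> = 0" by auto
    show "swap_at x (Suc x) \<eta> \<in> {\<eta> \<in> ?S. \<theta> \<eta> = 0}"
      using adjoint_zero_predecessors(1)[OF \<alpha>\<beta> N nonneg \<eta> adj[OF \<eta>(1)] a(2-5)]
        swap_at_configs[OF \<eta>(1), of x "Suc x"] a by simp
  next
    fix \<eta> assume a: "\<eta> \<in> {\<eta> \<in> ?S. \<theta> \<eta> = 0}" "\<eta> 1"
    then have \<eta>: "\<eta> \<in> ?S" "\<theta> \<eta> = 0" by auto
    show "flip_at 1 \<eta> \<in> {\<eta> \<in> ?S. \<theta> \<eta> = 0}"
      using adjoint_zero_predecessors(2)[OF \<alpha>\<beta> N nonneg \<eta> adj[OF \<eta>(1)] a(2)]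
        flip_at_configs[OF \<eta>(1), of 1] N by simp
  next
    fix \<eta> assume a: "\<eta> \<in> {\<eta> \<in> ?S. \<theta> \<eta> = 0}" "\<not> \<eta> N"
    then have \<eta>: "\<eta> \<in> ?S" "\<theta> \<eta> = 0" by auto
    show "flip_at N \<eta> \<in> {\<eta> \<in> ?S. \<theta> \<eta> = 0}"
      using adjoint_zero_predecessors(3)[OF \<alpha>\<beta> N nonneg \<eta> adj[OF \<eta>(1)] a(2)]
        flip_at_configs[OF \<eta>(1), of N] N by simp
  qed auto
  then have "p \<eta> = c * q \<eta>" if "\<eta> \<in> ?S" for \<eta> using that by (auto simp: \<theta>_def)
  then show ?thesis using that by blast
qed

definition config_weight :: "nat \<Rightarrow> real \<Rightarrow> real \<Rightarrow> config \<Rightarrow> real" where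
  "config_weight N \<alpha> \<beta> \<eta> = weight \<alpha> \<beta> (map \<eta> [1..<Suc N])"

lemma upt_split: "i \<le> k \<Longrightarrow> k \<le> j \<Longrightarrow> [i..<j] = [i..<k] @ [k..<j]" for i j k :: nat
  using upt_add_eq_append[of i k "j - k"] by simp

text \<open>The contribution of the bond \<open>{x, x + 1}\<close> is \<open>D x - D (x + 1)\<close>, where \<open>D x\<close> is the weight of the word
  with letter \<open>x\<close> deleted, with a negative sign if the letter is a particle: this is the rule
  \<open>DE = D + E\<close> if the two letters differ, and for equal letters both sides vanish. The sum telescopes, and the
  boundary rules cancel the two terms that remain.\<close>

lemma tasep_adjoint_config_weight:
  assumes N: "N \<ge> 1" and \<alpha>\<beta>: "\<alpha> > 0" "\<beta> > 0"
  shows "tasep_adjoint N \<alpha> \<beta> (config_weight N \<alpha> \<beta>) \<eta> = 0"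
proof -
  note rules = matrix_product_weightD[OF matrix_product_weight_weight[OF \<alpha>\<beta>(1), of \<beta>]]
  let ?W = "config_weight N \<alpha> \<beta>"
  define D where "D x = (if \<eta> x then -1 else 1)
      * weight \<alpha> \<beta> (map \<eta> [1..<x] @ map \<eta> [Suc x..<Suc N])" for x
  have bond: "of_bool (\<not> \<eta> x \<and> \<eta> (x + 1)) * ?W (swap_at x (x + 1) \<eta>)
      - of_bool (\<eta> x \<and> \<not> \<eta> (x + 1)) * ?W \<eta> = D x - D (Suc x)" if x: "x \<in> {1..<N}" for x
  proof -
    let ?u = "map \<eta> [1..<x]" and ?v = "map \<eta> [Suc (Suc x)..<Suc N]"
    have tail: "[Suc x..<Suc N] = Suc x # [Suc (Suc x)..<Suc N]"
      using x by (intro upt_conv_Cons) simp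
    have split: "[1..<Suc N] = [1..<x] @ x # Suc x # [Suc (Suc x)..<Suc N]"
      using x upt_split[of 1 x "Suc N"] upt_conv_Cons[of x "Suc N"] tail by simp
    have W: "?W \<eta> = weight \<alpha> \<beta> (?u @ \<eta> x # \<eta> (Suc x) # ?v)"
      unfolding config_weight_def split by simp
    have "map (swap_at x (x + 1) \<eta>) [1..<x] = ?u"
      "map (swap_at x (x + 1) \<eta>) [Suc (Suc x)..<Suc N] = ?v"
      by (auto simp: swap_at_def)
    then have W': "?W (swap_at x (x + 1) \<eta>) = weight \<alpha> \<beta> (?u @ \<eta> (Suc x) # \<eta> x # ?v)"
      unfolding config_weight_def split
      by (simp only: map_append list.map) (simp add: swap_at_def)
    have D: "D x = (if \<eta> x then -1 else 1) * weight \<alpha> \<beta> (?u @ \<eta> (Suc x) # ?v)"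
      unfolding D_def tail by simp
    have "map \<eta> [1..<Suc x] = ?u @ [\<eta> x]" using x by simp
    then have D': "D (Suc x) = (if \<eta> (Suc x) then -1 else 1) * weight \<alpha> \<beta> (?u @ \<eta> x # ?v)"
      unfolding D_def by simp
    show ?thesis
      unfolding W W' D D' by (cases "\<eta> x"; cases "\<eta> (Suc x)") (simp_all add: rules(4))
  qed
  have bulk: "(\<Sum>x\<in>{1..<N}. of_bool (\<not> \<eta> x \<and> \<eta> (x + 1)) * ?W (swap_at x (x + 1) \<eta>)
                  - of_bool (\<eta> x \<and> \<not> \<eta> (x + 1)) * ?W \<eta>) = D 1 - D N"
  proof -
    have "(\<Sum>x\<in>{1..<N}. of_bool (\<not> \<eta> x \<and> \<eta> (x + 1)) * ?W (swap_at x (x + 1) \<eta>)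
                  - of_bool (\<eta> x \<and> \<not> \<eta> (x + 1)) * ?W \<eta>) = (\<Sum>x\<in>{1..<N}. - D (Suc x) - - D x)"
      using bond by (intro sum.cong) auto
    also have "\<dots> = - D N - - D 1" using N by (rule sum_Suc_diff')
    finally show ?thesis by simp
  qed
  have left: "\<alpha> * (if \<eta> 1 then ?W (flip_at 1 \<eta>) else - ?W \<eta>) = - D 1"
  proof -
    have split: "[1..<Suc N] = 1 # [2..<Suc N]" using N upt_conv_Cons[of 1 "Suc N"] by (simp add: numeral_2_eq_2)
    have "map (flip_at 1 \<eta>) [2..<Suc N] = map \<eta> [2..<Suc N]" by (auto simp: flip_at_def)
    then have "?W (flip_at 1 \<eta>) = weight \<alpha> \<beta> ((\<not> \<eta> 1) # map \<eta> [2..<Suc N])"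
      unfolding config_weight_def split by (simp only: list.map flip_at_same)
    moreover have "?W \<eta> = weight \<alpha> \<beta> (\<eta> 1 # map \<eta> [2..<Suc N])"
      unfolding config_weight_def split by simp
    moreover have "D 1 = (if \<eta> 1 then -1 else 1) * weight \<alpha> \<beta> (map \<eta> [2..<Suc N])"
      by (simp add: D_def numeral_2_eq_2 del: upt_Suc)
    ultimately show ?thesis using \<alpha>\<beta> by (auto simp: rules(2))
  qed
  have right: "\<beta> * (if \<eta> N then - ?W \<eta> else ?W (flip_at N \<eta>)) = D N"
  proof -
    have split: "[1..<Suc N] = [1..<N] @ [N]" using N by simp
    have "map (flip_at N \<eta>) [1..<N] = map \<eta> [1..<N]" by (auto simp: flip_at_def)
    then have "?W (flip_at N \<eta>) = weight \<alpha> \<beta> (map \<eta> [1..<N] @ [\<not> \<eta> N])"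
      unfolding config_weight_def split by (simp only: map_append list.map flip_at_same)
    moreover have "?W \<eta> = weight \<alpha> \<beta> (map \<eta> [1..<N] @ [\<eta> N])"
      unfolding config_weight_def split by simp
    moreover have "D N = (if \<eta> N then -1 else 1) * weight \<alpha> \<beta> (map \<eta> [1..<N])"
      by (simp add: D_def)
    ultimately show ?thesis using \<alpha>\<beta> by (auto simp: rules(3))
  qed
  show ?thesis unfolding tasep_adjoint_def bulk left right by simp
qed

section \<open>Marginals of the stationary measure\<close>

lemma bij_betw_configs_words: "bij_betw (\<lambda>\<eta>. map \<eta> [i..<j]) (configs {i..<j}) (words (j - i))"
proof (rule bij_betwI[of _ _ _ "\<lambda>u. restrict (\<lambda>x. u ! (x - i)) {i..<j}"])
  show "(\<lambda>u. restrict (\<lambda>x. u ! (x - i)) {i..<j}) (map \<eta> [i..<j]) = \<eta>"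
    if "\<eta> \<in> configs {i..<j}" for \<eta>
    using that by (intro ext) (auto simp: restrict_def configs_extensional)
  show "map (restrict (\<lambda>x. u ! (x - i)) {i..<j}) [i..<j] = u" if "u \<in> words (j - i)" for u
    using that by (intro nth_equalityI) (auto simp: words_def)
qed (auto simp: words_def configs_def)

lemma sum_configs:
  "(\<Sum>\<eta>\<in>configs {i..<j}. f (map \<eta> [i..<j])) = (\<Sum>u\<in>words (j - i). f u)"
  by (rule sum.reindex_bij_betw[OF bij_betw_configs_words])

lemma stationary_weight:
  assumes N: "N \<ge> 1" and \<alpha>\<beta>: "\<alpha> > 0" "\<beta> > 0" and st: "tasep_stationary N \<alpha> \<beta> \<mu>"
    and \<eta>: "\<eta> \<in> configs {1..N}"
  shows "pmf \<mu> \<eta> = weight \<alpha> \<beta> (map \<eta> [1..<Suc N]) / total_weight \<alpha> \<beta> N"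
proof -
  let ?S = "configs {1..N}" and ?W = "config_weight N \<alpha> \<beta>"
  obtain c where c: "\<And>\<eta>. \<eta> \<in> ?S \<Longrightarrow> pmf \<mu> \<eta> = c * ?W \<eta>"
    by (rule adjoint_kernel_unique[OF \<alpha>\<beta> N, of "pmf \<mu>" ?W])
       (auto simp: stationary_adjoint[OF N \<alpha>\<beta> st] tasep_adjoint_config_weight[OF N \<alpha>\<beta>]
         config_weight_def weight_pos[OF \<alpha>\<beta>])
  have "1 = (\<Sum>\<eta>\<in>?S. pmf \<mu> \<eta>)"
    using st by (intro sum_pmf_eq_1[symmetric] finite_configs) (auto simp: tasep_stationary_def)
  also have "\<dots> = c * (\<Sum>\<eta>\<in>?S. ?W \<eta>)" by (simp add: c sum_distrib_left)
  also have "(\<Sum>\<eta>\<in>?S. ?W \<eta>) = total_weight \<alpha> \<beta> N"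
    using sum_configs[of "weight \<alpha> \<beta>" 1 "Suc N"]
    by (simp add: config_weight_def total_weight_def atLeastLessThanSuc_atLeastAtMost)
  finally have "c = 1 / total_weight \<alpha> \<beta> N"
    using total_weight_pos[OF \<alpha>\<beta>, of N] by (simp add: field_simps)
  then show ?thesis using c[OF \<eta>] by (simp add: config_weight_def)
qed

lemma pmf_marginal_stationary:
  assumes N: "N \<ge> 1" and \<alpha>\<beta>: "\<alpha> > 0" "\<beta> > 0" and st: "tasep_stationary N \<alpha> \<beta> \<mu>"
    and ab: "1 \<le> a" "a \<le> b" "b \<le> N" and \<xi>: "\<xi> \<in> configs {a..b}"
  shows "pmf (marginal {a..b} \<mu>) \<xi>
    = (\<Sum>u\<in>words (a - 1). \<Sum>v\<in>words (N - b). weight \<alpha> \<beta> (u @ map \<xi> [a..<Suc b] @ v))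
      / total_weight \<alpha> \<beta> N"
proof -
  let ?S = "configs {1..N}" and ?x = "map \<xi> [a..<Suc b]" and ?m = "Suc b - a"
  let ?mid = "\<lambda>y :: bool list. take ?m (drop (a - 1) y)"
  have fin: "finite ?S" by (rule finite_configs) simp
  have sub: "set_pmf \<mu> \<subseteq> ?S" using st by (simp add: tasep_stationary_def)
  have mid: "restrict \<eta> {a..b} = \<xi> \<longleftrightarrow> ?mid (map \<eta> [1..<Suc N]) = ?x" for \<eta>
  proof -
    have "[1..<Suc N] = [1..<a] @ [a..<Suc b] @ [Suc b..<Suc N]"
      using ab upt_split[of 1 a "Suc N"] upt_split[of a "Suc b" "Suc N"] by simp
    then have "?mid (map \<eta> [1..<Suc N]) = map \<eta> [a..<Suc b]"
      using ab by (simp del: upt_Suc)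
    also have "\<dots> = ?x \<longleftrightarrow> (\<forall>x\<in>{a..b}. \<eta> x = \<xi> x)" by (auto simp del: upt_Suc)
    also have "\<dots> \<longleftrightarrow> restrict \<eta> {a..b} = \<xi>"
      using \<xi> by (auto simp: restrict_def fun_eq_iff configs_extensional)
    finally show ?thesis by blast
  qed
  have "pmf (marginal {a..b} \<mu>) \<xi> = measure (measure_pmf \<mu>) {\<eta>. restrict \<eta> {a..b} = \<xi>}"
    by (simp add: marginal_def pmf_map vimage_def)
  also have "\<dots> = measure (measure_pmf \<mu>) {\<eta> \<in> ?S. restrict \<eta> {a..b} = \<xi>}"
    using sub by (intro measure_pmf.finite_measure_eq_AE) (auto simp: AE_measure_pmf_iff)
  also have "\<dots> = (\<Sum>\<eta> | \<eta> \<in> ?S \<and> restrict \<eta> {a..b} = \<xi>. pmf \<mu> \<eta>)"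
    using fin by (intro measure_measure_pmf_finite) auto
  also have "\<dots> = (\<Sum>\<eta>\<in>?S. of_bool (restrict \<eta> {a..b} = \<xi>) * pmf \<mu> \<eta>)"
    using fin by (intro sum.mono_neutral_cong_left) auto
  also have "\<dots> = (\<Sum>\<eta>\<in>?S. of_bool (?mid (map \<eta> [1..<Suc N]) = ?x)
      * (weight \<alpha> \<beta> (map \<eta> [1..<Suc N]) / total_weight \<alpha> \<beta> N))"
    unfolding mid by (intro sum.cong refl) (simp only: stationary_weight[OF N \<alpha>\<beta> st])
  also have "\<dots> = (\<Sum>y\<in>words N. of_bool (?mid y = ?x) * (weight \<alpha> \<beta> y / total_weight \<alpha> \<beta> N))"
    using sum_configs[of "\<lambda>y. of_bool (?mid y = ?x) * (weight \<alpha> \<beta> y / total_weight \<alpha> \<beta> N)" 1 "Suc N"]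
    by (simp add: atLeastLessThanSuc_atLeastAtMost del: upt_Suc)
  also have "words N = words ((a - 1) + (?m + (N - b)))" using ab by simp
  also have "(\<Sum>y\<in>words ((a - 1) + (?m + (N - b))). of_bool (?mid y = ?x) * (weight \<alpha> \<beta> y / total_weight \<alpha> \<beta> N))
      = (\<Sum>u\<in>words (a - 1). \<Sum>x\<in>words ?m. \<Sum>v\<in>words (N - b).
          of_bool (x = ?x) * (weight \<alpha> \<beta> (u @ x @ v) / total_weight \<alpha> \<beta> N))"
    unfolding sum_words_add by (intro sum.cong refl) (simp add: words_def del: upt_Suc)
  also have "\<dots> = (\<Sum>u\<in>words (a - 1). \<Sum>v\<in>words (N - b). weight \<alpha> \<beta> (u @ ?x @ v) / total_weight \<alpha> \<beta> N)"
  proof (rule sum.cong[OF refl])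
    fix u
    have "?x \<in> words ?m" by (simp add: words_def del: upt_Suc)
    have "(\<Sum>x\<in>words ?m. \<Sum>v\<in>words (N - b).
          of_bool (x = ?x) * (weight \<alpha> \<beta> (u @ x @ v) / total_weight \<alpha> \<beta> N))
        = (\<Sum>x\<in>words ?m. if x = ?x then \<Sum>v\<in>words (N - b). weight \<alpha> \<beta> (u @ x @ v) / total_weight \<alpha> \<beta> N else 0)"
      by (intro sum.cong refl) auto
    also have "\<dots> = (\<Sum>v\<in>words (N - b). weight \<alpha> \<beta> (u @ ?x @ v) / total_weight \<alpha> \<beta> N)"
      using \<open>?x \<in> words ?m\<close> by (simp del: upt_Suc)
    finally show "(\<Sum>x\<in>words ?m. \<Sum>v\<in>words (N - b).
          of_bool (x = ?x) * (weight \<alpha> \<beta> (u @ x @ v) / total_weight \<alpha> \<beta> N))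
        = (\<Sum>v\<in>words (N - b). weight \<alpha> \<beta> (u @ ?x @ v) / total_weight \<alpha> \<beta> N)" .
  qed
  finally show ?thesis by (simp add: sum_divide_distrib del: upt_Suc)
qed

lemma pmf_Ber:
  assumes "0 \<le> \<rho>" "\<rho> \<le> 1" "\<xi> \<in> configs {a..b}"
  shows "pmf (Ber {a..b} \<rho>) \<xi> = bernoulli_weight \<rho> (map \<xi> [a..<Suc b])"
proof -
  have "pmf (Ber {a..b} \<rho>) \<xi> = (\<Prod>x\<in>{a..b}. pmf (bernoulli_pmf \<rho>) (\<xi> x))"
    unfolding Ber_def using assms(3) by (intro pmf_Pi') (auto simp: configs_extensional)
  also have "\<dots> = (\<Prod>x\<in>{a..b}. if \<xi> x then \<rho> else 1 - \<rho>)"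
    using assms(1,2) by (intro prod.cong refl) simp
  also have "\<dots> = (\<Prod>x\<leftarrow>[a..<Suc b]. if \<xi> x then \<rho> else 1 - \<rho>)"
    using prod.distinct_set_conv_list[of "[a..<Suc b]" "\<lambda>x. if \<xi> x then \<rho> else 1 - \<rho>"]
    by (simp add: atLeastLessThanSuc_atLeastAtMost del: upt_Suc)
  finally show ?thesis by (simp add: bernoulli_weight_def comp_def del: upt_Suc)
qed

lemma tv_dist_stationary:
  assumes N: "N \<ge> 1" and \<alpha>\<beta>: "\<alpha> > 0" "\<beta> > 0" and st: "tasep_stationary N \<alpha> \<beta> \<mu>"
    and ab: "1 \<le> a" "a \<le> b" "b \<le> N" and \<rho>: "0 \<le> \<rho>" "\<rho> \<le> 1"
  shows "tv_dist {a..b} (marginal {a..b} \<mu>) (Ber {a..b} \<rho>)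
    = 1 / 2 * marginal_error \<alpha> \<beta> (a - 1) (Suc b - a) (N - b) \<rho>"
proof -
  have N': "a - 1 + (Suc b - a) + (N - b) = N" using ab by simp
  let ?E = "\<lambda>x. \<bar>(\<Sum>u\<in>words (a - 1). \<Sum>v\<in>words (N - b). weight \<alpha> \<beta> (u @ x @ v))
      / total_weight \<alpha> \<beta> N - bernoulli_weight \<rho> x\<bar>"
  have "(\<Sum>\<xi>\<in>configs {a..b}. \<bar>pmf (marginal {a..b} \<mu>) \<xi> - pmf (Ber {a..b} \<rho>) \<xi>\<bar>)
      = (\<Sum>\<xi>\<in>configs {a..b}. ?E (map \<xi> [a..<Suc b]))"
    by (intro sum.cong refl)
       (simp only: pmf_marginal_stationary[OF N \<alpha>\<beta> st ab] pmf_Ber[OF \<rho>])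
  also have "\<dots> = (\<Sum>x\<in>words (Suc b - a). ?E x)"
    using sum_configs[of ?E a "Suc b"] by (simp add: atLeastLessThanSuc_atLeastAtMost del: upt_Suc)
  finally show ?thesis by (simp only: tv_dist_def marginal_error_def N')
qed

section \<open>Convergence of the marginals\<close>

lemma much_greater_filterlim:
  "much_greater f g \<longleftrightarrow> filterlim (\<lambda>N. f N / g N) at_top sequentially"
proof -
  have "much_greater f g \<longleftrightarrow> (\<lambda>N. ereal (f N / g N)) \<longlonglongrightarrow> \<infinity>"
    unfolding much_greater_def by (simp add: Liminf_PInfty)
  then show ?thesis by (simp add: tendsto_PInfty_eq_at_top)
qed

text \<open>The comparison function \<open>N\<^sup>1\<^sup>/\<^sup>3 log N\<close> is at least \<open>1\<close> for \<open>N \<ge> 3\<close>.\<close>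

lemma filterlim_of_much_greater:
  assumes "much_greater f (\<lambda>N. real N powr (1 / 3) * ln (real N))"
  shows "filterlim f at_top sequentially"
proof (rule filterlim_at_top_mono)
  show "filterlim (\<lambda>N. f N / (real N powr (1 / 3) * ln (real N))) at_top sequentially"
    using assms by (simp only: much_greater_filterlim)
  have "\<forall>\<^sub>F N in sequentially. f N / (real N powr (1 / 3) * ln (real N)) \<ge> 0"
    using assms unfolding much_greater_filterlim filterlim_at_top by blast
  moreover have "\<forall>\<^sub>F N in sequentially. N \<ge> 3" by (rule eventually_ge_at_top)
  ultimately show "\<forall>\<^sub>F N in sequentially. f N / (real N powr (1 / 3) * ln (real N)) \<le> f N"
  proof eventually_elim
    case (elim N)
    let ?g = "real N powr (1 / 3) * ln (real N)"
    have "1 * 1 \<le> ?g"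
    proof (rule mult_mono)
      show "1 \<le> real N powr (1 / 3)" using elim by (intro ge_one_powr_ge_zero) auto
      have "exp 1 \<le> real N" using elim exp_le by linarith
      then show "1 \<le> ln (real N)" using elim by (subst ln_ge_iff) auto
    qed auto
    then have g: "?g \<ge> 1" by simp
    then have "0 \<le> f N" using elim by (simp add: zero_le_divide_iff) 
    then have "f N * 1 \<le> f N * ?g" using g by (intro mult_left_mono) auto
    then show ?case using g by (simp add: divide_le_eq)
  qed
qed

lemma filterlim_nat_of_much_greater:
  assumes "much_greater f (\<lambda>N. real N powr (1 / 3) * ln (real N))"
    and "\<And>N. N \<ge> 1 \<Longrightarrow> f N = real (k N)"
  shows "filterlim k at_top sequentially"
proof -
  have "\<forall>\<^sub>F N in sequentially. f N = real (k N)"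
    using eventually_ge_at_top[of 1] by eventually_elim (use assms(2) in auto)
  then have "filterlim (\<lambda>N. real (k N)) at_top sequentially"
    using filterlim_of_much_greater[OF assms(1)] by (rule filterlim_mono_eventually[OF _ order_refl order_refl, rotated])
  then show ?thesis by (simp add: filterlim_sequentially_iff_filterlim_real)
qed

text \<open>The estimate of order \<open>(|I|/N)\<^sup>1\<^sup>/\<^sup>2\<close> applies once \<open>\<delta>N \<ge> 2\<close>, which makes both outer segments nonempty.\<close>

lemma tv_dist_tendsto_maximal_current:
  fixes \<alpha> \<beta> \<delta> :: real and a b :: "nat \<Rightarrow> nat" and \<mu> :: "nat \<Rightarrow> config pmf"
  assumes rates: "\<alpha> \<ge> 1 / 2" "\<beta> \<ge> 1 / 2"
    and st: "\<And>N. N \<ge> 1 \<Longrightarrow> tasep_stationary N \<alpha> \<beta> (\<mu> N)"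
    and ab: "\<And>N. N \<ge> 1 \<Longrightarrow> 1 \<le> a N \<and> a N \<le> b N \<and> b N \<le> N"
    and \<delta>: "\<delta> > 0" "\<forall>\<^sub>F N in sequentially. min (real (a N)) (real N - real (b N)) \<ge> \<delta> * real N"
    and large: "much_greater (\<lambda>N. \<delta> * real N) (\<lambda>N. real (card {a N..b N}))"
  shows "(\<lambda>N. tv_dist {a N..b N} (marginal {a N..b N} (\<mu> N)) (Ber {a N..b N} (1 / 2))) \<longlonglongrightarrow> 0"
proof -
  obtain C where C: "\<And>l m r. 1 \<le> l \<Longrightarrow> 1 \<le> m \<Longrightarrow> 1 \<le> r \<Longrightarrow>
      \<delta> * real (l + m + r) \<le> real l + 1 \<Longrightarrow> \<delta> * real (l + m + r) \<le> real r + 1 \<Longrightarrow>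
      marginal_error \<alpha> \<beta> l m r (1 / 2) \<le> C * sqrt (real m / real (l + m + r))"
    using maximal_current_error[OF rates \<delta>(1)] by blast
  let ?tv = "\<lambda>N. tv_dist {a N..b N} (marginal {a N..b N} (\<mu> N)) (Ber {a N..b N} (1 / 2))"
  let ?m = "\<lambda>N. card {a N..b N}"
  have "((\<lambda>N. inverse (\<delta> * real N / real (?m N))) \<longlongrightarrow> 0) sequentially"
    using large unfolding much_greater_filterlim by (rule tendsto_inverse_0_at_top)
  then have "(\<lambda>N. \<delta> * inverse (\<delta> * real N / real (?m N))) \<longlonglongrightarrow> \<delta> * 0"
    by (intro tendsto_mult tendsto_const)
  then have "(\<lambda>N. real (?m N) / real N) \<longlonglongrightarrow> 0"
    using \<delta>(1) by (simp add: field_simps)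
  then have "(\<lambda>N. 1 / 2 * (C * sqrt (real (?m N) / real N))) \<longlonglongrightarrow> 1 / 2 * (C * sqrt 0)"
    by (intro tendsto_intros)
  then have lim: "(\<lambda>N. 1 / 2 * (C * sqrt (real (?m N) / real N))) \<longlonglongrightarrow> 0" by simp
  have ev: "\<forall>\<^sub>F N in sequentially. ?tv N \<le> 1 / 2 * (C * sqrt (real (?m N) / real N))"
    using \<delta>(2) eventually_ge_at_top[of "nat \<lceil>2 / \<delta>\<rceil>"] eventually_ge_at_top[of 1]
  proof eventually_elim
    case (elim N)
    have "2 / \<delta> \<le> real N" using elim(2) by linarith
    then have two: "2 \<le> \<delta> * real N" using \<delta>(1) by (simp add: field_simps)
    have I: "1 \<le> a N" "a N \<le> b N" "b N \<le> N" using ab[OF elim(3)] by auto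
    have N: "a N - 1 + (Suc (b N) - a N) + (N - b N) = N" using I by simp
    have "\<delta> * real N \<le> real (a N - 1) + 1" "\<delta> * real N \<le> real (N - b N)"
      using elim(1) I by (simp_all add: of_nat_diff)
    note far = this
    have l: "1 \<le> a N - 1" and r: "1 \<le> N - b N" using far two by linarith+
    have m: "1 \<le> Suc (b N) - a N" using I by linarith
    have "marginal_error \<alpha> \<beta> (a N - 1) (Suc (b N) - a N) (N - b N) (1 / 2)
        \<le> C * sqrt (real (Suc (b N) - a N) / real N)"
      using C[OF l m r] far unfolding N by linarith
    then show ?case
      using tv_dist_stationary[OF elim(3) _ _ st[OF elim(3)] I, of "1 / 2"] rates
      by simp
  qed
  have "\<forall>\<^sub>F N in sequentially. 0 \<le> ?tv N"
    unfolding tv_dist_def by (intro always_eventually) (auto intro!: sum_nonneg)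
  from this ev tendsto_const lim show ?thesis by (rule tendsto_sandwich)
qed

lemma tv_dist_tendsto_low_density:
  fixes \<alpha> \<beta> :: real and a b :: "nat \<Rightarrow> nat" and \<mu> :: "nat \<Rightarrow> config pmf"
  assumes rates: "0 < \<alpha>" "\<alpha> < 1 / 2" "\<alpha> < \<beta>"
    and st: "\<And>N. N \<ge> 1 \<Longrightarrow> tasep_stationary N \<alpha> \<beta> (\<mu> N)"
    and ab: "\<And>N. N \<ge> 1 \<Longrightarrow> 1 \<le> a N \<and> a N \<le> b N \<and> b N \<le> N"
    and far: "filterlim (\<lambda>N. N - b N) at_top sequentially"
  shows "(\<lambda>N. tv_dist {a N..b N} (marginal {a N..b N} (\<mu> N)) (Ber {a N..b N} \<alpha>)) \<longlonglongrightarrow> 0"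
proof -
  have "low_density \<alpha> \<beta>" using rates by unfold_locales
  from low_density.marginal_error_tendsto[OF this far]
  have "(\<lambda>N. 1 / 2 * marginal_error \<alpha> \<beta> (a N - 1) (Suc (b N) - a N) (N - b N) \<alpha>) \<longlonglongrightarrow> 1 / 2 * 0"
    by (intro tendsto_mult tendsto_const)
  then have lim: "(\<lambda>N. 1 / 2 * marginal_error \<alpha> \<beta> (a N - 1) (Suc (b N) - a N) (N - b N) \<alpha>) \<longlonglongrightarrow> 0"
    by simp
  have "\<forall>\<^sub>F N in sequentially. 1 / 2 * marginal_error \<alpha> \<beta> (a N - 1) (Suc (b N) - a N) (N - b N) \<alpha>
      = tv_dist {a N..b N} (marginal {a N..b N} (\<mu> N)) (Ber {a N..b N} \<alpha>)"
    using eventually_ge_at_top[of 1]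
  proof eventually_elim
    case (elim N)
    then show ?case
      using tv_dist_stationary[OF elim _ _ st[OF elim], of "a N" "b N" \<alpha>] ab[OF elim] rates by simp
  qed
  with lim show ?thesis by (rule Lim_transform_eventually)
qed

lemma tv_dist_tendsto_high_density:
  fixes \<alpha> \<beta> :: real and a b :: "nat \<Rightarrow> nat" and \<mu> :: "nat \<Rightarrow> config pmf"
  assumes rates: "0 < \<beta>" "\<beta> < 1 / 2" "\<beta> < \<alpha>"
    and st: "\<And>N. N \<ge> 1 \<Longrightarrow> tasep_stationary N \<alpha> \<beta> (\<mu> N)"
    and ab: "\<And>N. N \<ge> 1 \<Longrightarrow> 1 \<le> a N \<and> a N \<le> b N \<and> b N \<le> N"
    and far: "filterlim a at_top sequentially"
  shows "(\<lambda>N. tv_dist {a N..b N} (marginal {a N..b N} (\<mu> N)) (Ber {a N..b N} (1 - \<beta>))) \<longlonglongrightarrow> 0"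
proof -
  have "filterlim (\<lambda>N. a N - 1) at_top sequentially"
    unfolding filterlim_at_top
  proof
    fix Z
    have "\<forall>\<^sub>F N in sequentially. Suc Z \<le> a N" using far by (simp add: filterlim_at_top)
    then show "\<forall>\<^sub>F N in sequentially. Z \<le> a N - 1" by eventually_elim simp
  qed
  moreover have "low_density \<beta> \<alpha>" using rates by unfold_locales
  ultimately have "(\<lambda>N. 1 / 2 * marginal_error \<beta> \<alpha> (N - b N) (Suc (b N) - a N) (a N - 1) \<beta>) \<longlonglongrightarrow> 1 / 2 * 0"
    by (intro tendsto_mult tendsto_const low_density.marginal_error_tendsto)
  then have lim: "(\<lambda>N. 1 / 2 * marginal_error \<beta> \<alpha> (N - b N) (Suc (b N) - a N) (a N - 1) \<beta>) \<longlonglongrightarrow> 0"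
    by simp
  have "\<forall>\<^sub>F N in sequentially. 1 / 2 * marginal_error \<beta> \<alpha> (N - b N) (Suc (b N) - a N) (a N - 1) \<beta>
      = tv_dist {a N..b N} (marginal {a N..b N} (\<mu> N)) (Ber {a N..b N} (1 - \<beta>))"
    using eventually_ge_at_top[of 1]
  proof eventually_elim
    case (elim N)
    then show ?case
      using tv_dist_stationary[OF elim _ _ st[OF elim], of "a N" "b N" "1 - \<beta>"] ab[OF elim] rates
        marginal_error_reflect[of \<alpha> \<beta> "a N - 1" "Suc (b N) - a N" "N - b N" "1 - \<beta>"]
      by simp
  qed
  with lim show ?thesis by (rule Lim_transform_eventually)
qed

theorem theorem1p8:
  fixes \<alpha> \<beta> :: real and a b :: "nat \<Rightarrow> nat" and \<mu> :: "nat \<Rightarrow> config pmf"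
  assumes "\<alpha> > 0" and "\<beta> > 0"
    and "\<And>N. N \<ge> 1 \<Longrightarrow> tasep_stationary N \<alpha> \<beta> (\<mu> N)"
    and "\<And>N. N \<ge> 1 \<Longrightarrow> 1 \<le> a N \<and> a N \<le> b N \<and> b N \<le> N"
  shows "(min \<alpha> \<beta> \<ge> 1 / 2 \<and>
          (\<exists>\<delta>>0. (\<forall>\<^sub>F N in sequentially. min (real (a N)) (real N - real (b N)) \<ge> \<delta> * real N) \<and>
                 much_greater (\<lambda>N. \<delta> * real N) (\<lambda>N. real (card {a N..b N})))
          \<longrightarrow> (\<lambda>N. tv_dist {a N..b N} (marginal {a N..b N} (\<mu> N)) (Ber {a N..b N} (1 / 2)))
                \<longlonglongrightarrow> 0)
       \<and> (\<alpha> < min (1 / 2) \<beta> \<and>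
          much_greater (\<lambda>N. real N - real (b N)) (\<lambda>N. real N powr (1 / 3) * ln (real N))
          \<longrightarrow> (\<lambda>N. tv_dist {a N..b N} (marginal {a N..b N} (\<mu> N)) (Ber {a N..b N} \<alpha>))
                \<longlonglongrightarrow> 0)
       \<and> (\<beta> < min (1 / 2) \<alpha> \<and>
          much_greater (\<lambda>N. real (a N)) (\<lambda>N. real N powr (1 / 3) * ln (real N))
          \<longrightarrow> (\<lambda>N. tv_dist {a N..b N} (marginal {a N..b N} (\<mu> N)) (Ber {a N..b N} (1 - \<beta>)))
                \<longlonglongrightarrow> 0)"
proof (intro conjI impI; (elim conjE)?)
  assume half: "min \<alpha> \<beta> \<ge> 1 / 2"
    and "\<exists>\<delta>>0. (\<forall>\<^sub>F N in sequentially. min (real (a N)) (real N - real (b N)) \<ge> \<delta> * real N) \<and>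
                 much_greater (\<lambda>N. \<delta> * real N) (\<lambda>N. real (card {a N..b N}))"
  then obtain \<delta> where \<delta>: "\<delta> > 0"
    "\<forall>\<^sub>F N in sequentially. min (real (a N)) (real N - real (b N)) \<ge> \<delta> * real N"
    "much_greater (\<lambda>N. \<delta> * real N) (\<lambda>N. real (card {a N..b N}))" by blast
  show "(\<lambda>N. tv_dist {a N..b N} (marginal {a N..b N} (\<mu> N)) (Ber {a N..b N} (1 / 2))) \<longlonglongrightarrow> 0"
    using half by (intro tv_dist_tendsto_maximal_current[OF _ _ assms(3,4) \<delta>]) auto
next
  assume low: "\<alpha> < min (1 / 2) \<beta>"
    and far: "much_greater (\<lambda>N. real N - real (b N)) (\<lambda>N. real N powr (1 / 3) * ln (real N))"
  have "filterlim (\<lambda>N. N - b N) at_top sequentially"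
    by (rule filterlim_nat_of_much_greater[OF far]) (use assms(4) in \<open>simp add: of_nat_diff\<close>)
  then show "(\<lambda>N. tv_dist {a N..b N} (marginal {a N..b N} (\<mu> N)) (Ber {a N..b N} \<alpha>)) \<longlonglongrightarrow> 0"
    using low assms(1) by (intro tv_dist_tendsto_low_density[OF _ _ _ assms(3,4)]) auto
next
  assume high: "\<beta> < min (1 / 2) \<alpha>"
    and far: "much_greater (\<lambda>N. real (a N)) (\<lambda>N. real N powr (1 / 3) * ln (real N))"
  have "filterlim a at_top sequentially"
    by (rule filterlim_nat_of_much_greater[OF far]) simp
  then show "(\<lambda>N. tv_dist {a N..b N} (marginal {a N..b N} (\<mu> N)) (Ber {a N..b N} (1 - \<beta>))) \<longlonglongrightarrow> 0"
    using high assms(2) by (intro tv_dist_tendsto_high_density[OF _ _ _ assms(3,4)]) auto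
qed

end
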